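(* Let $C_p$ be a cyclic group of prime order $p$. Then $$R^*_{\mathbb C}(C_p^k)=\frac{\mathbb Z[x_1,\cdots,x_k]}{(p x_i,\ x_i^p x_j-x_i x_j^p)},$$ where $C_p^k$ is the direct product of $k$ copies of $C_p$ and the indices $i,j$ in the relations range over $1,\dots,k$.
   Context: Let $G$ be a finite group. $R_{\mathbb C}(G)$ is the ring of virtual complex characters of $G$ (the free abelian group on the irreducible complex characters, with product induced by tensor product), with augmentation $\epsilon:R_{\mathbb C}(G)\to\mathbb Z$ the degree map and $I=\ker\epsilon$. Exterior powers of representations give maps $\lambda^n$ on characters, with $\lambda^0=1$ and $\lambda^1=\mathrm{id}$, extended to $R_{\mathbb C}(G)$ through the formula $\lambda^n(x+y)=\sum_{a+b=n}\lambda^a(x)\lambda^b(y)$. Put $\gamma^n(x)=\lambda^n(x+n-1)$. Let $\Gamma^n\subseteq R_{\mathbb C}(G)$ be the additive subgroup generated by all products $\gamma^{i_1}(y_1)\cdots\gamma^{i_r}(y_r)$ with $y_j\in I$ and $\sum_j i_j\ge n$; then $\Gamma^0=R_{\mathbb C}(G)$, $\Gamma^1=I$ and $\Gamma^m\Gamma^n\subseteq\Gamma^{m+n}$. The graded character ring of $G$ over $\mathbb C$ is $R^*_{\mathbb C}(G)=\bigoplus_{n\ge0}\Gamma^n/\Gamma^{n+1}$. The displayed equality is a presentation of this ring by generators and relations (an isomorphism of rings). *)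

theory Defs
  imports
    "Jordan_Normal_Form.VS_Connect"
    "HOL-Algebra.Product_Groups"
    "HOL-Algebra.QuotRing"
    "HOL-Library.Poly_Mapping"
begin

section \<open>Complex matrix representations and their characters\<close>

definition representation :: "('a, 'b) monoid_scheme \<Rightarrow> nat \<Rightarrow> ('a \<Rightarrow> complex mat) \<Rightarrow> bool" where
  "representation G d \<rho> \<longleftrightarrow> \<rho> \<in> hom G (units_of (ring_mat TYPE(complex) d ()))"

definition irreducible_rep :: "('a, 'b) monoid_scheme \<Rightarrow> nat \<Rightarrow> ('a \<Rightarrow> complex mat) \<Rightarrow> bool" where
  "irreducible_rep G d \<rho> \<longleftrightarrow> representation G d \<rho> \<and> d > 0 \<and>
     (\<forall>W. VectorSpace.subspace class_ring W (module_vec TYPE(complex) d) \<and>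
          (\<forall>g\<in>carrier G. \<forall>w\<in>W. \<rho> g *\<^sub>v w \<in> W) \<longrightarrow>
          W = {0\<^sub>v d} \<or> W = carrier_vec d)"

definition mat_trace :: "complex mat \<Rightarrow> complex" where
  "mat_trace A = (\<Sum>i<dim_row A. A $$ (i, i))"

definition rep_character :: "('a, 'b) monoid_scheme \<Rightarrow> ('a \<Rightarrow> complex mat) \<Rightarrow> 'a \<Rightarrow> complex" where
  "rep_character G \<rho> = (\<lambda>g\<in>carrier G. mat_trace (\<rho> g))"

text \<open>The increasing sequences \<open>i\<^sub>1 < \<dots> < i\<^sub>n\<close> in \<open>{0..<d}\<close>; they index the standard basis
  \<open>e_(i\<^sub>1) \<and> \<dots> \<and> e_(i\<^sub>n)\<close> of the \<open>n\<close>-th exterior power of a \<open>d\<close>-dimensional space.\<close>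

definition ext_basis :: "nat \<Rightarrow> nat \<Rightarrow> nat list list" where
  "ext_basis d n = filter (\<lambda>is. length is = n) (subseqs [0..<d])"

text \<open>The matrix of the \<open>n\<close>-th exterior power of \<open>A\<close> in this basis: its entries are the
  \<open>n \<times> n\<close> minors of \<open>A\<close>. For \<open>n = 0\<close> this is the \<open>1 \<times> 1\<close> identity matrix.\<close>

definition ext_power_mat :: "nat \<Rightarrow> complex mat \<Rightarrow> complex mat" where
  "ext_power_mat n A = (let B = ext_basis (dim_row A) n in
     mat (length B) (length B)
       (\<lambda>(a, b). det (mat n n (\<lambda>(i, j). A $$ (B ! a ! i, B ! b ! j)))))"

definition ext_power_rep :: "nat \<Rightarrow> ('a \<Rightarrow> complex mat) \<Rightarrow> 'a \<Rightarrow> complex mat" where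
  "ext_power_rep n \<rho> = (\<lambda>g. ext_power_mat n (\<rho> g))"


section \<open>The ring of virtual characters\<close>

text \<open>Complex functions on \<open>G\<close> with pointwise operations. The trace of a tensor product of two
  matrices is the product of their traces, so tensor products of representations induce the
  pointwise product of characters.\<close>

definition function_ring :: "('a, 'b) monoid_scheme \<Rightarrow> ('a \<Rightarrow> complex) ring" where
  "function_ring G =
     \<lparr>carrier = carrier G \<rightarrow>\<^sub>E UNIV,
      mult = (\<lambda>x y. \<lambda>g\<in>carrier G. x g * y g),
      one = (\<lambda>g\<in>carrier G. 1),
      zero = (\<lambda>g\<in>carrier G. 0),
      add = (\<lambda>x y. \<lambda>g\<in>carrier G. x g + y g)\<rparr>"

definition irr_characters :: "('a, 'b) monoid_scheme \<Rightarrow> ('a \<Rightarrow> complex) set" where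
  "irr_characters G = {rep_character G \<rho> | d \<rho>. irreducible_rep G d \<rho>}"

text \<open>The integral span of the irreducible characters inside the functions on \<open>G\<close>. Irreducible
  characters are linearly independent functions, so for finite \<open>G\<close> this is the free abelian group
  on them.\<close>

definition char_ring :: "('a, 'b) monoid_scheme \<Rightarrow> ('a \<Rightarrow> complex) ring" where
  "char_ring G = (function_ring G)
     \<lparr>carrier := generate (add_monoid (function_ring G)) (irr_characters G)\<rparr>"

text \<open>The degree of a representation is the value of its character at the identity.\<close>

definition augmentation :: "('a, 'b) monoid_scheme \<Rightarrow> ('a \<Rightarrow> complex) \<Rightarrow> int" where
  "augmentation G x = (THE d. of_int d = x \<one>\<^bsub>G\<^esub>)"

definition aug_ideal :: "('a, 'b) monoid_scheme \<Rightarrow> ('a \<Rightarrow> complex) set" where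
  "aug_ideal G = {x \<in> carrier (char_ring G). augmentation G x = 0}"


section \<open>Lambda and gamma operations, and the gamma filtration\<close>

definition lambda_family ::
  "('a, 'b) monoid_scheme \<Rightarrow> (nat \<Rightarrow> ('a \<Rightarrow> complex) \<Rightarrow> 'a \<Rightarrow> complex) \<Rightarrow> bool" where
  "lambda_family G L \<longleftrightarrow>
     (\<forall>n. L n \<in> carrier (char_ring G) \<rightarrow>\<^sub>E carrier (char_ring G)) \<and>
     (\<forall>n d \<rho>. representation G d \<rho> \<longrightarrow>
        L n (rep_character G \<rho>) = rep_character G (ext_power_rep n \<rho>)) \<and>
     (\<forall>x\<in>carrier (char_ring G). L 0 x = \<one>\<^bsub>char_ring G\<^esub>) \<and>
     (\<forall>x\<in>carrier (char_ring G). L 1 x = x) \<and>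
     (\<forall>n. \<forall>x\<in>carrier (char_ring G). \<forall>y\<in>carrier (char_ring G).
        L n (x \<oplus>\<^bsub>char_ring G\<^esub> y) =
          (\<Oplus>\<^bsub>char_ring G\<^esub>a\<in>{..n}. L a x \<otimes>\<^bsub>char_ring G\<^esub> L (n - a) y))"

text \<open>For finite \<open>G\<close> there is exactly one such family: every virtual character is a difference of
  two characters, and the addition formula determines \<open>L n\<close> on it by recursion on \<open>n\<close>. The
  values off \<open>char_ring G\<close> are fixed by the extensionality in \<^const>\<open>lambda_family\<close>.\<close>

definition lambda_op ::
  "('a, 'b) monoid_scheme \<Rightarrow> nat \<Rightarrow> ('a \<Rightarrow> complex) \<Rightarrow> 'a \<Rightarrow> complex" where
  "lambda_op G = (THE L. lambda_family G L)"

text \<open>The integer \<open>n - 1\<close> is \<open>-1\<close> for \<open>n = 0\<close>.\<close>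

definition gamma_op ::
  "('a, 'b) monoid_scheme \<Rightarrow> nat \<Rightarrow> ('a \<Rightarrow> complex) \<Rightarrow> 'a \<Rightarrow> complex" where
  "gamma_op G n x = lambda_op G n
     (x \<oplus>\<^bsub>char_ring G\<^esub> add_pow (char_ring G) (int n - 1) \<one>\<^bsub>char_ring G\<^esub>)"

definition gamma_products :: "('a, 'b) monoid_scheme \<Rightarrow> nat \<Rightarrow> ('a \<Rightarrow> complex) set" where
  "gamma_products G n =
     {foldr (\<lambda>(i, y) z. gamma_op G i y \<otimes>\<^bsub>char_ring G\<^esub> z) iys \<one>\<^bsub>char_ring G\<^esub> | iys.
        snd ` set iys \<subseteq> aug_ideal G \<and> sum_list (map fst iys) \<ge> n}"

definition gamma_filtration :: "('a, 'b) monoid_scheme \<Rightarrow> nat \<Rightarrow> ('a \<Rightarrow> complex) set" where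
  "gamma_filtration G n = generate (add_monoid (char_ring G)) (gamma_products G n)"


section \<open>The graded character ring\<close>

definition graded_piece :: "('a, 'b) monoid_scheme \<Rightarrow> nat \<Rightarrow> ('a \<Rightarrow> complex) set monoid" where
  "graded_piece G n =
     add_monoid ((char_ring G)\<lparr>carrier := gamma_filtration G n\<rparr>) Mod gamma_filtration G (Suc n)"

text \<open>The product of the class of \<open>x\<close> in degree \<open>i\<close> with the class of \<open>y\<close> in degree \<open>j\<close> is the
  class of \<open>x y\<close> in degree \<open>i + j\<close>.\<close>

definition graded_char_ring :: "('a, 'b) monoid_scheme \<Rightarrow> (nat \<Rightarrow> ('a \<Rightarrow> complex) set) ring" where
  "graded_char_ring G =
     \<lparr>carrier = carrier (sum_group UNIV (graded_piece G)),
      mult = (\<lambda>a b n. \<Otimes>\<^bsub>graded_piece G n\<^esub>i\<in>{..n}.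
                rcoset_mult (char_ring G) (gamma_filtration G (Suc n)) (a i) (b (n - i))),
      one = (\<lambda>n. if n = 0
                  then gamma_filtration G 1 +>\<^bsub>char_ring G\<^esub> \<one>\<^bsub>char_ring G\<^esub>
                  else \<one>\<^bsub>graded_piece G n\<^esub>),
      zero = \<one>\<^bsub>sum_group UNIV (graded_piece G)\<^esub>,
      add = (\<lambda>a b. a \<otimes>\<^bsub>sum_group UNIV (graded_piece G)\<^esub> b)\<rparr>"


section \<open>Integral polynomials in finitely many variables\<close>

text \<open>Polynomials are finitely supported integer functions on monomials, and monomials are finitely
  supported exponent functions \<open>nat \<Rightarrow>\<^sub>0 nat\<close>; multiplication in \<open>\<Rightarrow>\<^sub>0\<close> is convolution.\<close>

type_synonym int_mpoly = "(nat \<Rightarrow>\<^sub>0 nat) \<Rightarrow>\<^sub>0 int"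

definition mpoly_ring :: "nat \<Rightarrow> int_mpoly ring" where
  "mpoly_ring k = class_ring\<lparr>carrier := {P. \<forall>m\<in>Poly_Mapping.keys P. Poly_Mapping.keys m \<subseteq> {1..k}}\<rparr>"

definition mpoly_var :: "nat \<Rightarrow> int_mpoly" where
  "mpoly_var i = Poly_Mapping.single (Poly_Mapping.single i 1) 1"

definition elementary_abelian_relations :: "nat \<Rightarrow> nat \<Rightarrow> int_mpoly set" where
  "elementary_abelian_relations p k =
     {of_nat p * mpoly_var i | i. i \<in> {1..k}} \<union>
     {mpoly_var i ^ p * mpoly_var j - mpoly_var i * mpoly_var j ^ p | i j. i \<in> {1..k} \<and> j \<in> {1..k}}"

end

theory Submission
  imports Defs "HOL-Number_Theory.Residues" "HOL-Computational_Algebra.Polynomial_FPS"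
    "Jordan_Normal_Form.Schur_Decomposition"
begin

text \<open>Let \<open>x\<^sub>i\<close> be the character of order \<open>p\<close> of the \<open>i\<close>-th factor and \<open>u\<^sub>i = x\<^sub>i - 1\<close>. From
  \<open>\<lambda>\<^sup>n(z + \<chi>) = \<lambda>\<^sup>n(z) + \<chi> \<lambda>\<^sup>n\<^sup>-\<^sup>1(z)\<close> for a linear character \<open>\<chi>\<close> one gets
  \<open>\<gamma>\<^sup>n(y + \<chi> - 1) = \<gamma>\<^sup>n(y) + (\<chi> - 1) \<gamma>\<^sup>n\<^sup>-\<^sup>1(y)\<close>, so the gamma filtration is the filtration by powers of
  the augmentation ideal, and the \<open>u\<^sub>i\<close> generate the graded ring. The equation
  \<open>(1 + u\<^sub>i)\<^sup>p = 1\<close> puts \<open>p u\<^sub>i + u\<^sub>i\<^sup>p\<close> into degree \<open>p + 1\<close>, which yields the relations.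

  Conversely let \<open>f\<close> be homogeneous of degree \<open>n > 0\<close> with \<open>f(u)\<close> of filtration degree \<open>n + 1\<close>.
  Restricting to the cyclic subgroup of direction \<open>a\<close> shows that, for some integral polynomial \<open>h\<close>
  and an integral lift \<open>H\<close> of the value \<open>H(1) = f(a)\<close>, the polynomial \<open>H - (X - 1) h\<close> vanishes at all
  \<open>p\<close>-th roots of unity other than \<open>1\<close>; summing over all \<open>p\<close>-th roots of unity gives \<open>p | f(a)\<close>.
  Modulo the relations a monomial depends only on its degree and on the function that it
  defines on \<open>F\<^sub>p\<^sup>k\<close>, and these functions are linearly independent. Hence \<open>f\<close> lies in the ideal.\<close>

section \<open>Integral polynomials\<close>

text \<open>The operations are specified by a \<open>THE\<close>, so existence and uniqueness must
  both be settled before any value can be computed. Existence meets two obstacles. Virtual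
  characters have negative multiplicities; binomial series with complex exponents absorb them. And
  \<open>\<lambda>\<close> has to agree with minors on every representation, not only on diagonal
  ones; this calls for multiplicities shared by all group elements, and they come from the
  determinants of \<open>1 + (x - 1) P\<close> for the isotypic projections \<open>P\<close>.

  The substitution of \<open>u_i\<close> for \<open>x_i\<close> is far from injective, since
  \<open>(1 + u_i)^p = 1\<close>. Membership in the filtration is therefore tested on values, and
  the kernel in degree \<open>n\<close> consists of the homogeneous polynomials whose values are
  also those of a polynomial of higher order.

  Distinct monomials of one degree may define the same function on \<open>F_p^k\<close>. To identify
  them modulo the relations, one variable of the monomial serves as a reservoir for the degree
  removed from the others. Degree 0 is exceptional: the constant \<open>p\<close> is not a relation,
  and the constant term is recovered exactly from the value at the identity.\<close>

abbreviation "lookup \<equiv> Poly_Mapping.lookup"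
abbreviation "keys \<equiv> Poly_Mapping.keys"
abbreviation "single \<equiv> Poly_Mapping.single"

definition mon_deg :: "(nat \<Rightarrow>\<^sub>0 nat) \<Rightarrow> nat" where
  "mon_deg m = (\<Sum>i\<in>keys m. lookup m i)"

definition mon_eval :: "(nat \<Rightarrow> 'b::comm_ring_1) \<Rightarrow> (nat \<Rightarrow>\<^sub>0 nat) \<Rightarrow> 'b" where
  "mon_eval z m = (\<Prod>i\<in>keys m. z i ^ lookup m i)"

definition mpoly_eval :: "(nat \<Rightarrow> 'b::comm_ring_1) \<Rightarrow> int_mpoly \<Rightarrow> 'b" where
  "mpoly_eval z P = (\<Sum>m\<in>keys P. of_int (lookup P m) * mon_eval z m)"

definition hom_part :: "nat \<Rightarrow> int_mpoly \<Rightarrow> int_mpoly" where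
  "hom_part n P = (\<Sum>m | m \<in> keys P \<and> mon_deg m = n. single m (lookup P m))"

text \<open>A sum and its summands have different supports, so additivity is compared over a common
  finite index set.\<close>

lemma mon_deg_superset: "finite S \<Longrightarrow> keys m \<subseteq> S \<Longrightarrow> mon_deg m = (\<Sum>i\<in>S. lookup m i)"
  unfolding mon_deg_def by (rule sum.mono_neutral_left) (auto simp: in_keys_iff)

lemma mon_eval_superset: "finite S \<Longrightarrow> keys m \<subseteq> S \<Longrightarrow> mon_eval z m = (\<Prod>i\<in>S. z i ^ lookup m i)"
  unfolding mon_eval_def by (rule prod.mono_neutral_left) (auto simp: in_keys_iff)

lemma mon_deg_add: "mon_deg (m + m') = mon_deg m + mon_deg m'"
  using Poly_Mapping.keys_add[of m m']
  by (subst (1 2 3) mon_deg_superset[of "keys m \<union> keys m'"])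
     (auto simp: lookup_add sum.distrib)

lemma mon_eval_add: "mon_eval z (m + m') = mon_eval z m * mon_eval z m'"
  using Poly_Mapping.keys_add[of m m']
  by (subst (1 2 3) mon_eval_superset[of "keys m \<union> keys m'"])
     (auto simp: lookup_add prod.distrib power_add)

lemma mon_deg_single [simp]: "mon_deg (single i n) = n"
  by (subst mon_deg_superset[of "{i}"]) auto

lemma mon_eval_single [simp]: "mon_eval z (single i n) = z i ^ n"
  by (subst mon_eval_superset[of "{i}"]) auto

lemma mon_deg_0 [simp]: "mon_deg 0 = 0" and mon_eval_0 [simp]: "mon_eval z 0 = 1"
  by (auto simp: mon_deg_def mon_eval_def)

lemma mpoly_sum_monomials: "(\<Sum>m\<in>keys P. single m (lookup P m)) = (P :: int_mpoly)"
proof (rule poly_mapping_eqI)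
  fix m show "lookup (\<Sum>m\<in>keys P. single m (lookup P m)) m = lookup P m"
    by (auto simp: lookup_sum lookup_single when_def in_keys_iff)
qed

lemma mpoly_eval_superset:
  "finite S \<Longrightarrow> keys P \<subseteq> S \<Longrightarrow> mpoly_eval z P = (\<Sum>m\<in>S. of_int (lookup P m) * mon_eval z m)"
  unfolding mpoly_eval_def by (rule sum.mono_neutral_left) (auto simp: in_keys_iff)

lemma mpoly_eval_add: "mpoly_eval z (P + Q) = mpoly_eval z P + mpoly_eval z Q"
  using Poly_Mapping.keys_add[of P Q]
  by (subst (1 2 3) mpoly_eval_superset[of "keys P \<union> keys Q"])
     (auto simp: lookup_add sum.distrib algebra_simps)

lemma mpoly_eval_single [simp]: "mpoly_eval z (single m c) = of_int c * mon_eval z m"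
  by (subst mpoly_eval_superset[of "{m}"]) auto

lemma mpoly_eval_0 [simp]: "mpoly_eval z 0 = 0"
  by (simp add: mpoly_eval_def)

lemma mpoly_eval_1 [simp]: "mpoly_eval z 1 = 1"
  using mpoly_eval_single[of z 0 1] by (simp del: mpoly_eval_single)

lemma mpoly_eval_uminus: "mpoly_eval z (- P) = - mpoly_eval z P"
  using mpoly_eval_add[of z P "- P"] by (simp add: add_eq_0_iff)

lemma mpoly_eval_diff: "mpoly_eval z (P - Q) = mpoly_eval z P - mpoly_eval z Q"
  using mpoly_eval_add[of z P "- Q"] by (simp add: mpoly_eval_uminus)

lemma mpoly_eval_sum: "mpoly_eval z (\<Sum>i\<in>A. f i) = (\<Sum>i\<in>A. mpoly_eval z (f i))"
  by (induction A rule: infinite_finite_induct) (auto simp: mpoly_eval_add)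

text \<open>Convolution as a double sum of monomials reduces statements on products, for evaluation
  and for \<open>hom_part\<close>, to single monomials.\<close>

lemma mpoly_mult_monomials:
  "P * Q = (\<Sum>m\<in>keys P. \<Sum>m'\<in>keys Q. single (m + m') (lookup P m * lookup Q m'))"
  for P Q :: int_mpoly
  by (subst mpoly_sum_monomials[of P, symmetric], subst mpoly_sum_monomials[of Q, symmetric])
     (simp add: sum_product mult_single)

lemma mpoly_eval_mult: "mpoly_eval z (P * Q) = mpoly_eval z P * mpoly_eval z Q"
proof -
  have "mpoly_eval z (P * Q) = (\<Sum>m\<in>keys P. \<Sum>m'\<in>keys Q.
      of_int (lookup P m * lookup Q m') * mon_eval z (m + m'))"
    by (simp only: mpoly_mult_monomials[of P Q] mpoly_eval_sum mpoly_eval_single)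
  then show ?thesis
    by (simp add: mpoly_eval_def sum_product mon_eval_add mult_ac)
qed

lemma mpoly_eval_power: "mpoly_eval z (P ^ n) = mpoly_eval z P ^ n"
  by (induction n) (auto simp: mpoly_eval_mult)

lemma mpoly_eval_var [simp]: "mpoly_eval z (mpoly_var i) = z i"
  by (simp add: mpoly_var_def)

section \<open>Homogeneous components\<close>

lemma lookup_hom_part: "lookup (hom_part n P) m = (if mon_deg m = n then lookup P m else 0)"
  by (auto simp: hom_part_def lookup_sum lookup_single when_def in_keys_iff)

lemma keys_hom_part: "keys (hom_part n P) = {m \<in> keys P. mon_deg m = n}"
  by (auto simp: in_keys_iff lookup_hom_part split: if_splits)

lemma hom_part_add: "hom_part n (P + Q) = hom_part n P + hom_part n Q"
  by (rule poly_mapping_eqI) (auto simp: lookup_hom_part lookup_add)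

lemma hom_part_0 [simp]: "hom_part n 0 = 0"
  by (simp add: hom_part_def)

lemma hom_part_uminus: "hom_part n (- P) = - hom_part n P"
  by (rule poly_mapping_eqI) (auto simp: lookup_hom_part)

lemma hom_part_diff: "hom_part n (P - Q) = hom_part n P - hom_part n Q"
  by (rule poly_mapping_eqI) (auto simp: lookup_hom_part lookup_minus)

lemma hom_part_single: "hom_part n (single m c) = (if mon_deg m = n then single m c else 0)"
  by (rule poly_mapping_eqI) (auto simp: lookup_hom_part lookup_single when_def)

lemma hom_part_sum: "hom_part n (\<Sum>i\<in>A. f i) = (\<Sum>i\<in>A. hom_part n (f i))"
  by (induction A rule: infinite_finite_induct) (auto simp: hom_part_add)

lemma hom_part_mult: "hom_part n (P * Q) = (\<Sum>i\<le>n. hom_part i P * hom_part (n - i) Q)"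
proof -
  have hp: "hom_part i P = (\<Sum>m\<in>keys P. hom_part i (single m (lookup P m)))" for i P
    by (subst mpoly_sum_monomials[of P, symmetric], subst hom_part_sum) simp
  \<comment> \<open>Only \<open>i = mon_deg m\<close> contributes, and the bound
    \<open>i \<le> n\<close> makes the truncated difference \<open>n - i\<close> exact. If
    \<open>m\<close> already has degree above \<open>n\<close>, no index qualifies and both sides
    vanish.\<close>
  have *: "(\<Sum>i\<le>n. hom_part i (single m c) * hom_part (n - i) (single m' c'))
      = hom_part n (single (m + m') (c * c'))" for m m' :: "nat \<Rightarrow>\<^sub>0 nat" and c c' :: int
  proof (cases "mon_deg m \<le> n")
    case True
    have "(\<Sum>i\<le>n. hom_part i (single m c) * hom_part (n - i) (single m' c'))
      = (\<Sum>i\<in>{mon_deg m}. hom_part i (single m c) * hom_part (n - i) (single m' c'))"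
      using True by (intro sum.mono_neutral_right) (auto simp: hom_part_single)
    then show ?thesis using True
      by (auto simp: hom_part_single mon_deg_add mult_single)
  next
    case False
    then show ?thesis by (auto simp: hom_part_single mon_deg_add intro!: sum.neutral)
  qed
  have "(\<Sum>i\<le>n. hom_part i P * hom_part (n - i) Q) =
     (\<Sum>i\<le>n. \<Sum>m\<in>keys P. \<Sum>m'\<in>keys Q. hom_part i (single m (lookup P m)) * hom_part (n - i) (single m' (lookup Q m')))"
    by (subst hp, subst (2) hp) (simp add: sum_product)
  also have "\<dots> = (\<Sum>m\<in>keys P. \<Sum>m'\<in>keys Q. \<Sum>i\<le>n. hom_part i (single m (lookup P m)) * hom_part (n - i) (single m' (lookup Q m')))"
    by (subst sum.swap, rule sum.cong[OF refl], subst sum.swap, rule refl)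
  also have "\<dots> = hom_part n (P * Q)"
    by (simp only: * mpoly_mult_monomials[of P Q] hom_part_sum)
  finally show ?thesis by simp
qed

lemma mpoly_sum_hom_parts:
  assumes "\<And>m. m \<in> keys P \<Longrightarrow> mon_deg m < N"
  shows "(\<Sum>n<N. hom_part n P) = P"
  using assms by (intro poly_mapping_eqI) (auto simp: lookup_sum lookup_hom_part in_keys_iff)

lemma hom_part_1: "hom_part n 1 = (if n = 0 then 1 else 0)"
  using hom_part_single[of n 0 1] by auto

section \<open>The ring of integral polynomials in k variables and its ideals\<close>

lemma in_mpoly_ring_iff: "P \<in> carrier (mpoly_ring k) \<longleftrightarrow> (\<forall>m\<in>keys P. keys m \<subseteq> {1..k})"
  by (simp add: mpoly_ring_def)

lemma mpoly_ring_simps [simp]: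
  "monoid.mult (mpoly_ring k) = (*)" "add (mpoly_ring k) = (+)" "one (mpoly_ring k) = 1"
  "zero (mpoly_ring k) = 0"
  by (simp_all add: mpoly_ring_def)

lemma mpoly_ring_add: "P \<in> carrier (mpoly_ring k) \<Longrightarrow> Q \<in> carrier (mpoly_ring k) \<Longrightarrow> P + Q \<in> carrier (mpoly_ring k)"
  using Poly_Mapping.keys_add[of P Q] unfolding in_mpoly_ring_iff by blast

lemma mpoly_ring_uminus: "P \<in> carrier (mpoly_ring k) \<Longrightarrow> - P \<in> carrier (mpoly_ring k)"
  unfolding in_mpoly_ring_iff by simp

lemma mpoly_ring_0: "0 \<in> carrier (mpoly_ring k)"
  unfolding in_mpoly_ring_iff by simp

lemma mpoly_ring_single: "keys m \<subseteq> {1..k} \<Longrightarrow> single m c \<in> carrier (mpoly_ring k)"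
  unfolding in_mpoly_ring_iff by simp

lemma mpoly_ring_1: "1 \<in> carrier (mpoly_ring k)"
  unfolding in_mpoly_ring_iff by simp

lemma mpoly_ring_mult:
  assumes "P \<in> carrier (mpoly_ring k)" "Q \<in> carrier (mpoly_ring k)"
  shows "P * Q \<in> carrier (mpoly_ring k)"
  unfolding in_mpoly_ring_iff
proof
  fix m assume "m \<in> keys (P * Q)"
  then obtain a b where "m = a + b" "a \<in> keys P" "b \<in> keys Q"
    using Poly_Mapping.keys_mult[of P Q] by blast
  then show "keys m \<subseteq> {1..k}"
    using assms Poly_Mapping.keys_add[of a b] unfolding in_mpoly_ring_iff by blast
qed

lemma mpoly_ring_diff: "P \<in> carrier (mpoly_ring k) \<Longrightarrow> Q \<in> carrier (mpoly_ring k) \<Longrightarrow> P - Q \<in> carrier (mpoly_ring k)"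
  using mpoly_ring_add[of P k "- Q"] mpoly_ring_uminus by simp

lemma mpoly_ring_power: "P \<in> carrier (mpoly_ring k) \<Longrightarrow> P ^ n \<in> carrier (mpoly_ring k)"
  by (induction n) (auto intro: mpoly_ring_mult mpoly_ring_1)

lemma mpoly_ring_sum: "(\<And>i. i \<in> A \<Longrightarrow> f i \<in> carrier (mpoly_ring k)) \<Longrightarrow> sum f A \<in> carrier (mpoly_ring k)"
  by (induction A rule: infinite_finite_induct) (auto intro: mpoly_ring_add mpoly_ring_0)

lemma mpoly_ring_var: "i \<in> {1..k} \<Longrightarrow> mpoly_var i \<in> carrier (mpoly_ring k)"
  by (auto simp: mpoly_var_def intro: mpoly_ring_single)

lemma mpoly_ring_hom_part: "P \<in> carrier (mpoly_ring k) \<Longrightarrow> hom_part n P \<in> carrier (mpoly_ring k)"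
  unfolding in_mpoly_ring_iff keys_hom_part by blast

lemma cring_mpoly_ring: "cring (mpoly_ring k)"
proof (rule cringI)
  show "abelian_group (mpoly_ring k)"
    by (rule abelian_groupI)
      (auto simp: algebra_simps mpoly_ring_add mpoly_ring_0 intro: bexI[OF _ mpoly_ring_uminus])
  show "comm_monoid (mpoly_ring k)"
    by (rule comm_monoidI) (auto simp: algebra_simps mpoly_ring_mult mpoly_ring_1)
qed (auto simp: algebra_simps)

lemma ideal_mpoly_ringD:
  assumes "ideal J (mpoly_ring k)"
  shows "0 \<in> J" "P \<in> J \<Longrightarrow> Q \<in> J \<Longrightarrow> P + Q \<in> J" "P \<in> J \<Longrightarrow> - P \<in> J"
    "P \<in> J \<Longrightarrow> Q \<in> J \<Longrightarrow> P - Q \<in> J"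
    "P \<in> J \<Longrightarrow> Q \<in> carrier (mpoly_ring k) \<Longrightarrow> P * Q \<in> J"
    "J \<subseteq> carrier (mpoly_ring k)"
proof -
  interpret ideal J "mpoly_ring k" by fact
  show 0: "0 \<in> J" using additive_subgroup.zero_closed[OF is_additive_subgroup] by simp
  show add: "P + Q \<in> J" if "P \<in> J" "Q \<in> J" for P Q
    using additive_subgroup.a_closed[OF is_additive_subgroup that] by simp
  show J: "J \<subseteq> carrier (mpoly_ring k)" using a_subset .
  show mult: "P * Q \<in> J" if "P \<in> J" "Q \<in> carrier (mpoly_ring k)" for P Q
    using I_r_closed that by simp
  show neg: "- P \<in> J" if "P \<in> J" for P
    using mult[OF that mpoly_ring_uminus[OF mpoly_ring_1]] by simp
  show "P \<in> J \<Longrightarrow> Q \<in> J \<Longrightarrow> P - Q \<in> J"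
    using add[of P "- Q"] neg by simp
qed

lemma ideal_mpoly_ring_sum:
  assumes "ideal J (mpoly_ring k)"
  shows "(\<And>i. i \<in> A \<Longrightarrow> f i \<in> J) \<Longrightarrow> sum f A \<in> J"
  by (induction A rule: infinite_finite_induct) (auto intro: ideal_mpoly_ringD[OF assms])

section \<open>Monomials modulo the relations\<close>

text \<open>Over the field of \<open>p\<close> elements a nonzero polynomial has at most as many
  roots as its degree. Splitting off \<open>X - a\<close> leaves a quotient that vanishes at the
  other points, because elements of \<open>A\<close> are incongruent modulo \<open>p\<close> and
  differences of distinct ones can be cancelled.\<close>

lemma poly_roots_mod_prime:
  fixes f :: "int poly"
  assumes "prime p" "finite A" "A \<subseteq> {0..<int p}" "\<And>a. a \<in> A \<Longrightarrow> int p dvd poly f a"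
    and "Polynomial.degree f < card A"
  shows "int p dvd Polynomial.coeff f i"
  using assms(2-)
proof (induction A arbitrary: f i rule: finite_induct)
  case (insert a A)
  define q where "q = synthetic_div f a"
  have f: "f = [:- a, 1:] * q + [:poly f a:]"
    using synthetic_div_correct'[of a f] by (simp add: q_def)
  have pa: "int p dvd poly f a" using insert by auto
  \<comment> \<open>When no points remain, the induction hypothesis would ask for a degree below 0;
    here \<open>f\<close> is constant and its quotient is zero.\<close>
  have q: "int p dvd Polynomial.coeff q j" for j
  proof (cases "A = {}")
    case True
    then have "Polynomial.degree f = 0" using insert by simp
    then have "q = 0" by (simp add: q_def synthetic_div_eq_0_iff)
    then show ?thesis by simp
  next
    case False
    show ?thesis
    proof (rule insert.IH)
      show "A \<subseteq> {0..<int p}" using insert by auto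
      have "card A > 0" using insert.hyps False by (simp add: card_gt_0_iff)
      moreover have "Polynomial.degree f < Suc (card A)" using insert.prems insert.hyps by simp
      ultimately show "Polynomial.degree q < card A"
        unfolding q_def degree_synthetic_div by linarith
      fix b assume b: "b \<in> A"
      have "int p dvd poly f b" using insert b by auto
      moreover have "poly f b = (b - a) * poly q b + poly f a"
        by (subst f) (simp add: algebra_simps)
      ultimately have "int p dvd (b - a) * poly q b + poly f a" by simp
      then have "int p dvd (b - a) * poly q b" using pa
        by (simp add: dvd_add_left_iff)
      moreover have "\<not> int p dvd (b - a)"
      proof
        assume "int p dvd b - a"
        moreover have "\<bar>b - a\<bar> < int p"
        proof -
          have "a \<in> {0..<int p}" "b \<in> {0..<int p}" using insert.prems b by auto
          then show ?thesis by auto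
        qed
        ultimately have "b - a = 0" using zdvd_imp_le[of "int p" "\<bar>b - a\<bar>"] by fastforce
        then show False using insert b by auto
      qed
      ultimately show "int p dvd poly q b"
        using assms(1) prime_dvd_mult_iff[of "int p"] by auto
    qed
  qed
  have "Polynomial.coeff f i = Polynomial.coeff ([:- a, 1:] * q) i + Polynomial.coeff [:poly f a:] i"
    by (subst f) (simp only: coeff_add)
  moreover have "Polynomial.coeff ([:- a, 1:] * q) i = - a * Polynomial.coeff q i + (case i of 0 \<Rightarrow> 0 | Suc j \<Rightarrow> Polynomial.coeff q j)"
    by (cases i) (auto simp: coeff_pCons)
  moreover have "int p dvd Polynomial.coeff [:poly f a:] i" using pa by (cases i) auto
  moreover have "int p dvd - a * Polynomial.coeff q i" using q[of i] by simp
  moreover have "int p dvd (case i of 0 \<Rightarrow> 0 | Suc j \<Rightarrow> Polynomial.coeff q j)"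
    using q by (cases i) auto
  ultimately show ?case by (simp only: dvd_add)
qed auto

text \<open>Induction on the variables: with the other coordinates fixed, the remaining polynomial
  in one variable has degree below \<open>p\<close> and vanishes at all \<open>p\<close> residues,
  so its coefficients vanish modulo \<open>p\<close> as functions of the other coordinates.\<close>

lemma monomials_independent_mod_prime:
  fixes c :: "('i \<Rightarrow> nat) \<Rightarrow> int"
  assumes p: "prime p" and "finite I"
    and "\<And>a. a \<in> (\<Pi>\<^sub>E i\<in>I. {0..<p}) \<Longrightarrow>
      int p dvd (\<Sum>e\<in>(\<Pi>\<^sub>E i\<in>I. {0..<p}). c e * (\<Prod>i\<in>I. int (a i) ^ e i))"
    and "e \<in> (\<Pi>\<^sub>E i\<in>I. {0..<p})"
  shows "int p dvd c e"
  using assms(2-)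
proof (induction I arbitrary: c e rule: finite_induct)
  case empty
  then show ?case by auto
next
  case (insert j I)
  let ?E = "\<Pi>\<^sub>E i\<in>I. {0..<p}"
  let ?E' = "\<Pi>\<^sub>E i\<in>insert j I. {0..<p}"
  have E': "(\<Sum>e\<in>?E'. h e) = (\<Sum>x<p. \<Sum>e\<in>?E. h (e(j := x)))" for h :: "('i \<Rightarrow> nat) \<Rightarrow> int"
  proof -
    have "(\<Sum>e\<in>?E'. h e) = (\<Sum>(x, e)\<in>{0..<p} \<times> ?E. h (e(j := x)))"
      unfolding PiE_insert_eq
      by (subst sum.reindex[OF inj_combinator[OF insert.hyps(2)]]) (simp add: case_prod_beta o_def)
    also have "\<dots> = (\<Sum>x<p. \<Sum>e\<in>?E. h (e(j := x)))"
      by (simp add: sum.cartesian_product lessThan_atLeast0)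
    finally show ?thesis .
  qed
  have *: "int p dvd (\<Sum>e\<in>?E. c (e(j := x)) * (\<Prod>i\<in>I. int (a i) ^ e i))"
    if a: "a \<in> ?E" and x: "x < p" for a x
  proof -
    \<comment> \<open>\<open>s x\<close> is the coefficient of the \<open>x\<close>-th power of
      variable \<open>j\<close> once \<open>a\<close> is substituted for the other variables;
      \<open>f\<close> is the resulting polynomial in that variable.\<close>
    define s where "s = (\<lambda>x. \<Sum>e\<in>?E. c (e(j := x)) * (\<Prod>i\<in>I. int (a i) ^ e i))"
    define f where "f = (\<Sum>x<p. Polynomial.monom (s x) x)"
    have cf: "Polynomial.coeff f y = s y" if "y < p" for y
      using that by (simp add: f_def coeff_sum)
    have "p > 0" using p prime_gt_0_nat by blast
    have "Polynomial.degree f \<le> p - 1"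
      unfolding f_def by (rule degree_sum_le) (auto intro: order_trans[OF degree_monom_le])
    then have d: "Polynomial.degree f < card {0..<int p}" using \<open>p > 0\<close> by simp
    have "int p dvd poly f y" if "y \<in> {0..<int p}" for y
    proof -
      define z where "z = nat y"
      have z: "y = int z" "z < p" using that by (auto simp: z_def)
      have "a(j := z) \<in> ?E'" using a z by (auto simp: PiE_iff extensional_def)
      from insert.prems(1)[OF this]
      have "int p dvd (\<Sum>x<p. \<Sum>e\<in>?E. c (e(j := x)) * (\<Prod>i\<in>insert j I. int ((a(j := z)) i) ^ (e(j := x)) i))"
        by (simp only: E')
      also have "(\<Sum>x<p. \<Sum>e\<in>?E. c (e(j := x)) * (\<Prod>i\<in>insert j I. int ((a(j := z)) i) ^ (e(j := x)) i)) = (\<Sum>x<p. s x * int z ^ x)"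
        unfolding s_def sum_distrib_right
      proof (intro sum.cong refl)
        fix x e
        have "(\<Prod>i\<in>I. int ((a(j := z)) i) ^ (e(j := x)) i) = (\<Prod>i\<in>I. int (a i) ^ e i)"
          using insert.hyps by (intro prod.cong) auto
        then show "c (e(j := x)) * (\<Prod>i\<in>insert j I. int ((a(j := z)) i) ^ (e(j := x)) i)
          = c (e(j := x)) * (\<Prod>i\<in>I. int (a i) ^ e i) * int z ^ x"
          using insert.hyps by (simp add: mult_ac)
      qed
      also have "\<dots> = poly f y"
        by (simp add: f_def poly_sum poly_monom z)
      finally show ?thesis .
    qed
    from poly_roots_mod_prime[OF p _ _ this d] have "int p dvd Polynomial.coeff f x" by simp
    then show ?thesis using cf x by (simp add: s_def)
  qed
  obtain x e0 where e: "e = e0(j := x)" "x < p" "e0 \<in> ?E"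
    using insert.prems(2) by (auto simp: PiE_insert_eq)
  show ?case unfolding e
    by (rule insert.IH[of "\<lambda>e. c (e(j := x))" e0, OF _ e(3)]) (rule *[OF _ e(2)])
qed

text \<open>This is Fermat's theorem. The shift by 1 keeps the reduced exponent positive, so that
  the congruence also holds when \<open>p\<close> divides \<open>a\<close>.\<close>

lemma power_mod_prime_periodic:
  assumes "prime p" "x > 0"
  shows "[(a::int) ^ x = a ^ ((x - 1) mod (p - 1) + 1)] (mod int p)"
proof (cases "int p dvd a")
  case True
  then have "int p dvd a ^ n" if "n > 0" for n using that True by (meson dvd_power dvd_trans)
  from this[of x] this[of "(x - 1) mod (p - 1) + 1"] show ?thesis
    using assms by (simp only: cong_def dvd_imp_mod_0 zero_less_Suc Suc_eq_plus1[symmetric])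
next
  case False
  have "[a ^ (p - 1) = 1] (mod int p)"
  proof -
    define b where "b = nat (a mod int p)"
    have b: "int b = a mod int p" using prime_gt_0_nat[OF assms(1)] by (simp add: b_def)
    have "\<not> p dvd b"
      using False b by (metis dvd_eq_mod_eq_0 int_dvd_int_iff mod_mod_trivial)
    then have "[b ^ (p - 1) = 1] (mod p)" using fermat_theorem[OF assms(1)] by simp
    then have "[int b ^ (p - 1) = 1] (mod int p)"
      by (metis cong_int_iff of_nat_1 of_nat_power)
    moreover have "[a = int b] (mod int p)" by (simp add: b cong_def)
    ultimately show ?thesis by (meson cong_pow cong_trans)
  qed
  then have "[(a ^ (p - 1)) ^ ((x - 1) div (p - 1)) = 1 ^ ((x - 1) div (p - 1))] (mod int p)"
    by (rule cong_pow)
  then have "[a ^ ((p - 1) * ((x - 1) div (p - 1))) * a ^ ((x - 1) mod (p - 1) + 1) = 1 * a ^ ((x - 1) mod (p - 1) + 1)] (mod int p)"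
    by (intro cong_mult cong_refl) (simp add: power_mult)
  moreover have "(p - 1) * ((x - 1) div (p - 1)) + ((x - 1) mod (p - 1) + 1) = x"
    using assms(2) mult_div_mod_eq[of "p - 1" "x - 1"] by linarith
  ultimately show ?thesis by (simp only: power_add[symmetric] mult_1)
qed

text \<open>Exponent 0 stays apart from the positive multiples of \<open>p - 1\<close>: the
  corresponding power functions differ at 0. Positive exponents are reduced into
  \<open>{1..p-1}\<close>.\<close>

definition red_exp :: "nat \<Rightarrow> nat \<Rightarrow> nat" where
  "red_exp p x = (if x = 0 then 0 else (x - 1) mod (p - 1) + 1)"

lemma red_exp_0_iff [simp]: "red_exp p x = 0 \<longleftrightarrow> x = 0"
  by (simp add: red_exp_def)

lemma red_exp_less:
  assumes "prime p"
  shows "red_exp p x < p"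
proof -
  have "p > 1" using assms by (rule prime_gt_1_nat)
  then have "(x - 1) mod (p - 1) < p - 1" by simp
  moreover have "red_exp p x \<le> (x - 1) mod (p - 1) + 1" by (simp add: red_exp_def)
  ultimately show ?thesis by linarith
qed

lemma red_exp_id: "x < p \<Longrightarrow> red_exp p x = x"
  by (auto simp: red_exp_def)

text \<open>The effect on exponents of trading \<open>x_i^p\<close> for \<open>x_i\<close>, as the
  relations do.\<close>

lemma red_exp_shift: "prime p \<Longrightarrow> red_exp p (x + p) = red_exp p (x + 1)"
proof -
  assume "prime p"
  then have "p > 1" by (rule prime_gt_1_nat)
  then have "x + p - 1 = x + (p - 1)" by simp
  then have "(x + p - 1) mod (p - 1) = x mod (p - 1)" by simp
  then show ?thesis using \<open>p > 1\<close> by (simp add: red_exp_def)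
qed

lemma power_red_exp: "prime p \<Longrightarrow> [(a::int) ^ x = a ^ red_exp p x] (mod int p)"
  using power_mod_prime_periodic[of p x a] by (cases "x = 0") (auto simp: red_exp_def)

section \<open>Rewriting monomials modulo the relations\<close>

lemma mpoly_var_power: "mpoly_var i ^ n = single (single i n) 1"
proof (induction n)
  case (Suc n)
  have "single i (Suc 0) + single i n = single i (Suc n)"
    by (simp flip: single_add)
  then show ?case using Suc by (simp add: mpoly_var_def mult_single)
qed auto

lemma lookup_le_mon_deg: "lookup m i \<le> mon_deg m"
  unfolding mon_deg_def by (cases "i \<in> keys m") (auto intro: member_le_sum simp: in_keys_iff)

lemma monomial_split:
  fixes m :: "nat \<Rightarrow>\<^sub>0 nat"
  assumes "lookup m i \<ge> n"
  obtains m0 where "m = m0 + single i n"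
proof
  show "m = m - single i n + single i n"
    using assms by (intro poly_mapping_eqI) (auto simp: lookup_add lookup_minus lookup_single when_def)
qed

text \<open>The congruences rest on ideal closure and on the presence of the relations alone, so
  they are proved for any such ideal and later applied to the generated one.\<close>

locale relations_ideal =
  fixes p k :: nat and J :: "int_mpoly set"
  assumes prime: "prime p" and ideal: "ideal J (mpoly_ring k)"
    and relations: "elementary_abelian_relations p k \<subseteq> J"
begin

lemmas J = ideal_mpoly_ringD[OF ideal]
lemmas J_sum = ideal_mpoly_ring_sum[OF ideal]

lemma single_scale:
  assumes "single m 1 - single m' 1 \<in> J"
  shows "single m c - single m' c \<in> J"
proof -
  have "(single m 1 - single m' 1) * single 0 c \<in> J"
    using assms by (intro J(5) mpoly_ring_single) auto
  then show ?thesis by (simp add: left_diff_distrib mult_single)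
qed

lemma shift_congruent:
  assumes "keys m \<subseteq> {1..k}" "i \<in> {1..k}" "j \<in> {1..k}"
  shows "single (m + single i p + single j 1) 1 - single (m + single i 1 + single j p) 1 \<in> J"
proof -
  have "mpoly_var i ^ p * mpoly_var j - mpoly_var i * mpoly_var j ^ p \<in> J"
    using relations assms unfolding elementary_abelian_relations_def by blast
  then have "(mpoly_var i ^ p * mpoly_var j - mpoly_var i * mpoly_var j ^ p) * single m 1 \<in> J"
    by (rule J(5)) (rule mpoly_ring_single[OF assms(1)])
  then show ?thesis
    unfolding mpoly_var_power by (simp add: mpoly_var_def left_diff_distrib mult_single add_ac)
qed

text \<open>The relation \<open>p x_i\<close> needs a variable to act on, hence
  \<open>m \<noteq> 0\<close>; a constant multiple of \<open>p\<close> need not lie in the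
  ideal.\<close>

lemma multiple_in_ideal:
  assumes "keys m \<subseteq> {1..k}" "m \<noteq> 0" "int p dvd c"
  shows "single m c \<in> J"
proof -
  obtain i where i: "i \<in> keys m" using assms(2) by (metis keys_eq_empty ex_in_conv)
  then have "lookup m i \<ge> 1" by (simp add: in_keys_iff)
  then obtain m0 where m0: "m = m0 + single i 1" by (rule monomial_split)
  have "keys m0 \<subseteq> keys m" by (auto simp: m0 in_keys_iff lookup_add)
  obtain d where d: "c = int p * d" using assms(3) by blast
  have "of_nat p * mpoly_var i \<in> J"
    using relations assms(1) i unfolding elementary_abelian_relations_def by blast
  then have "(of_nat p * mpoly_var i) * single m0 d \<in> J"
    by (rule J(5)) (rule mpoly_ring_single[OF order_trans[OF \<open>keys m0 \<subseteq> keys m\<close> assms(1)]])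
  then show ?thesis
    by (simp add: mpoly_var_def mult_single m0 d add_ac flip: single_of_nat)
qed

text \<open>Variable \<open>j\<close> is the reservoir. Each use of a relation moves
  \<open>p - 1\<close> units of exponent from some \<open>i\<close> to \<open>j\<close>, which
  preserves the degree and lowers the degree outside \<open>j\<close>. That \<open>j\<close> occurs
  in \<open>m\<close> supplies the factor \<open>x_j\<close> in \<open>x_i^p x_j\<close>.\<close>

lemma reduce_monomial:
  assumes "keys m \<subseteq> {1..k}" "j \<in> keys m"
  shows "\<exists>m'. keys m' \<subseteq> {1..k} \<and> mon_deg m' = mon_deg m \<and>
    (\<forall>i. i \<noteq> j \<longrightarrow> lookup m' i = red_exp p (lookup m i)) \<and> single m 1 - single m' 1 \<in> J"
  using assms
proof (induction "mon_deg m - lookup m j" arbitrary: m rule: less_induct)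
  case less
  show ?case
  proof (cases "\<exists>i. i \<noteq> j \<and> lookup m i \<ge> p")
    case False
    then show ?thesis using less.prems
      by (intro exI[of _ m]) (auto simp: J(1) red_exp_id not_le)
  next
    case True
    then obtain i where i: "i \<noteq> j" "lookup m i \<ge> p" by blast
    have p: "p > 1" using prime by (rule prime_gt_1_nat)
    obtain m1 where m1: "m = m1 + single i p" using i(2) by (rule monomial_split)
    have "lookup m1 j \<ge> 1" using less.prems(2) i(1)
      by (auto simp: m1 in_keys_iff lookup_add lookup_single)
    then obtain m0 where m0: "m1 = m0 + single j 1" by (rule monomial_split)
    have m: "m = m0 + single i p + single j 1" by (simp add: m0 m1 add_ac)
    define n where "n = m0 + single i 1 + single j p"
    have "i \<in> keys m" using i p by (simp add: in_keys_iff)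
    then have ik: "i \<in> {1..k}" "j \<in> {1..k}" using less.prems by blast+
    have m0k: "keys m0 \<subseteq> {1..k}" using less.prems(1) by (auto simp: m in_keys_iff lookup_add)
    have nk: "keys n \<subseteq> {1..k}"
    proof -
      have "keys n \<subseteq> keys m0 \<union> {i, j}"
        by (auto simp: n_def in_keys_iff lookup_add lookup_single when_def split: if_splits)
      then show ?thesis using m0k ik by blast
    qed
    have jn: "j \<in> keys n" using p by (simp add: n_def in_keys_iff lookup_add)
    have dn: "mon_deg n = mon_deg m" by (simp add: n_def m mon_deg_add)
    have "mon_deg n - lookup n j < mon_deg m - lookup m j"
      using i(1) p lookup_le_mon_deg[of m0 j]
      by (simp add: n_def m mon_deg_add lookup_add lookup_single)
    from less.hyps[OF this nk jn] obtain m' where m':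
      "keys m' \<subseteq> {1..k}" "mon_deg m' = mon_deg n"
      "\<And>i. i \<noteq> j \<Longrightarrow> lookup m' i = red_exp p (lookup n i)" "single n 1 - single m' 1 \<in> J" by blast
    have "single m 1 - single n 1 \<in> J"
      unfolding m n_def by (rule shift_congruent[OF m0k ik])
    from J(2)[OF this m'(4)] have "single m 1 - single m' 1 \<in> J" by simp
    moreover have "red_exp p (lookup n i') = red_exp p (lookup m i')" if "i' \<noteq> j" for i'
      using that red_exp_shift[OF prime, of "lookup m0 i'"]
      by (auto simp: n_def m lookup_add lookup_single when_def)
    ultimately show ?thesis using m' dn by auto
  qed
qed

text \<open>Equal reduced exponents give equal supports, so both monomials can be reduced with a
  common reservoir. The results agree away from it, and equality of degrees forces agreement there
  too.\<close>

lemma same_reduction_congruent: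
  assumes "keys m \<subseteq> {1..k}" "keys n \<subseteq> {1..k}" "mon_deg m = mon_deg n"
    and red: "\<And>i. red_exp p (lookup m i) = red_exp p (lookup n i)"
  shows "single m 1 - single n 1 \<in> J"
proof -
  have "lookup m i = 0 \<longleftrightarrow> lookup n i = 0" for i
    using red[of i] red_exp_0_iff[of p "lookup m i"] red_exp_0_iff[of p "lookup n i"] by simp
  then have keys: "keys m = keys n" by (simp add: set_eq_iff in_keys_iff del: neq0_conv)
  show ?thesis
  proof (cases "keys m = {}")
    case True
    then have "m = n" using keys by (metis not_in_keys_iff_lookup_eq_zero poly_mapping_eqI empty_iff)
    then show ?thesis by (simp add: J(1))
  next
    case False
    then obtain j where j: "j \<in> keys m" "j \<in> keys n" using keys by blast
    obtain m' where m': "keys m' \<subseteq> {1..k}" "mon_deg m' = mon_deg m"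
      "\<And>i. i \<noteq> j \<Longrightarrow> lookup m' i = red_exp p (lookup m i)" "single m 1 - single m' 1 \<in> J"
      using reduce_monomial[OF assms(1) j(1)] by blast
    obtain n' where n': "keys n' \<subseteq> {1..k}" "mon_deg n' = mon_deg n"
      "\<And>i. i \<noteq> j \<Longrightarrow> lookup n' i = red_exp p (lookup n i)" "single n 1 - single n' 1 \<in> J"
      using reduce_monomial[OF assms(2) j(2)] by blast
    have off: "lookup m' i = lookup n' i" if "i \<noteq> j" for i using m'(3) n'(3) red that by simp
    have "j \<in> {1..k}" using j(1) assms(1) by blast
    have "lookup m' j + (\<Sum>i\<in>{1..k}-{j}. lookup m' i) = lookup n' j + (\<Sum>i\<in>{1..k}-{j}. lookup n' i)"
      using mon_deg_superset[OF _ m'(1)] mon_deg_superset[OF _ n'(1)] m'(2) n'(2) assms(3) \<open>j \<in> {1..k}\<close>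
      by (simp add: sum.remove)
    moreover have "(\<Sum>i\<in>{1..k}-{j}. lookup m' i) = (\<Sum>i\<in>{1..k}-{j}. lookup n' i)"
      using off by (intro sum.cong) auto
    ultimately have "lookup m' j = lookup n' j" by linarith
    with off have "m' = n'" by (intro poly_mapping_eqI) metis
    with J(4)[OF m'(4) n'(4)] show ?thesis by simp
  qed
qed

text \<open>Monomials of \<open>P\<close> with the same reduced exponents collapse modulo
  \<open>J\<close> to one of them, with the sum \<open>c e\<close> of their coefficients in front.
  Independence of reduced monomials makes every \<open>c e\<close> divisible by \<open>p\<close>,
  and positive degree then puts each collapsed term into \<open>J\<close>.\<close>

lemma vanishing_in_ideal:
  assumes P: "P \<in> carrier (mpoly_ring k)" and hom: "\<And>m. m \<in> keys P \<Longrightarrow> mon_deg m = n" and "n > 0"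
    and vanish: "\<And>a. a \<in> (\<Pi>\<^sub>E i\<in>{1..k}. {0..<p}) \<Longrightarrow> int p dvd mpoly_eval (\<lambda>i. int (a i)) P"
  shows "P \<in> J"
proof -
  define r where "r m = (\<lambda>i\<in>{1..k}. red_exp p (lookup m i))" for m :: "nat \<Rightarrow>\<^sub>0 nat"
  let ?E = "\<Pi>\<^sub>E i\<in>{1..k}. {0..<p}"
  define c where "c e = (\<Sum>m | m \<in> keys P \<and> r m = e. lookup P m)" for e
  have rE: "r m \<in> ?E" for m using red_exp_less[OF prime] by (auto simp: r_def)
  have finE: "finite ?E" by (intro finite_PiE) auto
  have mk: "keys m \<subseteq> {1..k}" if "m \<in> keys P" for m using P that by (simp add: in_mpoly_ring_iff)
  have cp: "int p dvd c e" if "e \<in> ?E" for e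
  proof (rule monomials_independent_mod_prime[OF prime _ _ that])
    fix a assume a: "a \<in> ?E"
    have "[mpoly_eval (\<lambda>i. int (a i)) P
       = (\<Sum>m\<in>keys P. lookup P m * (\<Prod>i\<in>{1..k}. int (a i) ^ r m i))] (mod int p)"
      unfolding mpoly_eval_def
    proof (intro cong_sum)
      fix m assume "m \<in> keys P"
      then have "mon_eval (\<lambda>i. int (a i)) m = (\<Prod>i\<in>{1..k}. int (a i) ^ lookup m i)"
        using mk by (intro mon_eval_superset) auto
      moreover have "[(\<Prod>i\<in>{1..k}. int (a i) ^ lookup m i) = (\<Prod>i\<in>{1..k}. int (a i) ^ r m i)] (mod int p)"
        by (intro cong_prod) (simp add: r_def power_red_exp[OF prime])
      ultimately show "[of_int (lookup P m) * mon_eval (\<lambda>i. int (a i)) m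
          = lookup P m * (\<Prod>i\<in>{1..k}. int (a i) ^ r m i)] (mod int p)"
        by (simp add: cong_mult)
    qed
    also have "(\<Sum>m\<in>keys P. lookup P m * (\<Prod>i\<in>{1..k}. int (a i) ^ r m i))
      = (\<Sum>e\<in>?E. \<Sum>m | m \<in> keys P \<and> r m = e. lookup P m * (\<Prod>i\<in>{1..k}. int (a i) ^ r m i))"
      by (rule sum.group[OF finite_keys finE, symmetric]) (intro image_subsetI rE)
    also have "\<dots> = (\<Sum>e\<in>?E. c e * (\<Prod>i\<in>{1..k}. int (a i) ^ e i))"
      by (intro sum.cong refl) (simp add: c_def sum_distrib_right)
    finally show "int p dvd (\<Sum>e\<in>?E. c e * (\<Prod>i\<in>{1..k}. int (a i) ^ e i))"
      using vanish[OF a] cong_dvd_iff by blast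
  qed auto
  \<comment> \<open>Taking the representative among the monomials of \<open>P\<close> guarantees the
    right degree and the right variables.\<close>
  define \<rho> where "\<rho> e = (SOME m. m \<in> keys P \<and> r m = e)" for e
  have \<rho>: "\<rho> (r m) \<in> keys P" "r (\<rho> (r m)) = r m" if "m \<in> keys P" for m
    using someI[of "\<lambda>m'. m' \<in> keys P \<and> r m' = r m" m] that by (auto simp: \<rho>_def)
  have "single m (lookup P m) - single (\<rho> (r m)) (lookup P m) \<in> J" if m: "m \<in> keys P" for m
  proof (rule single_scale, rule same_reduction_congruent)
    show "keys m \<subseteq> {1..k}" "keys (\<rho> (r m)) \<subseteq> {1..k}" "mon_deg m = mon_deg (\<rho> (r m))"
      using mk[OF m] mk[OF \<rho>(1)[OF m]] hom[OF m] hom[OF \<rho>(1)[OF m]] by simp_all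
    fix i show "red_exp p (lookup m i) = red_exp p (lookup (\<rho> (r m)) i)"
    proof (cases "i \<in> {1..k}")
      case True
      then show ?thesis using fun_cong[OF \<rho>(2)[OF m], of i] by (simp add: r_def)
    next
      case False
      then have "i \<notin> keys m" "i \<notin> keys (\<rho> (r m))"
        using mk[OF m] mk[OF \<rho>(1)[OF m]] by blast+
      then have "lookup m i = 0" "lookup (\<rho> (r m)) i = 0"
        unfolding not_in_keys_iff_lookup_eq_zero .
      then show ?thesis by simp
    qed
  qed
  then have "(\<Sum>m\<in>keys P. single m (lookup P m) - single (\<rho> (r m)) (lookup P m)) \<in> J" by (rule J_sum)
  then have 1: "P - (\<Sum>m\<in>keys P. single (\<rho> (r m)) (lookup P m)) \<in> J"
    by (simp add: sum_subtractf mpoly_sum_monomials)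
  have single_sum: "(\<Sum>x\<in>A. single m (f x)) = single m (sum f A)" for A m and f :: "(nat \<Rightarrow>\<^sub>0 nat) \<Rightarrow> int"
    by (induction A rule: infinite_finite_induct) (auto simp: single_add)
  have "(\<Sum>m\<in>keys P. single (\<rho> (r m)) (lookup P m))
      = (\<Sum>e\<in>?E. \<Sum>m | m \<in> keys P \<and> r m = e. single (\<rho> (r m)) (lookup P m))"
    by (rule sum.group[OF finite_keys finE, symmetric]) (intro image_subsetI rE)
  also have "\<dots> = (\<Sum>e\<in>?E. single (\<rho> e) (c e))"
    unfolding c_def single_sum[symmetric] by (intro sum.cong) auto
  also have "\<dots> \<in> J"
  proof (rule J_sum)
    fix e assume e: "e \<in> ?E"
    show "single (\<rho> e) (c e) \<in> J"
    proof (cases "\<exists>m. m \<in> keys P \<and> r m = e")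
      case True
      then obtain m where m: "m \<in> keys P" "e = r m" by blast
      have "mon_deg (\<rho> e) > 0" using hom[OF \<rho>(1)[OF m(1)]] \<open>n > 0\<close> m(2) by simp
      then have "\<rho> e \<noteq> 0" by auto
      then show ?thesis using mk[OF \<rho>(1)[OF m(1)]] m(2) cp[OF e] by (intro multiple_in_ideal) auto
    next
      case False
      then have "c e = 0" unfolding c_def by (intro sum.neutral) auto
      then show ?thesis by (simp add: J(1))
    qed
  qed
  finally have "(\<Sum>m\<in>keys P. single (\<rho> (r m)) (lookup P m)) \<in> J" .
  from J(2)[OF 1 this] show ?thesis by simp
qed

end

section \<open>Exterior powers of matrices\<close>

text \<open>Renaming indices along \<open>xs\<close> transports permutations and preserves signs; a
  minor thereby depends on the index set and not on its enumeration.\<close>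

lemma sum_permutes_minor:
  fixes f :: "nat \<Rightarrow> nat \<Rightarrow> 'b::comm_ring_1"
  assumes "distinct xs" "length xs = n"
  shows "(\<Sum>\<pi> | \<pi> permutes {0..<n}. signof \<pi> * (\<Prod>i=0..<n. f (xs ! i) (xs ! \<pi> i))) =
    (\<Sum>\<pi> | \<pi> permutes set xs. signof \<pi> * (\<Prod>i\<in>set xs. f i (\<pi> i)))"
proof -
  let ?f = "\<lambda>i. xs ! i" and ?N = "{0..<n}"
  define g where "g = inv_into ?N ?f"
  have bij: "bij_betw ?f ?N (set xs)"
    using assms by (intro bij_betw_nth) auto
  have bij': "bij_betw g (set xs) ?N" unfolding g_def by (rule bij_betw_inv_into[OF bij])
  have gf: "g (xs ! x) = x" if "x \<in> ?N" for x
    unfolding g_def using bij_betw_inv_into_left[OF bij that] .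
  have fg: "xs ! (g x) = x" if "x \<in> set xs" for x
    unfolding g_def using bij_betw_inv_into_right[OF bij that] .
  have inj: "inj_on ?f ?N" using bij by (simp add: bij_betw_def)
  show ?thesis
  proof (rule sum.reindex_bij_witness[of _ "map_permutation (set xs) g" "map_permutation ?N ?f"])
    fix \<pi> assume "\<pi> \<in> {\<pi>. \<pi> permutes ?N}"
    then have \<pi>: "\<pi> permutes ?N" by simp
    show "map_permutation ?N ?f \<pi> \<in> {\<pi>. \<pi> permutes set xs}"
      using map_permutation_permutes[OF bij \<pi>] by simp
    show "map_permutation (set xs) g (map_permutation ?N ?f \<pi>) = \<pi>"
      by (rule map_permutation_compose_inv[OF bij \<pi>]) (rule gf)
    have "(\<Prod>i\<in>set xs. f i (map_permutation ?N ?f \<pi> i))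
        = (\<Prod>i\<in>?N. f (xs ! i) (map_permutation ?N ?f \<pi> (xs ! i)))"
      by (rule prod.reindex_bij_betw[OF bij, symmetric])
    also have "\<dots> = (\<Prod>i\<in>?N. f (xs ! i) (xs ! \<pi> i))"
      by (intro prod.cong refl) (simp add: map_permutation_apply[OF inj])
    moreover have "sign (map_permutation ?N ?f \<pi>) = sign \<pi>"
      by (rule sign_map_permutation[OF inj \<pi>]) simp
    ultimately show "signof (map_permutation ?N ?f \<pi>) * (\<Prod>i\<in>set xs. f i (map_permutation ?N ?f \<pi> i))
        = signof \<pi> * (\<Prod>i=0..<n. f (xs ! i) (xs ! \<pi> i))" by simp
  next
    fix \<pi> assume "\<pi> \<in> {\<pi>. \<pi> permutes set xs}"
    then have \<pi>: "\<pi> permutes set xs" by simp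
    show "map_permutation (set xs) g \<pi> \<in> {\<pi>. \<pi> permutes ?N}"
      using map_permutation_permutes[OF bij' \<pi>] by simp
    show "map_permutation ?N ?f (map_permutation (set xs) g \<pi>) = \<pi>"
      by (rule map_permutation_compose_inv[OF bij' \<pi>]) (rule fg)
  qed
qed

text \<open>Permutations of \<open>S\<close> itself replace an enumeration of \<open>S\<close>, so
  that the Leibniz formula for a large determinant can be regrouped by subsets.\<close>

definition principal_minor :: "complex mat \<Rightarrow> nat set \<Rightarrow> complex" where
  "principal_minor A S = (\<Sum>\<pi> | \<pi> permutes S. signof \<pi> * (\<Prod>i\<in>S. A $$ (i, \<pi> i)))"

section \<open>Traces of exterior powers and the determinant of 1 + tA\<close>

lemma trace_ext_power:
  assumes "A \<in> carrier_mat d d"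
  shows "mat_trace (ext_power_mat n A) = (\<Sum>S | S \<subseteq> {0..<d} \<and> card S = n. principal_minor A S)"
proof -
  define B where "B = ext_basis d n"
  have d: "dim_row A = d" using assms by simp
  have "distinct (map set B)"
    unfolding B_def ext_basis_def by (rule distinct_map_filter[OF distinct_set_subseqs]) simp
  then have B: "distinct B" "inj_on set (set B)" by (auto simp: distinct_map)
  have Bd: "distinct xs" "length xs = n" if "xs \<in> set B" for xs
    using that subseqs_distinctD[of xs "[0..<d]"] by (auto simp: B_def ext_basis_def)
  have setB: "set ` set B = {S. S \<subseteq> {0..<d} \<and> card S = n}"
  proof safe
    fix xs x assume xs: "xs \<in> set B"
    then have "set xs \<in> set ` set (subseqs [0..<d])" unfolding B_def ext_basis_def by auto
    then have "set xs \<subseteq> {0..<d}" unfolding subseqs_powset by simp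
    then show "x \<in> set xs \<Longrightarrow> x \<in> {0..<d}" by blast
    show "card (set xs) = n" using Bd[OF xs] distinct_card by metis
  next
    fix S assume S: "S \<subseteq> {0..<d}" "n = card S"
    then have "S \<in> set ` set (subseqs [0..<d])" by (simp add: subseqs_powset)
    then obtain xs where xs: "xs \<in> set (subseqs [0..<d])" "S = set xs" by blast
    then have "distinct xs" using subseqs_distinctD[of xs "[0..<d]"] by simp
    then have "length xs = card S" using xs(2) distinct_card by metis
    with xs show "S \<in> set ` set B" using S(2) by (auto simp: B_def ext_basis_def)
  qed
  have "mat_trace (ext_power_mat n A)
    = (\<Sum>a<length B. det (mat n n (\<lambda>(i, j). A $$ (B ! a ! i, B ! a ! j))))"
    unfolding mat_trace_def ext_power_mat_def Let_def d B_def[symmetric] by simp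
  also have "\<dots> = (\<Sum>xs\<in>set B. det (mat n n (\<lambda>(i, j). A $$ (xs ! i, xs ! j))))"
    by (rule sum.reindex_bij_betw[OF bij_betw_nth[OF B(1) refl refl]])
  also have "\<dots> = (\<Sum>xs\<in>set B. principal_minor A (set xs))"
  proof (intro sum.cong refl)
    fix xs assume xs: "xs \<in> set B"
    have "det (mat n n (\<lambda>(i, j). A $$ (xs ! i, xs ! j)))
      = (\<Sum>\<pi> | \<pi> permutes {0..<n}. signof \<pi> * (\<Prod>i=0..<n. A $$ (xs ! i, xs ! \<pi> i)))"
    proof (subst det_def'[of _ n], simp, intro sum.cong refl)
      fix \<pi> assume "\<pi> \<in> {\<pi>. \<pi> permutes {0..<n}}"
      then have \<pi>: "\<pi> permutes {0..<n}" by simp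
      have "(\<Prod>i=0..<n. mat n n (\<lambda>(i, j). A $$ (xs ! i, xs ! j)) $$ (i, \<pi> i)) = (\<Prod>i=0..<n. A $$ (xs ! i, xs ! \<pi> i))"
        using permutes_in_image[OF \<pi>] by (intro prod.cong refl) auto
      then show "signof \<pi> * (\<Prod>i=0..<n. mat n n (\<lambda>(i, j). A $$ (xs ! i, xs ! j)) $$ (i, \<pi> i))
        = signof \<pi> * (\<Prod>i=0..<n. A $$ (xs ! i, xs ! \<pi> i))" by simp
    qed
    also have "\<dots> = principal_minor A (set xs)"
      unfolding principal_minor_def
      by (rule sum_permutes_minor[OF Bd[OF xs], where f = "\<lambda>i j. A $$ (i, j)"])
    finally show "det (mat n n (\<lambda>(i, j). A $$ (xs ! i, xs ! j))) = principal_minor A (set xs)" .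
  qed
  also have "\<dots> = (\<Sum>S\<in>set ` set B. principal_minor A S)"
    by (simp add: sum.reindex[OF B(2)])
  finally show ?thesis by (simp add: setB)
qed

lemma trace_ext_power_1:
  assumes "A \<in> carrier_mat d d"
  shows "mat_trace (ext_power_mat 1 A) = mat_trace A"
proof -
  have "{S. S \<subseteq> {0..<d} \<and> card S = 1} = (\<lambda>i. {i}) ` {0..<d}"
    by (auto simp: card_1_singleton_iff)
  then have "mat_trace (ext_power_mat 1 A) = (\<Sum>i<d. principal_minor A {i})"
    unfolding trace_ext_power[OF assms] by (simp add: sum.reindex lessThan_atLeast0)
  also have "\<dots> = mat_trace A"
    using assms by (simp add: mat_trace_def principal_minor_def)
  finally show ?thesis .
qed

text \<open>Multiplying out the Leibniz formula selects the set \<open>S\<close> of rows that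
  contribute \<open>t A\<close>. In the other rows the identity matrix forces the permutation to fix
  the index, so only permutations of \<open>S\<close> survive and leave \<open>t ^ card S\<close>
  times a principal minor.\<close>

lemma det_one_plus_expansion:
  assumes "A \<in> carrier_mat d d"
  shows "det (1\<^sub>m d + t \<cdot>\<^sub>m A) = (\<Sum>n\<le>d. mat_trace (ext_power_mat n A) * t ^ n)"
proof -
  let ?N = "{0..<d}"
  define f where "f S \<pi> = signof \<pi> * (\<Prod>i\<in>S. t * A $$ (i, \<pi> i)) * (\<Prod>i\<in>?N - S. if i = \<pi> i then 1 else 0)"
    for S and \<pi> :: "nat \<Rightarrow> nat"
  have "det (1\<^sub>m d + t \<cdot>\<^sub>m A) = (\<Sum>\<pi> | \<pi> permutes ?N. signof \<pi> * (\<Prod>i=0..<d. (1\<^sub>m d + t \<cdot>\<^sub>m A) $$ (i, \<pi> i)))"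
    using assms by (subst det_def'[of _ d]) auto
  also have "\<dots> = (\<Sum>\<pi> | \<pi> permutes ?N. \<Sum>S\<in>Pow ?N. f S \<pi>)"
  proof (intro sum.cong refl)
    fix \<pi> assume "\<pi> \<in> {\<pi>. \<pi> permutes ?N}"
    then have \<pi>: "\<pi> permutes ?N" by simp
    have "(\<Prod>i=0..<d. (1\<^sub>m d + t \<cdot>\<^sub>m A) $$ (i, \<pi> i)) = (\<Prod>i=0..<d. t * A $$ (i, \<pi> i) + (if i = \<pi> i then 1 else 0))"
      using permutes_in_image[OF \<pi>] assms by (intro prod.cong refl) auto
    also have "\<dots> = (\<Sum>S\<in>Pow ?N. (\<Prod>i\<in>S. t * A $$ (i, \<pi> i)) * (\<Prod>i\<in>?N - S. if i = \<pi> i then 1 else 0))"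
      by (rule prod_add) simp
    finally show "signof \<pi> * (\<Prod>i=0..<d. (1\<^sub>m d + t \<cdot>\<^sub>m A) $$ (i, \<pi> i)) = (\<Sum>S\<in>Pow ?N. f S \<pi>)"
      by (simp add: f_def sum_distrib_left mult.assoc)
  qed
  also have "\<dots> = (\<Sum>S\<in>Pow ?N. \<Sum>\<pi> | \<pi> permutes ?N. f S \<pi>)" by (rule sum.swap)
  also have "\<dots> = (\<Sum>S\<in>Pow ?N. t ^ card S * principal_minor A S)"
  proof (intro sum.cong refl)
    fix S assume "S \<in> Pow ?N"
    then have S: "S \<subseteq> ?N" "finite S" using finite_subset by auto
    have "(\<Sum>\<pi> | \<pi> permutes ?N. f S \<pi>) = (\<Sum>\<pi> | \<pi> permutes S. f S \<pi>)"
    proof (rule sum.mono_neutral_right)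
      show "finite {\<pi>. \<pi> permutes ?N}" by (rule finite_permutations) simp
      show "{\<pi>. \<pi> permutes S} \<subseteq> {\<pi>. \<pi> permutes ?N}" using permutes_subset[OF _ S(1)] by blast
      show "\<forall>\<pi>\<in>{\<pi>. \<pi> permutes ?N} - {\<pi>. \<pi> permutes S}. f S \<pi> = 0"
      proof
        fix \<pi> assume "\<pi> \<in> {\<pi>. \<pi> permutes ?N} - {\<pi>. \<pi> permutes S}"
        then have \<pi>: "\<pi> permutes ?N" "\<not> \<pi> permutes S" by auto
        then obtain x where x: "x \<in> ?N - S" "\<pi> x \<noteq> x" using permutes_superset[OF \<pi>(1), of S] by blast
        then have "(\<Prod>i\<in>?N - S. if i = \<pi> i then 1 else 0) = (0 :: complex)"
          using x(1) x(2)[symmetric] by (intro prod_zero bexI[of _ x]) auto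
        then show "f S \<pi> = 0" by (simp add: f_def)
      qed
    qed
    also have "\<dots> = (\<Sum>\<pi> | \<pi> permutes S. t ^ card S * (signof \<pi> * (\<Prod>i\<in>S. A $$ (i, \<pi> i))))"
    proof (intro sum.cong refl)
      fix \<pi> assume "\<pi> \<in> {\<pi>. \<pi> permutes S}"
      then have "(\<Prod>i\<in>?N - S. if i = \<pi> i then 1 else 0) = (1 :: complex)"
        by (intro prod.neutral) (auto simp: permutes_not_in)
      then show "f S \<pi> = t ^ card S * (signof \<pi> * (\<Prod>i\<in>S. A $$ (i, \<pi> i)))"
        by (simp add: f_def prod.distrib)
    qed
    finally show "(\<Sum>\<pi> | \<pi> permutes ?N. f S \<pi>) = t ^ card S * principal_minor A S"
      by (simp add: principal_minor_def sum_distrib_left)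
  qed
  also have "\<dots> = (\<Sum>n\<le>d. \<Sum>S | S \<in> Pow ?N \<and> card S = n. t ^ card S * principal_minor A S)"
  proof (rule sum.group[symmetric])
    show "card ` Pow {0..<d} \<subseteq> {..d}"
      using card_mono[of "{0..<d}"] by fastforce
  qed auto
  also have "\<dots> = (\<Sum>n\<le>d. mat_trace (ext_power_mat n A) * t ^ n)"
    unfolding trace_ext_power[OF assms] sum_distrib_right
    by (intro sum.cong) auto
  finally show ?thesis .
qed

lemma trace_ext_power_0:
  assumes "A \<in> carrier_mat d d" "n > d"
  shows "mat_trace (ext_power_mat n A) = 0"
proof -
  have "card S \<noteq> n" if "S \<subseteq> {0..<d}" for S
    using card_mono[OF _ that] assms(2) by auto
  then have "{S. S \<subseteq> {0..<d} \<and> card S = n} = {}" by blast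
  then show ?thesis unfolding trace_ext_power[OF assms(1)] by (simp only: sum.empty)
qed

text \<open>Polynomials that agree at all complex numbers coincide, so any polynomial formula for
  the determinant yields all the traces at once.\<close>

lemma trace_ext_power_coeff:
  assumes A: "A \<in> carrier_mat d d" and q: "\<And>t. det (1\<^sub>m d + t \<cdot>\<^sub>m A) = poly q t"
  shows "mat_trace (ext_power_mat n A) = Polynomial.coeff q n"
proof -
  define r where "r = (\<Sum>n\<le>d. Polynomial.monom (mat_trace (ext_power_mat n A)) n)"
  have "poly r t = poly q t" for t
    unfolding q[symmetric] det_one_plus_expansion[OF A]
    by (simp add: r_def poly_sum poly_monom)
  then have "q = r" by (metis poly_eq_poly_eq_iff ext)
  moreover have "Polynomial.coeff r n = mat_trace (ext_power_mat n A)"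
    using trace_ext_power_0[OF A, of n] by (auto simp: r_def coeff_sum not_le)
  ultimately show ?thesis by simp
qed

text \<open>Triangularisation keeps idempotency, and the diagonal entries of an idempotent
  triangular matrix are 0 or 1. The exponent counts the ones, hence does not depend on
  \<open>x\<close>.\<close>

lemma det_idempotent:
  fixes P :: "complex mat"
  assumes P: "P \<in> carrier_mat d d" and idem: "P * P = P"
  shows "\<exists>r. \<forall>x. det (1\<^sub>m d + (x - 1) \<cdot>\<^sub>m P) = x ^ r"
proof -
  obtain as where "char_poly P = (\<Prod>a\<leftarrow>as. [:- a, 1:])" using char_poly_factorized[OF P] by blast
  from schur_decomposition_exists[OF P this] obtain B where
    B: "B \<in> carrier_mat d d" "upper_triangular B" and sim: "similar_mat P B" by blast
  from similar_matD[OF sim] obtain n S T where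
    c: "{P, B, S, T} \<subseteq> carrier_mat n n" and ST: "S * T = 1\<^sub>m n" "T * S = 1\<^sub>m n" and PB: "P = S * B * T"
    by blast
  have [simp]: "n = d" using c P by auto
  have S: "S \<in> carrier_mat d d" and T: "T \<in> carrier_mat d d" using c by auto
  note ca = S T B(1) P
  have "T * P * S = (T * S) * B * (T * S)"
    unfolding PB using ca by (simp add: assoc_mult_mat[of _ d d _ d _ d])
  then have BP: "B = T * P * S" using ST(2) ca by simp
  have "B * B = T * P * (S * T) * P * S"
    unfolding BP using ca by (simp add: assoc_mult_mat[of _ d d _ d _ d])
  also have "\<dots> = T * (P * P) * S"
    using ca ST(1) by (simp add: assoc_mult_mat[of _ d d _ d _ d])
  finally have BB: "B * B = B" unfolding idem BP .
  have diag: "B $$ (i, i) = 0 \<or> B $$ (i, i) = 1" if i: "i < d" for i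
  proof -
    have "(B * B) $$ (i, i) = (\<Sum>j\<in>{0..<d}. B $$ (i, j) * B $$ (j, i))"
      using B(1) i by (simp add: scalar_prod_def)
    also have "\<dots> = (\<Sum>j\<in>{i}. B $$ (i, j) * B $$ (j, i))"
    proof (rule sum.mono_neutral_right)
      show "\<forall>j\<in>{0..<d} - {i}. B $$ (i, j) * B $$ (j, i) = 0"
      proof
        fix j assume "j \<in> {0..<d} - {i}"
        then show "B $$ (i, j) * B $$ (j, i) = 0"
          using upper_triangularD[OF B(2), of j i] upper_triangularD[OF B(2), of i j] B(1) i
          by (cases "j < i") auto
      qed
    qed (use i in auto)
    finally show ?thesis unfolding BB by simp
  qed
  have "det (1\<^sub>m d + (x - 1) \<cdot>\<^sub>m P) = x ^ card {i\<in>{0..<d}. B $$ (i, i) = 1}" for x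
  proof -
    let ?P = "1\<^sub>m d + (x - 1) \<cdot>\<^sub>m P" and ?B = "1\<^sub>m d + (x - 1) \<cdot>\<^sub>m B"
    have "S * ?B * T = S * T + (x - 1) \<cdot>\<^sub>m (S * B * T)"
      using ca by (simp add: mult_add_distrib_mat[where nr = d and n = d and nc = d]
        add_mult_distrib_mat[where nr = d and n = d and nc = d]
        mult_smult_distrib[where nr = d and n = d and nc = d]
        mult_smult_assoc_mat[where nr = d and n = d and nc = d])
    then have "?P = S * ?B * T" unfolding PB ST(1) by simp
    then have "similar_mat ?P ?B"
      using ST ca by (intro similar_matI[of _ _ S T d]) auto
    then have "det ?P = det ?B" by (rule det_similar)
    also have "upper_triangular ?B" using B by (auto simp: upper_triangular_def)
    then have "det ?B = prod_list (diag_mat ?B)"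
      by (rule det_upper_triangular[of _ d]) (use ca in auto)
    also have "\<dots> = (\<Prod>i=0..<d. ?B $$ (i, i))"
      using B(1) by (simp add: prod_list_diag_prod)
    also have "\<dots> = (\<Prod>i=0..<d. if B $$ (i, i) = 1 then x else 1)"
      using B(1) diag by (intro prod.cong refl) auto
    also have "\<dots> = x ^ card {i\<in>{0..<d}. B $$ (i, i) = 1}"
      by (simp add: prod.If_cases Int_def)
    finally show ?thesis .
  qed
  then show ?thesis by blast
qed

section \<open>Representations of a finite abelian group\<close>

lemma representationD:
  assumes "group G" "representation G d \<rho>"
  shows "g \<in> carrier G \<Longrightarrow> \<rho> g \<in> carrier_mat d d"
    and "g \<in> carrier G \<Longrightarrow> h \<in> carrier G \<Longrightarrow> \<rho> (g \<otimes>\<^bsub>G\<^esub> h) = \<rho> g * \<rho> h"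
    and "\<rho> \<one>\<^bsub>G\<^esub> = 1\<^sub>m d"
proof -
  let ?R = "ring_mat TYPE(complex) d ()"
  interpret R: ring ?R by (rule ring_mat)
  interpret U: group "units_of ?R" by (rule R.units_group)
  have hom: "\<rho> \<in> hom G (units_of ?R)" using assms(2) by (simp add: representation_def)
  then show "g \<in> carrier G \<Longrightarrow> \<rho> g \<in> carrier_mat d d"
    by (auto simp: hom_def units_of_carrier Units_def ring_mat_def)
  show "g \<in> carrier G \<Longrightarrow> h \<in> carrier G \<Longrightarrow> \<rho> (g \<otimes>\<^bsub>G\<^esub> h) = \<rho> g * \<rho> h"
    using hom by (auto simp: hom_def units_of_mult ring_mat_def)
  have "\<rho> \<one>\<^bsub>G\<^esub> = \<one>\<^bsub>units_of ?R\<^esub>"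
    by (rule hom_one[OF hom assms(1) U.is_group])
  then show "\<rho> \<one>\<^bsub>G\<^esub> = 1\<^sub>m d" by (simp add: units_of_one ring_mat_def)
qed

text \<open>An interface to the dual of a finite abelian group. The two orthogonality relations say
  that the characters indexed by \<open>A\<close> are distinct and that there are enough of them.
  The results on lambda and gamma operations are proved from this interface, away from the product
  structure of the group.\<close>

locale dual_group = comm_group G for G (structure) +
  fixes A :: "'i set" and chi :: "'i \<Rightarrow> 'a \<Rightarrow> complex"
  assumes finite_carrier: "finite (carrier G)" and finite_index: "finite A"
    and chi_mult: "\<And>a g h. a \<in> A \<Longrightarrow> g \<in> carrier G \<Longrightarrow> h \<in> carrier G \<Longrightarrow> chi a (g \<otimes> h) = chi a g * chi a h"
    and chi_one: "\<And>a. a \<in> A \<Longrightarrow> chi a \<one> = 1"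
    and orthogonality: "\<And>a b. a \<in> A \<Longrightarrow> b \<in> A \<Longrightarrow>
      (\<Sum>g\<in>carrier G. chi a (inv g) * chi b g) = (if a = b then of_nat (card (carrier G)) else 0)"
    and dual_orthogonality: "\<And>g. g \<in> carrier G \<Longrightarrow>
      (\<Sum>a\<in>A. chi a g) = (if g = \<one> then of_nat (card (carrier G)) else 0)"
    and chi_prod: "\<And>a b. a \<in> A \<Longrightarrow> b \<in> A \<Longrightarrow> \<exists>c\<in>A. \<forall>g\<in>carrier G. chi c g = chi a g * chi b g"
    and chi_trivial: "\<exists>a\<in>A. \<forall>g\<in>carrier G. chi a g = 1"
begin

section \<open>Isotypic projections of a representation\<close>

abbreviation (input) "N \<equiv> (of_nat (card (carrier G)) :: complex)"

lemma N_nonzero: "N \<noteq> 0"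
  using finite_carrier one_closed by (auto simp: card_eq_0_iff)

lemma sum_translate:
  assumes "g \<in> carrier G"
  shows "(\<Sum>h\<in>carrier G. f (g \<otimes> h)) = (\<Sum>h\<in>carrier G. f h)"
  by (rule sum.reindex_bij_witness[of _ "\<lambda>h. inv g \<otimes> h" "\<lambda>h. g \<otimes> h"])
     (use assms in \<open>auto simp flip: m_assoc\<close>)

text \<open>An entry of the averaging projection onto the \<open>chi a\<close>-isotypic
  subspace.\<close>

definition proj_entry :: "('a \<Rightarrow> complex mat) \<Rightarrow> 'i \<Rightarrow> nat \<Rightarrow> nat \<Rightarrow> complex" where
  "proj_entry \<rho> a i j = (\<Sum>g\<in>carrier G. chi a (inv g) * \<rho> g $$ (i, j)) / N"

context
  fixes d \<rho> assumes rep: "representation G d \<rho>"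
begin

lemmas \<rho> = representationD[OF is_group rep]

lemma entry_mult:
  assumes "g \<in> carrier G" "h \<in> carrier G" "i < d" "j < d"
  shows "(\<Sum>l<d. \<rho> g $$ (i, l) * \<rho> h $$ (l, j)) = \<rho> (g \<otimes> h) $$ (i, j)"
proof -
  have "\<rho> (g \<otimes> h) $$ (i, j) = (\<rho> g * \<rho> h) $$ (i, j)" using \<rho>(2) assms by simp
  also have "\<dots> = (\<Sum>l<d. \<rho> g $$ (i, l) * \<rho> h $$ (l, j))"
    using \<rho>(1)[OF assms(1)] \<rho>(1)[OF assms(2)] assms(3,4)
    by (simp add: scalar_prod_def lessThan_atLeast0)
  finally show ?thesis by simp
qed

lemma rep_proj_entry:
  assumes "g \<in> carrier G" "b \<in> A" "i < d" "j < d"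
  shows "(\<Sum>l<d. \<rho> g $$ (i, l) * proj_entry \<rho> b l j) = chi b g * proj_entry \<rho> b i j"
proof -
  have "(\<Sum>l<d. \<rho> g $$ (i, l) * proj_entry \<rho> b l j)
    = (\<Sum>l<d. \<Sum>h\<in>carrier G. chi b (inv h) * (\<rho> g $$ (i, l) * \<rho> h $$ (l, j))) / N"
    by (simp add: proj_entry_def sum_distrib_left sum_divide_distrib mult_ac)
  also have "(\<Sum>l<d. \<Sum>h\<in>carrier G. chi b (inv h) * (\<rho> g $$ (i, l) * \<rho> h $$ (l, j)))
    = (\<Sum>h\<in>carrier G. \<Sum>l<d. chi b (inv h) * (\<rho> g $$ (i, l) * \<rho> h $$ (l, j)))"
    by (rule sum.swap)
  also have "\<dots> = (\<Sum>h\<in>carrier G. chi b (inv h) * \<rho> (g \<otimes> h) $$ (i, j))"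
    by (intro sum.cong refl) (simp add: sum_distrib_left[symmetric] entry_mult assms)
  \<comment> \<open>Commutativity lets \<open>inv h\<close> be rewritten through
    \<open>g \<otimes> h\<close>, after which the sum can be translated by \<open>g\<close>.\<close>
  also have "\<dots> = (\<Sum>h\<in>carrier G. chi b (g \<otimes> inv (g \<otimes> h)) * \<rho> (g \<otimes> h) $$ (i, j))"
  proof (intro sum.cong refl)
    fix h assume h: "h \<in> carrier G"
    have "g \<otimes> inv (g \<otimes> h) = inv h"
      using assms(1) h by (simp add: inv_mult m_assoc[symmetric])
    then show "chi b (inv h) * \<rho> (g \<otimes> h) $$ (i, j) = chi b (g \<otimes> inv (g \<otimes> h)) * \<rho> (g \<otimes> h) $$ (i, j)" by simp
  qed
  also have "\<dots> = (\<Sum>h\<in>carrier G. chi b (g \<otimes> inv h) * \<rho> h $$ (i, j))"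
    by (rule sum_translate[OF assms(1), where f = "\<lambda>h. chi b (g \<otimes> inv h) * \<rho> h $$ (i, j)"])
  also have "\<dots> = chi b g * (\<Sum>h\<in>carrier G. chi b (inv h) * \<rho> h $$ (i, j))"
    unfolding sum_distrib_left using assms(1,2) by (intro sum.cong refl) (simp add: chi_mult mult_ac)
  finally show ?thesis by (simp add: proj_entry_def)
qed

lemma proj_entry_mult:
  assumes "a \<in> A" "b \<in> A" "i < d" "j < d"
  shows "(\<Sum>l<d. proj_entry \<rho> a i l * proj_entry \<rho> b l j) = (if a = b then proj_entry \<rho> b i j else 0)"
proof -
  have "(\<Sum>l<d. proj_entry \<rho> a i l * proj_entry \<rho> b l j)
    = (\<Sum>l<d. \<Sum>g\<in>carrier G. chi a (inv g) * (\<rho> g $$ (i, l) * proj_entry \<rho> b l j)) / N"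
    unfolding proj_entry_def[of _ a] sum_divide_distrib sum_distrib_right
    by (intro sum.cong refl) simp
  also have "(\<Sum>l<d. \<Sum>g\<in>carrier G. chi a (inv g) * (\<rho> g $$ (i, l) * proj_entry \<rho> b l j))
    = (\<Sum>g\<in>carrier G. \<Sum>l<d. chi a (inv g) * (\<rho> g $$ (i, l) * proj_entry \<rho> b l j))"
    by (rule sum.swap)
  also have "\<dots> = (\<Sum>g\<in>carrier G. chi a (inv g) * chi b g) * proj_entry \<rho> b i j"
    unfolding sum_distrib_right
    by (intro sum.cong refl) (simp add: sum_distrib_left[symmetric] rep_proj_entry assms)
  finally show ?thesis using orthogonality[OF assms(1,2)] N_nonzero by auto
qed

lemma sum_proj_entry:
  assumes "i < d" "j < d"
  shows "(\<Sum>a\<in>A. proj_entry \<rho> a i j) = (if i = j then 1 else 0)"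
proof -
  have "(\<Sum>a\<in>A. proj_entry \<rho> a i j) = (\<Sum>a\<in>A. \<Sum>g\<in>carrier G. chi a (inv g) * \<rho> g $$ (i, j)) / N"
    by (simp add: proj_entry_def sum_divide_distrib)
  also have "(\<Sum>a\<in>A. \<Sum>g\<in>carrier G. chi a (inv g) * \<rho> g $$ (i, j))
    = (\<Sum>g\<in>carrier G. (\<Sum>a\<in>A. chi a (inv g)) * \<rho> g $$ (i, j))"
    unfolding sum_distrib_right by (rule sum.swap)
  also have "\<dots> = (\<Sum>g\<in>carrier G. if g = \<one> then N * \<rho> g $$ (i, j) else 0)"
    by (intro sum.cong refl) (auto simp: dual_orthogonality)
  also have "\<dots> = N * \<rho> \<one> $$ (i, j)"
    using finite_carrier by (simp add: sum.delta)
  finally show ?thesis using N_nonzero \<rho>(3) assms by simp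
qed

lemma rep_entry:
  assumes "g \<in> carrier G" "i < d" "j < d"
  shows "\<rho> g $$ (i, j) = (\<Sum>a\<in>A. chi a g * proj_entry \<rho> a i j)"
proof -
  have "\<rho> g $$ (i, j) = (\<Sum>l<d. \<rho> g $$ (i, l) * (if l = j then 1 else 0))"
    using assms(3) by (simp add: if_distrib[of "\<lambda>x. _ * x"] cong: if_cong)
  also have "\<dots> = (\<Sum>l<d. \<rho> g $$ (i, l) * (\<Sum>a\<in>A. proj_entry \<rho> a l j))"
    using assms(3) by (intro sum.cong refl) (simp add: sum_proj_entry)
  also have "\<dots> = (\<Sum>a\<in>A. \<Sum>l<d. \<rho> g $$ (i, l) * proj_entry \<rho> a l j)"
    unfolding sum_distrib_left by (rule sum.swap)
  also have "\<dots> = (\<Sum>a\<in>A. chi a g * proj_entry \<rho> a i j)"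
    by (intro sum.cong refl) (simp add: rep_proj_entry assms)
  finally show ?thesis .
qed

text \<open>Functional calculus for the isotypic decomposition: the matrix acting as the scalar
  \<open>s a\<close> on the part belonging to \<open>a\<close>.\<close>

definition spectral :: "('i \<Rightarrow> complex) \<Rightarrow> complex mat" where
  "spectral s = mat d d (\<lambda>(i, j). \<Sum>a\<in>A. s a * proj_entry \<rho> a i j)"

lemma spectral_carrier: "spectral s \<in> carrier_mat d d"
  by (simp add: spectral_def)

lemma spectral_cong: "(\<And>a. a \<in> A \<Longrightarrow> s a = t a) \<Longrightarrow> spectral s = spectral t"
  by (simp add: spectral_def cong: sum.cong)

lemma spectral_mult: "spectral s * spectral t = spectral (\<lambda>a. s a * t a)"
proof (rule eq_matI)
  fix i j assume "i < dim_row (spectral (\<lambda>a. s a * t a))" "j < dim_col (spectral (\<lambda>a. s a * t a))"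
  then have ij: "i < d" "j < d" by (simp_all add: spectral_def)
  have "(spectral s * spectral t) $$ (i, j)
    = (\<Sum>l<d. (\<Sum>a\<in>A. s a * proj_entry \<rho> a i l) * (\<Sum>b\<in>A. t b * proj_entry \<rho> b l j))"
    using ij by (simp add: spectral_def scalar_prod_def lessThan_atLeast0)
  also have "\<dots> = (\<Sum>l<d. \<Sum>a\<in>A. \<Sum>b\<in>A. s a * t b * (proj_entry \<rho> a i l * proj_entry \<rho> b l j))"
    by (simp add: sum_product mult_ac)
  also have "\<dots> = (\<Sum>a\<in>A. \<Sum>b\<in>A. \<Sum>l<d. s a * t b * (proj_entry \<rho> a i l * proj_entry \<rho> b l j))"
    by (subst sum.swap, rule sum.cong[OF refl], rule sum.swap)
  also have "\<dots> = (\<Sum>a\<in>A. \<Sum>b\<in>A. if a = b then s a * t b * proj_entry \<rho> b i j else 0)"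
    by (intro sum.cong refl) (simp add: sum_distrib_left[symmetric] proj_entry_mult ij)
  also have "\<dots> = spectral (\<lambda>a. s a * t a) $$ (i, j)"
    using ij finite_index by (simp add: spectral_def)
  finally show "(spectral s * spectral t) $$ (i, j) = spectral (\<lambda>a. s a * t a) $$ (i, j)" .
qed (simp_all add: spectral_def)

lemma spectral_one: "spectral (\<lambda>_. 1) = 1\<^sub>m d"
  by (rule eq_matI) (simp_all add: spectral_def sum_proj_entry)

lemma spectral_affine: "spectral (\<lambda>a. 1 + t * s a) = 1\<^sub>m d + t \<cdot>\<^sub>m spectral s"
  by (rule eq_matI)
    (simp_all add: spectral_def distrib_right sum.distrib sum_proj_entry sum_distrib_left mult.assoc)

lemma spectral_rep: "g \<in> carrier G \<Longrightarrow> spectral (\<lambda>a. chi a g) = \<rho> g"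
  using \<rho>(1)[of g] by (intro eq_matI) (auto simp: spectral_def rep_entry)

text \<open>The exponents must serve all \<open>s\<close> simultaneously. Changing one value of
  \<open>s\<close> at a time factors the matrix into pieces \<open>1 + (x - 1) P\<close> with
  \<open>P\<close> a projection, and each piece has a fixed exponent.\<close>

lemma det_spectral: "\<exists>m. \<forall>s. det (spectral s) = (\<Prod>a\<in>A. s a ^ m a)"
proof -
  let ?e = "\<lambda>b a. if a = b then 1 else 0 :: complex"
  have "\<exists>r. \<forall>x. det (spectral (\<lambda>a. if a = b then x else 1)) = x ^ r" for b
  proof -
    have "(\<lambda>a. 1 + (x - 1) * ?e b a) = (\<lambda>a. if a = b then x else 1)" for x by auto
    moreover have "spectral (?e b) * spectral (?e b) = spectral (?e b)"
      unfolding spectral_mult by (intro arg_cong[where f = spectral]) auto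
    note det_idempotent[OF spectral_carrier this]
    ultimately show ?thesis by (simp flip: spectral_affine)
  qed
  then obtain m where m: "\<And>b x. det (spectral (\<lambda>a. if a = b then x else 1)) = x ^ m b" by metis
  have "det (spectral (\<lambda>a. if a \<in> F then s a else 1)) = (\<Prod>a\<in>F. s a ^ m a)" if "finite F" for F s
    using that
  proof (induction F rule: finite_induct)
    case empty
    then show ?case by (simp add: spectral_one)
  next
    case (insert b F)
    have "spectral (\<lambda>a. if a \<in> insert b F then s a else 1)
      = spectral (\<lambda>a. if a = b then s b else 1) * spectral (\<lambda>a. if a \<in> F then s a else 1)"
      unfolding spectral_mult using insert.hyps by (intro arg_cong[where f = spectral]) auto
    then show ?case
      using insert m by (simp add: det_mult[OF spectral_carrier spectral_carrier])
  qed
  note * = this[OF finite_index]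
  have "det (spectral s) = (\<Prod>a\<in>A. s a ^ m a)" for s
  proof -
    have "spectral s = spectral (\<lambda>a. if a \<in> A then s a else 1)" by (rule spectral_cong) simp
    then show ?thesis by (simp only: *)
  qed
  then show ?thesis by blast
qed

text \<open>Taking \<open>s a = 1 + t * chi a g\<close> in the functional calculus gives
  \<open>det (1 + t \<rho> g)\<close>. The same \<open>m\<close> works for every \<open>g\<close>:
  these are the multiplicities of the linear characters in \<open>\<rho>\<close>, found without a
  simultaneous eigenbasis.\<close>

lemma rep_decomposition:
  "\<exists>m. \<forall>g\<in>carrier G. \<forall>n. mat_trace (ext_power_mat n (\<rho> g))
      = Polynomial.coeff (\<Prod>a\<in>A. [:1, chi a g:] ^ m a) n"
proof -
  obtain m where m: "\<And>s. det (spectral s) = (\<Prod>a\<in>A. s a ^ m a)" using det_spectral by blast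
  show ?thesis
  proof (intro exI ballI allI trace_ext_power_coeff)
    fix g assume g: "g \<in> carrier G"
    show "\<rho> g \<in> carrier_mat d d" using \<rho>(1)[OF g] .
    fix t show "det (1\<^sub>m d + t \<cdot>\<^sub>m \<rho> g) = poly (\<Prod>a\<in>A. [:1, chi a g:] ^ m a) t"
      unfolding spectral_rep[OF g, symmetric] spectral_affine[symmetric] m by (simp add: poly_prod)
  qed
qed

text \<open>The projections sum to the identity, so one of them has a nonzero entry at
  \<open>(0, 0)\<close>; its first column is the eigenvector.\<close>

lemma common_eigenvector:
  assumes "d > 0"
  obtains a v where "a \<in> A" "v \<in> carrier_vec d" "v \<noteq> 0\<^sub>v d" "\<And>g. g \<in> carrier G \<Longrightarrow> \<rho> g *\<^sub>v v = chi a g \<cdot>\<^sub>v v"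
proof -
  have "(\<Sum>a\<in>A. proj_entry \<rho> a 0 0) \<noteq> 0" using sum_proj_entry[OF assms assms] by simp
  then obtain a where a: "a \<in> A" "proj_entry \<rho> a 0 0 \<noteq> 0" by (meson sum.neutral)
  define v where "v = vec d (\<lambda>i. proj_entry \<rho> a i 0)"
  show thesis
  proof (rule that[OF a(1)])
    show "v \<in> carrier_vec d" by (simp add: v_def)
    have "v $ 0 \<noteq> 0\<^sub>v d $ 0" using a(2) assms by (simp add: v_def)
    then show "v \<noteq> 0\<^sub>v d" by metis
    fix g assume g: "g \<in> carrier G"
    show "\<rho> g *\<^sub>v v = chi a g \<cdot>\<^sub>v v"
      using \<rho>(1)[OF g] rep_proj_entry[OF g a(1) _ assms]
      by (intro eq_vecI) (auto simp: v_def scalar_prod_def lessThan_atLeast0)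
  qed
qed

end

text \<open>The line through a common eigenvector is invariant, hence the whole space, so the
  dimension is 1.\<close>

lemma irreducible_character:
  assumes "irreducible_rep G d \<rho>"
  shows "\<exists>a\<in>A. rep_character G \<rho> = restrict (chi a) (carrier G)"
proof -
  have rep: "representation G d \<rho>" and d: "d > 0"
    and irr: "\<And>W. VectorSpace.subspace class_ring W (module_vec TYPE(complex) d) \<Longrightarrow>
      (\<And>g w. g \<in> carrier G \<Longrightarrow> w \<in> W \<Longrightarrow> \<rho> g *\<^sub>v w \<in> W) \<Longrightarrow> W = {0\<^sub>v d} \<or> W = carrier_vec d"
    using assms by (auto simp: irreducible_rep_def)
  note \<rho> = representationD[OF is_group rep]
  obtain a v where a: "a \<in> A" and v: "v \<in> carrier_vec d" "v \<noteq> 0\<^sub>v d"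
    and ev: "\<And>g. g \<in> carrier G \<Longrightarrow> \<rho> g *\<^sub>v v = chi a g \<cdot>\<^sub>v v"
    using common_eigenvector[OF rep d] by blast
  define W where "W = range (\<lambda>c. c \<cdot>\<^sub>v v)"
  interpret V: vectorspace class_ring "module_vec TYPE(complex) d" by (rule vec_vs)
  have "submodule class_ring W (module_vec TYPE(complex) d)"
  proof
    show "W \<subseteq> carrier (module_vec TYPE(complex) d)" using v(1) by (auto simp: W_def module_vec_simps)
    show "x \<oplus>\<^bsub>module_vec TYPE(complex) d\<^esub> y \<in> W" if "x \<in> W" "y \<in> W" for x y
      using that by (auto simp: W_def module_vec_simps add_smult_distrib_vec[symmetric])
    show "\<zero>\<^bsub>module_vec TYPE(complex) d\<^esub> \<in> W"
      using v(1) by (auto simp: W_def module_vec_simps image_iff intro!: exI[of _ 0])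
    show "c \<odot>\<^bsub>module_vec TYPE(complex) d\<^esub> x \<in> W" if "x \<in> W" for c x
      using that by (auto simp: W_def module_vec_simps smult_smult_assoc)
  qed
  then have "VectorSpace.subspace class_ring W (module_vec TYPE(complex) d)"
    by (intro VectorSpace.subspace.intro V.vectorspace_axioms)
  moreover have "\<rho> g *\<^sub>v w \<in> W" if g: "g \<in> carrier G" "w \<in> W" for g w
  proof -
    obtain c where "w = c \<cdot>\<^sub>v v" using g(2) by (auto simp: W_def)
    then have "\<rho> g *\<^sub>v w = (c * chi a g) \<cdot>\<^sub>v v"
      using mult_mat_vec[OF \<rho>(1)[OF g(1)] v(1)] ev[OF g(1)] by (simp add: smult_smult_assoc)
    then show ?thesis by (simp add: W_def)
  qed
  ultimately have "W = {0\<^sub>v d} \<or> W = carrier_vec d" by (rule irr)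
  moreover have "v \<in> W" unfolding W_def by (rule range_eqI[of _ _ 1]) simp
  ultimately have W: "W = carrier_vec d" using v(2) by blast
  have d1: "d = 1"
  proof (rule ccontr)
    assume "d \<noteq> 1"
    then have "d > 1" using d by simp
    have "unit_vec d 0 \<in> W" "unit_vec d 1 \<in> W" unfolding W by simp_all
    then obtain b c where b: "unit_vec d 0 = b \<cdot>\<^sub>v v" and c: "unit_vec d 1 = c \<cdot>\<^sub>v v"
      unfolding W_def by blast
    have "b * v $ 0 = 1" "c * v $ 0 = 0" "c * v $ 1 = 1"
      using arg_cong[OF b, of "\<lambda>w :: complex vec. w $ 0"] arg_cong[OF c, of "\<lambda>w :: complex vec. w $ 0"] arg_cong[OF c, of "\<lambda>w :: complex vec. w $ 1"]
        \<open>d > 1\<close> v(1) by simp_all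
    then show False by auto
  qed
  have "v $ 0 \<noteq> 0"
  proof
    assume "v $ 0 = 0"
    then have "v = 0\<^sub>v d" using v(1) d1 by (intro eq_vecI) auto
    then show False using v(2) by simp
  qed
  moreover have "\<rho> g $$ (0, 0) * v $ 0 = chi a g * v $ 0" if "g \<in> carrier G" for g
    using arg_cong[OF ev[OF that], of "\<lambda>w :: complex vec. w $ 0"] \<rho>(1)[OF that] v(1) d1
    by (simp add: scalar_prod_def)
  ultimately have "\<rho> g $$ (0, 0) = chi a g" if "g \<in> carrier G" for g using that by simp
  then have "mat_trace (\<rho> g) = chi a g" if "g \<in> carrier G" for g
    using \<rho>(1)[OF that] d1 that by (simp add: mat_trace_def)
  then have "rep_character G \<rho> = restrict (chi a) (carrier G)"
    by (auto simp: rep_character_def)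
  then show ?thesis using a by blast
qed

lemma linear_rep:
  assumes "a \<in> A"
  defines "\<rho> \<equiv> \<lambda>g. mat 1 1 (\<lambda>_. chi a g)"
  shows "irreducible_rep G 1 \<rho>" "rep_character G \<rho> = restrict (chi a) (carrier G)"
proof -
  let ?R = "ring_mat TYPE(complex) 1 ()"
  have mult: "\<rho> g * \<rho> h = mat 1 1 (\<lambda>_. chi a g * chi a h)" for g h
    by (rule eq_matI) (auto simp: \<rho>_def scalar_prod_def)
  have one: "mat 1 1 (\<lambda>_. 1) = (1\<^sub>m 1 :: complex mat)" by (rule eq_matI) auto
  have inv: "\<rho> g * \<rho> (inv g) = 1\<^sub>m 1" "\<rho> (inv g) * \<rho> g = 1\<^sub>m 1" if "g \<in> carrier G" for g
    using that assms(1) by (simp_all add: mult chi_mult[symmetric] chi_one one del: One_nat_def)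
  have c: "\<rho> g \<in> carrier_mat 1 1" for g by (simp add: \<rho>_def)
  have "\<rho> g \<in> Units ?R" if "g \<in> carrier G" for g
    unfolding Units_def ring_mat_simps using inv[OF that] c by blast
  then have rep: "representation G 1 \<rho>"
    unfolding representation_def hom_def units_of_carrier units_of_mult ring_mat_simps
    using mult assms(1) by (auto simp: \<rho>_def chi_mult)
  moreover have "W = {0\<^sub>v 1} \<or> W = carrier_vec 1"
    if "VectorSpace.subspace class_ring W (module_vec TYPE(complex) 1)" for W
  proof -
    interpret W: submodule class_ring W "module_vec TYPE(complex) 1"
      using that by (simp add: VectorSpace.subspace_def)
    have sub: "W \<subseteq> carrier_vec 1" using W.subset by (simp add: module_vec_simps)
    have zero: "0\<^sub>v 1 \<in> W" using W.zero_closed by (simp add: module_vec_simps)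
    show ?thesis
    proof (cases "W \<subseteq> {0\<^sub>v 1}")
      case True
      then show ?thesis using zero by blast
    next
      case False
      then obtain w where w: "w \<in> W" "w \<noteq> 0\<^sub>v 1" by blast
      have "dim_vec w = 1" using w(1) sub by auto
      then have "w $ 0 \<noteq> 0" using w(2) by (auto simp: vec_eq_iff)
      have "x \<in> W" if "x \<in> carrier_vec 1" for x
      proof -
        have "x = (x $ 0 / w $ 0) \<cdot>\<^sub>v w"
          using that \<open>w $ 0 \<noteq> 0\<close> \<open>dim_vec w = 1\<close> by (intro eq_vecI) auto
        moreover have "(x $ 0 / w $ 0) \<cdot>\<^sub>v w \<in> W"
          using W.smult_closed[OF _ w(1), of "x $ 0 / w $ 0"] by (simp add: module_vec_simps)
        ultimately show ?thesis by simp
      qed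
      then show ?thesis using sub by blast
    qed
  qed
  ultimately show "irreducible_rep G 1 \<rho>" by (auto simp: irreducible_rep_def)
  show "rep_character G \<rho> = restrict (chi a) (carrier G)"
    by (auto simp: rep_character_def mat_trace_def \<rho>_def)
qed

lemma irr_characters_eq: "irr_characters G = (\<lambda>a. restrict (chi a) (carrier G)) ` A"
proof (intro equalityI subsetI)
  fix x assume "x \<in> irr_characters G"
  then obtain d \<rho> where "x = rep_character G \<rho>" "irreducible_rep G d \<rho>"
    by (auto simp: irr_characters_def)
  with irreducible_character[of d \<rho>] show "x \<in> (\<lambda>a. restrict (chi a) (carrier G)) ` A" by auto
next
  fix x assume "x \<in> (\<lambda>a. restrict (chi a) (carrier G)) ` A"
  then obtain a where a: "a \<in> A" "x = restrict (chi a) (carrier G)" by blast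
  have "x = rep_character G (\<lambda>g. mat 1 1 (\<lambda>_. chi a g))"
    using linear_rep(2)[OF a(1)] a(2) by simp
  then show "x \<in> irr_characters G"
    using linear_rep(1)[OF a(1)] unfolding irr_characters_def by blast
qed

end

section \<open>Lambda and gamma operations on virtual characters\<close>

lemma function_ring_simps:
  "carrier (function_ring G) = carrier G \<rightarrow>\<^sub>E UNIV"
  "x \<otimes>\<^bsub>function_ring G\<^esub> y = (\<lambda>g\<in>carrier G. x g * y g)"
  "x \<oplus>\<^bsub>function_ring G\<^esub> y = (\<lambda>g\<in>carrier G. x g + y g)"
  "\<one>\<^bsub>function_ring G\<^esub> = (\<lambda>g\<in>carrier G. 1)"
  "\<zero>\<^bsub>function_ring G\<^esub> = (\<lambda>g\<in>carrier G. 0)"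
  by (simp_all add: function_ring_def)

lemma char_ring_simps:
  "x \<otimes>\<^bsub>char_ring G\<^esub> y = (\<lambda>g\<in>carrier G. x g * y g)"
  "x \<oplus>\<^bsub>char_ring G\<^esub> y = (\<lambda>g\<in>carrier G. x g + y g)"
  "\<one>\<^bsub>char_ring G\<^esub> = (\<lambda>g\<in>carrier G. 1)"
  "\<zero>\<^bsub>char_ring G\<^esub> = (\<lambda>g\<in>carrier G. 0)"
  by (simp_all add: char_ring_def function_ring_def)

lemma function_ring_add_group: "group (add_monoid (function_ring G))"
proof (rule groupI)
  fix x assume "x \<in> carrier (add_monoid (function_ring G))"
  then show "\<exists>y\<in>carrier (add_monoid (function_ring G)). y \<otimes>\<^bsub>add_monoid (function_ring G)\<^esub> x = \<one>\<^bsub>add_monoid (function_ring G)\<^esub>"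
    by (intro bexI[of _ "\<lambda>g\<in>carrier G. - x g"]) (auto simp: function_ring_simps)
qed (auto simp: function_ring_simps algebra_simps PiE_def intro!: extensionalityI[of _ "carrier G"])

lemma function_ring_neg:
  assumes "x \<in> carrier G \<rightarrow>\<^sub>E UNIV"
  shows "inv\<^bsub>add_monoid (function_ring G)\<^esub> x = (\<lambda>g\<in>carrier G. - x g)"
proof -
  interpret F: group "add_monoid (function_ring G)" by (rule function_ring_add_group)
  show ?thesis
    using assms by (intro F.inv_equality) (auto simp: function_ring_simps)
qed

text \<open>The series \<open>(1 + z t)^c\<close>. A general exponent \<open>c\<close> makes room
  for negative multiplicities.\<close>

definition binomial_fps :: "complex \<Rightarrow> complex \<Rightarrow> complex fps" where
  "binomial_fps c z = Abs_fps (\<lambda>j. (c gchoose j) * z ^ j)"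

lemma binomial_fps_add: "binomial_fps (c + d) z = binomial_fps c z * binomial_fps d z"
proof (rule fps_ext)
  fix n
  have "fps_nth (binomial_fps c z * binomial_fps d z) n
    = (\<Sum>i=0..n. (c gchoose i) * (d gchoose (n - i)) * (z ^ i * z ^ (n - i)))"
    by (simp add: fps_mult_nth binomial_fps_def mult_ac)
  also have "\<dots> = (\<Sum>i=0..n. (c gchoose i) * (d gchoose (n - i))) * z ^ n"
    unfolding sum_distrib_right by (intro sum.cong) (auto simp flip: power_add)
  finally show "fps_nth (binomial_fps (c + d) z) n = fps_nth (binomial_fps c z * binomial_fps d z) n"
    by (simp add: binomial_fps_def gbinomial_Vandermonde)
qed

lemma binomial_fps_0: "binomial_fps 0 z = 1"
  by (rule fps_ext) (auto simp: binomial_fps_def gbinomial_0_left)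

lemma binomial_fps_1: "binomial_fps 1 z = fps_of_poly [:1, z:]"
proof (rule fps_ext)
  fix n
  have "(1 gchoose n :: complex) = of_nat (1 choose n)" using binomial_gbinomial[of 1 n, where ?'a = complex] by (simp only: of_nat_1)
  then show "fps_nth (binomial_fps 1 z) n = fps_nth (fps_of_poly [:1, z:]) n"
    by (cases n; cases "n - 1") (auto simp: binomial_fps_def coeff_pCons)
qed

lemma binomial_fps_of_nat: "binomial_fps (of_nat m) z = fps_of_poly ([:1, z:] ^ m)"
  by (induction m) (auto simp: binomial_fps_0 binomial_fps_1 binomial_fps_add fps_of_poly_mult)

context dual_group
begin

section \<open>The ring of virtual characters\<close>

abbreviation (input) "V \<equiv> carrier (char_ring G)"

definition X :: "'i \<Rightarrow> 'a \<Rightarrow> complex" where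
  "X a = restrict (chi a) (carrier G)"

definition cst :: "int \<Rightarrow> 'a \<Rightarrow> complex" where
  "cst c = (\<lambda>g\<in>carrier G. of_int c)"

definition neg :: "('a \<Rightarrow> complex) \<Rightarrow> 'a \<Rightarrow> complex" where
  "neg x = (\<lambda>g\<in>carrier G. - x g)"

abbreviation add_V (infixl "\<boxplus>" 65) where "x \<boxplus> y \<equiv> x \<oplus>\<^bsub>char_ring G\<^esub> y"
abbreviation mult_V (infixl "\<boxtimes>" 70) where "x \<boxtimes> y \<equiv> x \<otimes>\<^bsub>char_ring G\<^esub> y"

lemma add_apply [simp]: "g \<in> carrier G \<Longrightarrow> (x \<boxplus> y) g = x g + y g"
  and mult_apply [simp]: "g \<in> carrier G \<Longrightarrow> (x \<boxtimes> y) g = x g * y g"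
  and neg_apply [simp]: "g \<in> carrier G \<Longrightarrow> neg x g = - x g"
  and cst_apply [simp]: "g \<in> carrier G \<Longrightarrow> cst c g = of_int c"
  and X_apply [simp]: "g \<in> carrier G \<Longrightarrow> X a g = chi a g"
  by (simp_all add: char_ring_simps neg_def cst_def X_def)

lemma one_V: "\<one>\<^bsub>char_ring G\<^esub> = cst 1" and zero_V: "\<zero>\<^bsub>char_ring G\<^esub> = cst 0"
  by (simp_all add: char_ring_simps cst_def)

lemma extensional_ops [simp]:
  "x \<boxplus> y \<in> extensional (carrier G)" "x \<boxtimes> y \<in> extensional (carrier G)" "neg x \<in> extensional (carrier G)"
  "cst c \<in> extensional (carrier G)" "X a \<in> extensional (carrier G)"
  by (simp_all add: char_ring_simps neg_def cst_def X_def)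

lemma V_eq: "V = generate (add_monoid (function_ring G)) (X ` A)"
  by (simp add: char_ring_def irr_characters_eq X_def)

lemma X_in_functions: "X ` A \<subseteq> carrier (add_monoid (function_ring G))"
  by (auto simp: X_def function_ring_simps)

lemma V_subgroup: "subgroup V (add_monoid (function_ring G))"
  unfolding V_eq by (rule group.generate_is_subgroup[OF function_ring_add_group X_in_functions])

lemma V_extensional: "x \<in> V \<Longrightarrow> x \<in> extensional (carrier G)"
  using subgroup.subset[OF V_subgroup] by (auto simp: function_ring_simps PiE_def)

lemma V_eqI:
  assumes "x \<in> extensional (carrier G)" "y \<in> extensional (carrier G)" "\<And>g. g \<in> carrier G \<Longrightarrow> x g = y g"
  shows "x = y"
  by (rule extensionalityI[OF assms])

lemma V_add: "x \<in> V \<Longrightarrow> y \<in> V \<Longrightarrow> x \<boxplus> y \<in> V"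
  using subgroup.m_closed[OF V_subgroup, of x y] by (simp add: char_ring_simps function_ring_simps)

lemma V_neg: "x \<in> V \<Longrightarrow> neg x \<in> V"
proof -
  assume x: "x \<in> V"
  have "inv\<^bsub>add_monoid (function_ring G)\<^esub> x = neg x"
    unfolding neg_def by (rule function_ring_neg) (simp add: V_extensional[OF x] PiE_def)
  then show "neg x \<in> V" using subgroup.m_inv_closed[OF V_subgroup x] by metis
qed

lemma V_zero: "cst 0 \<in> V"
  using subgroup.one_closed[OF V_subgroup] by (simp add: cst_def function_ring_simps)

lemma V_X: "a \<in> A \<Longrightarrow> X a \<in> V"
  unfolding V_eq by (blast intro: generate.incl)

lemma V_one: "cst 1 \<in> V"
proof -
  obtain a where "a \<in> A" "\<And>g. g \<in> carrier G \<Longrightarrow> chi a g = 1" using chi_trivial by blast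
  then have "cst 1 = X a" by (auto intro: V_eqI)
  then show ?thesis using V_X \<open>a \<in> A\<close> by simp
qed

lemma V_cst_nat: "cst (int n) \<in> V"
proof (induction n)
  case (Suc n)
  have "cst (int (Suc n)) = cst (int n) \<boxplus> cst 1" by (rule V_eqI) auto
  then show ?case using V_add[OF Suc V_one] by simp
qed (use V_zero in simp)

lemma V_cst: "cst c \<in> V"
proof (cases "c \<ge> 0")
  case True
  then show ?thesis using V_cst_nat[of "nat c"] by simp
next
  case False
  then have "cst c = neg (cst (int (nat (- c))))" by (intro V_eqI) auto
  then show ?thesis by (metis V_neg V_cst_nat)
qed

text \<open>Steps by single linear characters fit the recursion for \<open>\<lambda>\<close>, which
  is explicit precisely for such summands.\<close>

lemma V_induct [consumes 1, case_names zero plus minus]: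
  assumes "x \<in> V" and zero: "P (cst 0)"
    and plus: "\<And>x a. x \<in> V \<Longrightarrow> a \<in> A \<Longrightarrow> P x \<Longrightarrow> P (x \<boxplus> X a)"
    and minus: "\<And>x a. x \<in> V \<Longrightarrow> a \<in> A \<Longrightarrow> P x \<Longrightarrow> P (x \<boxplus> neg (X a))"
  shows "P x"
proof -
  \<comment> \<open>Generated elements are sums of two generated elements, so the claim is
    strengthened to an arbitrary starting point \<open>y\<close>.\<close>
  have "y \<in> V \<Longrightarrow> P y \<Longrightarrow> P (y \<boxplus> x)" if "x \<in> generate (add_monoid (function_ring G)) (X ` A)" for x y
    using that
  proof (induction arbitrary: y rule: generate.induct)
    case one
    have "y \<boxplus> \<one>\<^bsub>add_monoid (function_ring G)\<^esub> = y"
      using V_extensional[OF one(1)] by (intro V_eqI) (auto simp: function_ring_simps)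
    then show ?case using one by simp
  next
    case (incl h)
    then show ?case using plus by auto
  next
    case (inv h)
    then obtain a where a: "a \<in> A" "h = X a" by blast
    have "inv\<^bsub>add_monoid (function_ring G)\<^esub> h = neg (X a)"
      unfolding a(2) neg_def by (rule function_ring_neg) (simp add: X_def)
    then show ?case using minus inv a by simp
  next
    case (eng h1 h2)
    have "h1 \<in> V" using eng.hyps V_eq by simp
    have "P ((y \<boxplus> h1) \<boxplus> h2)"
      using eng V_add[OF eng.prems(1) \<open>h1 \<in> V\<close>] by blast
    moreover have "(y \<boxplus> h1) \<boxplus> h2 = y \<boxplus> (h1 \<otimes>\<^bsub>add_monoid (function_ring G)\<^esub> h2)"
      by (rule V_eqI) (auto simp: function_ring_simps)
    ultimately show ?case by simp
  qed
  from this[of x "cst 0"] assms(1) have "P (cst 0 \<boxplus> x)" using zero V_zero V_eq by simp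
  moreover have "cst 0 \<boxplus> x = x" using V_extensional[OF assms(1)] by (intro V_eqI) auto
  ultimately show ?thesis by simp
qed

lemma V_mult_X:
  assumes "x \<in> V" "a \<in> A"
  shows "x \<boxtimes> X a \<in> V"
  using assms(1)
proof (induction rule: V_induct)
  case zero
  have "cst 0 \<boxtimes> X a = cst 0" by (rule V_eqI) auto
  then show ?case using V_zero by simp
next
  case (plus x b)
  obtain c where c: "c \<in> A" "\<And>g. g \<in> carrier G \<Longrightarrow> chi c g = chi b g * chi a g"
    using chi_prod[OF plus(2) assms(2)] by blast
  have "(x \<boxplus> X b) \<boxtimes> X a = x \<boxtimes> X a \<boxplus> X c"
    using c by (intro V_eqI) (auto simp: algebra_simps)
  then show ?case using V_add[OF plus(3) V_X[OF c(1)]] by simp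
next
  case (minus x b)
  obtain c where c: "c \<in> A" "\<And>g. g \<in> carrier G \<Longrightarrow> chi c g = chi b g * chi a g"
    using chi_prod[OF minus(2) assms(2)] by blast
  have "(x \<boxplus> neg (X b)) \<boxtimes> X a = x \<boxtimes> X a \<boxplus> neg (X c)"
    using c by (intro V_eqI) (auto simp: algebra_simps)
  then show ?case using V_add[OF minus(3) V_neg[OF V_X[OF c(1)]]] by simp
qed

lemma V_mult:
  assumes "x \<in> V" "y \<in> V"
  shows "x \<boxtimes> y \<in> V"
  using assms(2)
proof (induction rule: V_induct)
  case zero
  have "x \<boxtimes> cst 0 = cst 0" by (rule V_eqI) auto
  then show ?case using V_zero by simp
next
  case (plus y b)
  have "x \<boxtimes> (y \<boxplus> X b) = x \<boxtimes> y \<boxplus> x \<boxtimes> X b" by (rule V_eqI) (auto simp: algebra_simps)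
  then show ?case using V_add[OF plus(3) V_mult_X[OF assms(1) plus(2)]] by simp
next
  case (minus y b)
  have "x \<boxtimes> (y \<boxplus> neg (X b)) = x \<boxtimes> y \<boxplus> neg (x \<boxtimes> X b)" by (rule V_eqI) (auto simp: algebra_simps)
  then show ?case using V_add[OF minus(3) V_neg[OF V_mult_X[OF assms(1) minus(2)]]] by simp
qed

lemma cring_char_ring: "cring (char_ring G)"
proof (rule cringI)
  show "abelian_group (char_ring G)"
  proof (rule abelian_groupI)
    fix x assume x: "x \<in> V"
    show "\<exists>y\<in>V. y \<boxplus> x = \<zero>\<^bsub>char_ring G\<^esub>"
      by (rule bexI[OF _ V_neg[OF x]], unfold zero_V, rule V_eqI) auto
    show "\<zero>\<^bsub>char_ring G\<^esub> \<boxplus> x = x"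
      unfolding zero_V using V_extensional[OF x] by (intro V_eqI) auto
  qed (auto simp: V_add V_zero zero_V intro: V_eqI)
  show "Group.comm_monoid (char_ring G)"
  proof (rule comm_monoidI)
    fix x assume x: "x \<in> V"
    show "\<one>\<^bsub>char_ring G\<^esub> \<boxtimes> x = x"
      unfolding one_V using V_extensional[OF x] by (intro V_eqI) auto
  qed (auto simp: V_mult V_one one_V intro: V_eqI)
  show "(x \<boxplus> y) \<boxtimes> z = x \<boxtimes> z \<boxplus> y \<boxtimes> z" for x y z
    by (rule V_eqI) (auto simp: algebra_simps)
qed

lemma finsum_apply:
  assumes "finite I" "\<And>i. i \<in> I \<Longrightarrow> f i \<in> V" "g \<in> carrier G"
  shows "(\<Oplus>\<^bsub>char_ring G\<^esub>i\<in>I. f i) g = (\<Sum>i\<in>I. f i g)"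
proof -
  interpret R: cring "char_ring G" by (rule cring_char_ring)
  show ?thesis using assms(1,2)
  proof (induction I rule: finite_induct)
    case empty
    then show ?case using assms(3) by (simp add: zero_V)
  next
    case (insert i I)
    then show ?case using assms(3) by (subst R.finsum_insert) auto
  qed
qed

text \<open>The multiplicity of \<open>chi a\<close>, read off by the inner product. Being a
  function of \<open>x\<close> itself, it avoids choosing a difference of two characters.\<close>

definition coef :: "'i \<Rightarrow> ('a \<Rightarrow> complex) \<Rightarrow> complex" where
  "coef a x = (\<Sum>g\<in>carrier G. chi a (inv g) * x g) / N"

lemma coef_add: "coef a (x \<boxplus> y) = coef a x + coef a y"
  by (simp add: coef_def algebra_simps sum.distrib add_divide_distrib)

lemma coef_0: "coef a (cst 0) = 0"
  by (simp add: coef_def)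

lemma coef_X: "a \<in> A \<Longrightarrow> b \<in> A \<Longrightarrow> coef a (X b) = (if a = b then 1 else 0)"
  using N_nonzero by (simp add: coef_def orthogonality)

text \<open>The generating series of the values \<open>\<lambda>^n(x)(g)\<close>. It turns sums into
  products by construction, which is the addition formula.\<close>

definition lambda_series :: "('a \<Rightarrow> complex) \<Rightarrow> 'a \<Rightarrow> complex fps" where
  "lambda_series x g = (\<Prod>a\<in>A. binomial_fps (coef a x) (chi a g))"

lemma lambda_series_add: "lambda_series (x \<boxplus> y) g = lambda_series x g * lambda_series y g"
  by (simp add: lambda_series_def coef_add binomial_fps_add prod.distrib)

lemma lambda_series_0: "lambda_series (cst 0) g = 1"
  by (simp add: lambda_series_def coef_0 binomial_fps_0)

lemma lambda_series_X:
  assumes "b \<in> A"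
  shows "lambda_series (X b) g = fps_of_poly [:1, chi b g:]"
proof -
  have "lambda_series (X b) g = (\<Prod>a\<in>A. if a = b then fps_of_poly [:1, chi b g:] else 1)"
    unfolding lambda_series_def using assms
    by (intro prod.cong) (auto simp: coef_X binomial_fps_0 binomial_fps_1)
  then show ?thesis using assms finite_index by simp
qed

lemma lambda_series_add_X:
  assumes "a \<in> A"
  shows "fps_nth (lambda_series (x \<boxplus> X a) g) n
    = fps_nth (lambda_series x g) n + (if n = 0 then 0 else chi a g * fps_nth (lambda_series x g) (n - 1))"
proof -
  have eq: "fps_of_poly [:1, chi a g:] = 1 + fps_const (chi a g) * fps_X"
    by (rule fps_ext) (auto simp: coeff_pCons split: nat.split)
  show ?thesis
    unfolding lambda_series_add lambda_series_X[OF assms] eq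
    by (cases n) (auto simp: distrib_left mult.left_commute[of _ "fps_const _"])
qed

lemma lambda_series_nth_0: "fps_nth (lambda_series x g) 0 = 1"
proof -
  have "fps_nth (\<Prod>a\<in>B. binomial_fps (coef a x) (chi a g)) 0 = 1" for B
    by (induction B rule: infinite_finite_induct) (auto simp: binomial_fps_def)
  then show ?thesis by (simp add: lambda_series_def)
qed

lemma add_neg_cancel: "x \<in> V \<Longrightarrow> (x \<boxplus> neg y) \<boxplus> y = x"
  using V_extensional[of x] by (intro V_eqI) auto

section \<open>Existence of the lambda operations\<close>

definition lam :: "nat \<Rightarrow> ('a \<Rightarrow> complex) \<Rightarrow> 'a \<Rightarrow> complex" where
  "lam n = (\<lambda>x\<in>V. \<lambda>g\<in>carrier G. fps_nth (lambda_series x g) n)"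

lemma lam_apply: "x \<in> V \<Longrightarrow> g \<in> carrier G \<Longrightarrow> lam n x g = fps_nth (lambda_series x g) n"
  by (simp add: lam_def)

lemma lam_extensional [simp]: "x \<in> V \<Longrightarrow> lam n x \<in> extensional (carrier G)"
  by (simp add: lam_def)

lemma lam_add_X:
  assumes "x \<in> V" "a \<in> A" "g \<in> carrier G"
  shows "lam n (x \<boxplus> X a) g = lam n x g + (if n = 0 then 0 else chi a g * lam (n - 1) x g)"
  using assms V_add[OF assms(1) V_X[OF assms(2)]] by (simp add: lam_apply lambda_series_add_X)

lemma lam_0: "x \<in> V \<Longrightarrow> lam 0 x = cst 1"
  by (rule V_eqI) (auto simp: lam_apply lambda_series_nth_0)

text \<open>The binomial formula does not display integrality. Adding a linear character preserves
  it visibly; for subtraction, \<open>\<lambda>^(n+1)(y) = \<lambda>^(n+1)(y + \<chi>) - \<chi>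
  \<lambda>^n(y)\<close> is solved by induction on \<open>n\<close>.\<close>

lemma lam_closed:
  assumes "x \<in> V"
  shows "lam n x \<in> V"
proof -
  have "\<forall>n. lam n x \<in> V" using assms
  proof (induction rule: V_induct)
    case zero
    have "lam n (cst 0) = cst (if n = 0 then 1 else 0)" for n
      by (rule V_eqI) (auto simp: lam_apply V_zero lambda_series_0)
    then show ?case using V_cst by metis
  next
    case (plus x a)
    have "lam n (x \<boxplus> X a) \<in> V" for n
    proof (cases n)
      case 0
      then show ?thesis using lam_0 V_add V_X V_one plus by simp
    next
      case (Suc m)
      have "lam n (x \<boxplus> X a) = lam n x \<boxplus> X a \<boxtimes> lam m x"
        using plus(1,2) V_add V_X Suc by (intro V_eqI) (auto simp: lam_add_X)
      then show ?thesis using plus V_add V_mult V_X by metis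
    qed
    then show ?case by blast
  next
    case (minus x a)
    define y where "y = x \<boxplus> neg (X a)"
    have y: "y \<in> V" using minus V_add V_neg V_X by (simp add: y_def)
    have x: "x = y \<boxplus> X a" using add_neg_cancel[OF minus(1)] by (simp add: y_def)
    have "lam n y \<in> V" for n
    proof (induction n)
      case 0
      then show ?case using lam_0 y V_one by simp
    next
      case (Suc n)
      have "lam (Suc n) y = lam (Suc n) x \<boxplus> neg (X a \<boxtimes> lam n y)"
        using y minus(2) V_add V_X by (intro V_eqI) (auto simp: lam_add_X x)
      moreover have "lam (Suc n) x \<in> V" using minus(3) by simp
      ultimately show ?case using Suc V_add V_mult V_X[OF minus(2)] V_neg by metis
    qed
    then show ?case by (simp add: y_def)
  qed
  then show ?thesis by blast
qed

lemma lam_1: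
  assumes "x \<in> V"
  shows "lam 1 x = x"
proof -
  have "\<forall>g\<in>carrier G. lam 1 x g = x g" using assms
  proof (induction rule: V_induct)
    case zero
    then show ?case by (auto simp: lam_apply V_zero lambda_series_0)
  next
    case (plus x a)
    then show ?case by (auto simp: lam_add_X lam_0)
  next
    case (minus x a)
    define y where "y = x \<boxplus> neg (X a)"
    have y: "y \<in> V" using minus V_add V_neg V_X by (simp add: y_def)
    have x: "x = y \<boxplus> X a" using add_neg_cancel[OF minus(1)] by (simp add: y_def)
    show ?case unfolding y_def[symmetric]
    proof
      fix g assume g: "g \<in> carrier G"
      have "lam 1 x g = lam 1 y g + chi a g"
        using lam_add_X[OF y minus(2) g, of 1] lam_0[OF y] g unfolding x by simp
      moreover have "lam 1 x g = x g" using minus(3) g by blast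
      ultimately show "lam 1 y g = y g" using g by (simp add: y_def eq_diff_eq)
    qed
  qed
  then show ?thesis using assms V_extensional by (intro V_eqI) auto
qed

lemma V_sum_X: "(\<lambda>g\<in>carrier G. \<Sum>a\<in>A. of_nat (m a) * chi a g) \<in> V"
proof -
  have mult: "(\<lambda>g\<in>carrier G. of_nat c * chi a g) \<in> V" if "a \<in> A" for a c
  proof (induction c)
    case 0
    have "(\<lambda>g\<in>carrier G. of_nat 0 * chi a g) = cst 0" by (rule V_eqI) auto
    then show ?case using V_zero by simp
  next
    case (Suc c)
    have "(\<lambda>g\<in>carrier G. of_nat (Suc c) * chi a g) = (\<lambda>g\<in>carrier G. of_nat c * chi a g) \<boxplus> X a"
      by (rule V_eqI) (auto simp: algebra_simps)
    then show ?case by (simp only: V_add[OF Suc V_X[OF that]])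
  qed
  have "(\<lambda>g\<in>carrier G. \<Sum>a\<in>B. of_nat (m a) * chi a g) \<in> V" if "finite B" "B \<subseteq> A" for B
    using that
  proof (induction B rule: finite_induct)
    case empty
    have "(\<lambda>g\<in>carrier G. \<Sum>a\<in>{}. of_nat (m a) * chi a g) = cst 0" by (rule V_eqI) auto
    then show ?case using V_zero by simp
  next
    case (insert b B)
    have "(\<lambda>g\<in>carrier G. \<Sum>a\<in>insert b B. of_nat (m a) * chi a g)
      = (\<lambda>g\<in>carrier G. \<Sum>a\<in>B. of_nat (m a) * chi a g) \<boxplus> (\<lambda>g\<in>carrier G. of_nat (m b) * chi b g)"
      using insert by (intro V_eqI) (auto simp: algebra_simps)
    moreover have "(\<lambda>g\<in>carrier G. \<Sum>a\<in>B. of_nat (m a) * chi a g)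
      \<boxplus> (\<lambda>g\<in>carrier G. of_nat (m b) * chi b g) \<in> V"
      by (rule V_add[OF insert.IH mult]) (use insert.prems in auto)
    ultimately show ?case by simp
  qed
  from this[OF finite_index] show ?thesis by simp
qed

text \<open>The multiplicities of \<open>rep_decomposition\<close> define a virtual character
  \<open>x\<close> whose series has the exterior traces as coefficients. Its coefficient in degree 1
  identifies \<open>x\<close> with the character of \<open>\<rho>\<close>; the other degrees then
  give the exterior powers.\<close>

lemma rep_character_lam:
  assumes "representation G d \<rho>"
  shows "rep_character G \<rho> \<in> V"
    and "lam n (rep_character G \<rho>) = rep_character G (ext_power_rep n \<rho>)"
proof -
  note \<rho> = representationD[OF is_group assms]
  obtain m where m: "\<And>g n. g \<in> carrier G \<Longrightarrow>
      mat_trace (ext_power_mat n (\<rho> g)) = Polynomial.coeff (\<Prod>a\<in>A. [:1, chi a g:] ^ m a) n"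
    using rep_decomposition[OF assms] by blast
  define x where "x = (\<lambda>g\<in>carrier G. \<Sum>a\<in>A. of_nat (m a) * chi a g)"
  have xV: "x \<in> V" unfolding x_def by (rule V_sum_X)
  have coef: "coef b x = of_nat (m b)" if b: "b \<in> A" for b
  proof -
    have "(\<Sum>g\<in>carrier G. chi b (inv g) * x g)
      = (\<Sum>g\<in>carrier G. \<Sum>a\<in>A. of_nat (m a) * (chi b (inv g) * chi a g))"
      by (intro sum.cong refl) (simp add: x_def sum_distrib_left mult_ac)
    also have "\<dots> = (\<Sum>a\<in>A. of_nat (m a) * (\<Sum>g\<in>carrier G. chi b (inv g) * chi a g))"
      by (subst sum.swap) (simp add: sum_distrib_left)
    also have "\<dots> = (\<Sum>a\<in>A. if b = a then of_nat (m a) * N else 0)"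
      using b by (intro sum.cong refl) (simp add: orthogonality)
    also have "\<dots> = of_nat (m b) * N" using b finite_index by simp
    finally show ?thesis using N_nonzero by (simp add: coef_def)
  qed
  have series: "lambda_series x g = fps_of_poly (\<Prod>a\<in>A. [:1, chi a g:] ^ m a)" for g
    unfolding lambda_series_def fps_of_poly_prod
    by (intro prod.cong refl) (simp add: coef binomial_fps_of_nat)
  have lamx: "lam n x g = mat_trace (ext_power_mat n (\<rho> g))" if "g \<in> carrier G" for n g
    using that m by (simp add: lam_apply[OF xV] series)
  have "rep_character G \<rho> = x"
  proof (rule V_eqI)
    fix g assume g: "g \<in> carrier G"
    have "rep_character G \<rho> g = lam 1 x g"
      using g trace_ext_power_1[OF \<rho>(1)[OF g]] lamx[OF g, of 1] by (simp add: rep_character_def)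
    then show "rep_character G \<rho> g = x g" using lam_1[OF xV] by simp
  qed (use V_extensional[OF xV] in \<open>auto simp: rep_character_def\<close>)
  then show "rep_character G \<rho> \<in> V" "lam n (rep_character G \<rho>) = rep_character G (ext_power_rep n \<rho>)"
    using xV lamx by (auto intro!: V_eqI simp: rep_character_def ext_power_rep_def)
qed

lemma lambda_family_lam: "lambda_family G lam"
  unfolding lambda_family_def
proof (intro conjI allI impI ballI)
  fix n show "lam n \<in> V \<rightarrow>\<^sub>E V"
    using lam_closed by (auto simp: lam_def)
next
  fix n d \<rho> assume "representation G d \<rho>"
  then show "lam n (rep_character G \<rho>) = rep_character G (ext_power_rep n \<rho>)"
    by (rule rep_character_lam)
next
  fix n x y assume xy: "x \<in> V" "y \<in> V"
  show "lam n (x \<boxplus> y) = (\<Oplus>\<^bsub>char_ring G\<^esub>a\<in>{..n}. lam a x \<boxtimes> lam (n - a) y)"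
  proof (rule V_eqI)
    interpret R: cring "char_ring G" by (rule cring_char_ring)
    have c: "lam a x \<boxtimes> lam (n - a) y \<in> V" for a using xy lam_closed V_mult by simp
    then show "(\<Oplus>\<^bsub>char_ring G\<^esub>a\<in>{..n}. lam a x \<boxtimes> lam (n - a) y) \<in> extensional (carrier G)"
      by (intro V_extensional R.finsum_closed) auto
    show "lam n (x \<boxplus> y) \<in> extensional (carrier G)" using xy V_add by simp
    fix g assume g: "g \<in> carrier G"
    have "(\<Oplus>\<^bsub>char_ring G\<^esub>a\<in>{..n}. lam a x \<boxtimes> lam (n - a) y) g = (\<Sum>a\<in>{..n}. lam a x g * lam (n - a) y g)"
      using c g by (subst finsum_apply) auto
    then show "lam n (x \<boxplus> y) g = (\<Oplus>\<^bsub>char_ring G\<^esub>a\<in>{..n}. lam a x \<boxtimes> lam (n - a) y) g"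
      using xy g V_add[OF xy] by (simp add: lam_apply lambda_series_add fps_mult_nth atLeast0AtMost)
  qed
qed (simp_all add: lam_0 lam_1[unfolded One_nat_def] one_V)

section \<open>Uniqueness of the lambda operations\<close>

lemma lambda_family_X:
  assumes "lambda_family G L" "a \<in> A"
  shows "L n (X a) = (if n = 0 then cst 1 else if n = 1 then X a else cst 0)"
proof -
  have "L n (X a) = cst 0" if "n > 1"
  proof -
    define \<rho> where "\<rho> = (\<lambda>g. mat 1 1 (\<lambda>_. chi a g))"
    have rep: "representation G 1 \<rho>" "X a = rep_character G \<rho>"
      using linear_rep[OF assms(2)] by (auto simp: \<rho>_def X_def irreducible_rep_def)
    then have "L n (X a) = rep_character G (ext_power_rep n \<rho>)"
      using assms(1) unfolding lambda_family_def by auto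
    \<comment> \<open>A matrix of size 1 has no minors of size \<open>n > 1\<close>.\<close>
    also have "\<dots> = cst 0"
      using that representationD(1)[OF is_group rep(1)]
      by (intro V_eqI) (auto simp: rep_character_def ext_power_rep_def intro!: trace_ext_power_0[of _ 1])
    finally show ?thesis .
  qed
  moreover have "L 0 (X a) = cst 1" "L 1 (X a) = X a"
    using assms(1) V_X[OF assms(2)] unfolding lambda_family_def one_V by blast+
  ultimately show ?thesis by auto
qed

lemma lambda_family_closed: "lambda_family G L \<Longrightarrow> x \<in> V \<Longrightarrow> L n x \<in> V"
  unfolding lambda_family_def by blast

lemma lambda_family_add_X:
  assumes L: "lambda_family G L" and x: "x \<in> V" and a: "a \<in> A" and g: "g \<in> carrier G"
  shows "L n (x \<boxplus> X a) g = L n x g + (if n = 0 then 0 else chi a g * L (n - 1) x g)"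
proof -
  have "L n (x \<boxplus> X a) = (\<Oplus>\<^bsub>char_ring G\<^esub>j\<in>{..n}. L j x \<boxtimes> L (n - j) (X a))"
    using L x V_X[OF a] unfolding lambda_family_def by blast
  then have "L n (x \<boxplus> X a) g = (\<Sum>j\<le>n. L j x g * L (n - j) (X a) g)"
    using g L x V_X[OF a] by (simp add: finsum_apply V_mult lambda_family_closed)
  also have "\<dots> = (\<Sum>j\<le>n. L j x g * (if n - j = 0 then 1 else if n - j = 1 then chi a g else 0))"
    using g by (intro sum.cong refl) (simp add: lambda_family_X[OF L a])
  also have "\<dots> = (\<Sum>j\<in>(if n = 0 then {n} else {n - 1, n}). L j x g * (if n - j = 0 then 1 else if n - j = 1 then chi a g else 0))"
    by (rule sum.mono_neutral_right) auto
  also have "\<dots> = L n x g + (if n = 0 then 0 else chi a g * L (n - 1) x g)"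
    by (auto simp: mult.commute)
  finally show ?thesis .
qed

text \<open>The values at 0 are not prescribed in degrees above 1. They follow from
  \<open>0 + \<chi> = \<chi>\<close>: the addition formula and the vanishing of
  \<open>\<lambda>^n(\<chi>)\<close> for \<open>n > 1\<close> determine them recursively.\<close>

lemma lambda_family_zero:
  assumes L: "lambda_family G L"
  shows "L n (cst 0) = (if n = 0 then cst 1 else cst 0)"
proof (induction n)
  case 0
  then show ?case using L V_zero unfolding lambda_family_def one_V by auto
next
  case (Suc n)
  show ?case
  proof (cases "n = 0")
    case True
    then show ?thesis using L V_zero unfolding lambda_family_def by auto
  next
    case False
    obtain a where a: "a \<in> A" using chi_trivial by blast
    have "cst 0 \<boxplus> X a = X a" by (rule V_eqI) auto
    then have "L (Suc n) (cst 0) g = 0" if "g \<in> carrier G" for g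
      using lambda_family_add_X[OF L V_zero a that, of "Suc n"] lambda_family_X[OF L a, of "Suc n"] Suc False that
      by simp
    then show ?thesis
      using V_extensional[OF lambda_family_closed[OF L V_zero]] by (auto intro!: V_eqI)
  qed
qed

text \<open>The recursion for adding a linear character can be run in both directions, so two
  families that agree at 0 agree on everything reached by adding and subtracting such
  characters.\<close>

lemma lambda_family_unique:
  assumes L: "lambda_family G L" and L': "lambda_family G L'"
  shows "L = L'"
proof -
  have V: "\<forall>n. \<forall>g\<in>carrier G. L n x g = L' n x g" if "x \<in> V" for x
    using that
  proof (induction rule: V_induct)
    case zero
    then show ?case by (simp add: lambda_family_zero[OF L] lambda_family_zero[OF L'])
  next
    case (plus x a)
    then show ?case by (auto simp: lambda_family_add_X[OF L] lambda_family_add_X[OF L'])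
  next
    case (minus x a)
    define y where "y = x \<boxplus> neg (X a)"
    have y: "y \<in> V" using minus V_add V_neg V_X by (simp add: y_def)
    have x: "x = y \<boxplus> X a" using add_neg_cancel[OF minus(1)] by (simp add: y_def)
    have "\<forall>g\<in>carrier G. L n y g = L' n y g" for n
    proof (induction n)
      case 0
      then show ?case using L L' y unfolding lambda_family_def by auto
    next
      case (Suc n)
      show ?case
      proof
        fix g assume g: "g \<in> carrier G"
        have "L (Suc n) x g = L' (Suc n) x g" using minus(3) g by blast
        then show "L (Suc n) y g = L' (Suc n) y g"
          using lambda_family_add_X[OF L y minus(2) g, of "Suc n"] lambda_family_add_X[OF L' y minus(2) g, of "Suc n"]
            Suc g unfolding x by simp
      qed
    qed
    then show ?case by (simp add: y_def)
  qed
  have "L n x = L' n x" for n x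
  proof (cases "x \<in> V")
    case True
    then show ?thesis
      using V V_extensional lambda_family_closed[OF L True] lambda_family_closed[OF L' True]
      by (intro V_eqI) auto
  next
    case False
    have "L n \<in> V \<rightarrow>\<^sub>E V" "L' n \<in> V \<rightarrow>\<^sub>E V" using L L' unfolding lambda_family_def by blast+
    from this[THEN PiE_arb, OF False] show ?thesis by simp
  qed
  then have "L n = L' n" for n by (rule ext)
  then show ?thesis by (rule ext)
qed

lemma lambda_family_lambda_op: "lambda_family G (lambda_op G)"
  unfolding lambda_op_def
  by (rule theI[of "lambda_family G", OF lambda_family_lam]) (rule lambda_family_unique[OF _ lambda_family_lam])

section \<open>Augmentation and gamma operations\<close>

lemma V_add_group: "group (add_monoid (char_ring G))"
proof -
  interpret R: cring "char_ring G" by (rule cring_char_ring)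
  show ?thesis by (rule R.a_group)
qed

lemma inv_char_ring:
  assumes "x \<in> V"
  shows "inv\<^bsub>add_monoid (char_ring G)\<^esub> x = neg x"
proof -
  interpret F: group "add_monoid (char_ring G)" by (rule V_add_group)
  have "neg x \<boxplus> x = cst 0" by (rule V_eqI) auto
  then show ?thesis using V_neg[OF assms] assms by (intro F.inv_equality) (auto simp: zero_V)
qed

lemma add_pow_one: "add_pow (char_ring G) (z :: int) \<one>\<^bsub>char_ring G\<^esub> = cst z"
proof -
  interpret F: group "add_monoid (char_ring G)" by (rule V_add_group)
  have nat: "cst 1 [^]\<^bsub>add_monoid (char_ring G)\<^esub> n = cst (int n)" for n :: nat
  proof (induction n)
    case 0
    then show ?case by (simp add: zero_V)
  next
    case (Suc n)
    have "cst (int n) \<boxplus> cst 1 = cst (int (Suc n))" by (rule V_eqI) auto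
    with Suc show ?case by simp
  qed
  have neg: "neg (cst (int n)) = cst (- int n)" for n by (rule V_eqI) auto
  show ?thesis
  proof (cases "z < 0")
    case True
    then have "cst 1 [^]\<^bsub>add_monoid (char_ring G)\<^esub> z = inv\<^bsub>add_monoid (char_ring G)\<^esub> cst (int (nat (- z)))"
      by (simp only: int_pow_def2 if_True nat)
    also have "\<dots> = cst z" using True by (simp only: inv_char_ring[OF V_cst] neg) (simp only: int_nat_eq, simp)
    finally show ?thesis by (simp only: add_pow_def one_V)
  next
    case False
    then have "cst 1 [^]\<^bsub>add_monoid (char_ring G)\<^esub> z = cst (int (nat z))"
      by (simp only: int_pow_def2 if_False nat)
    also have "\<dots> = cst z" using False by simp
    finally show ?thesis by (simp only: add_pow_def one_V)
  qed
qed

lemma augmentation_eq: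
  assumes "x \<in> V"
  shows "x \<one> = of_int (augmentation G x)"
proof -
  have "\<exists>z::int. of_int z = x \<one>" using assms
  proof (induction rule: V_induct)
    case zero
    show ?case by (rule exI[of _ 0]) simp
  next
    case (plus x a)
    then obtain z :: int where "of_int z = x \<one>" by blast
    then show ?case using plus(2) by (intro exI[of _ "z + 1"]) (simp add: chi_one)
  next
    case (minus x a)
    then obtain z :: int where "of_int z = x \<one>" by blast
    then show ?case using minus(2) by (intro exI[of _ "z - 1"]) (simp add: chi_one)
  qed
  then obtain z :: int where z: "of_int z = x \<one>" by blast
  then have "augmentation G x = z"
    unfolding augmentation_def by (intro the_equality) (auto simp flip: z)
  then show ?thesis using z by simp
qed

lemma aug_ideal_iff: "x \<in> aug_ideal G \<longleftrightarrow> x \<in> V \<and> x \<one> = 0"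
  by (auto simp: aug_ideal_def augmentation_eq)

lemma augI_plus: "y \<in> aug_ideal G \<Longrightarrow> a \<in> A \<Longrightarrow> y \<boxplus> X a \<boxplus> cst (- 1) \<in> aug_ideal G"
  and augI_minus: "y \<in> aug_ideal G \<Longrightarrow> a \<in> A \<Longrightarrow> y \<boxplus> neg (X a) \<boxplus> cst 1 \<in> aug_ideal G"
  by (auto simp: aug_ideal_iff chi_one V_add V_neg V_X V_cst)

text \<open>Subtracting the degree maps the ring onto the augmentation ideal;
  \<open>V_induct\<close> transported along this map steps by \<open>\<chi> - 1\<close>.\<close>

lemma aug_induct [consumes 1, case_names zero plus minus]:
  assumes "x \<in> aug_ideal G" and zero: "P (cst 0)"
    and plus: "\<And>y a. y \<in> aug_ideal G \<Longrightarrow> a \<in> A \<Longrightarrow> P y \<Longrightarrow> P (y \<boxplus> X a \<boxplus> cst (- 1))"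
    and minus: "\<And>y a. y \<in> aug_ideal G \<Longrightarrow> a \<in> A \<Longrightarrow> P y \<Longrightarrow> P (y \<boxplus> neg (X a) \<boxplus> cst 1)"
  shows "P x"
proof -
  define n where "n x = x \<boxplus> cst (- augmentation G x)" for x
  have aug_cst: "augmentation G y = c" if "y \<in> V" "y \<one> = of_int c" for y c
    using augmentation_eq[OF that(1)] that(2) by simp
  have nI: "n x \<in> aug_ideal G" if "x \<in> V" for x
    using that V_add V_cst augmentation_eq[OF that] by (auto simp: n_def aug_ideal_iff)
  have "x \<in> V" using assms(1) aug_ideal_iff by blast
  then have "P (n x)"
  proof (induction rule: V_induct)
    case zero
    have "augmentation G (cst 0) = 0" by (rule aug_cst[OF V_zero]) simp
    then have "n (cst 0) = cst 0" unfolding n_def by (intro V_eqI) auto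
    then show ?case using assms(2) by simp
  next
    case (plus x a)
    have "augmentation G (x \<boxplus> X a) = augmentation G x + 1"
      using plus(1,2) augmentation_eq[OF plus(1)]
      by (intro aug_cst V_add V_X) (auto simp: chi_one)
    then have "n (x \<boxplus> X a) = n x \<boxplus> X a \<boxplus> cst (- 1)"
      unfolding n_def by (intro V_eqI) auto
    then show ?case using assms(3)[OF nI[OF plus(1)] plus(2,3)] by simp
  next
    case (minus x a)
    have "augmentation G (x \<boxplus> neg (X a)) = augmentation G x - 1"
      using minus(1,2) augmentation_eq[OF minus(1)]
      by (intro aug_cst V_add V_neg V_X) (auto simp: chi_one)
    then have "n (x \<boxplus> neg (X a)) = n x \<boxplus> neg (X a) \<boxplus> cst 1"
      unfolding n_def by (intro V_eqI) auto
    then show ?case using assms(4)[OF nI[OF minus(1)] minus(2,3)] by simp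
  qed
  moreover have "n x = x"
    using assms(1) aug_cst[of x 0] V_extensional[of x]
    unfolding n_def aug_ideal_iff by (intro V_eqI) auto
  ultimately show ?thesis by simp
qed

lemmas lambda_op_closed = lambda_family_closed[OF lambda_family_lambda_op]
lemmas lambda_op_add_X = lambda_family_add_X[OF lambda_family_lambda_op]
lemmas lambda_op_zero = lambda_family_zero[OF lambda_family_lambda_op]

lemma lambda_op_0: "x \<in> V \<Longrightarrow> lambda_op G 0 x = cst 1"
  and lambda_op_1: "x \<in> V \<Longrightarrow> lambda_op G 1 x = x"
  using lambda_family_lambda_op unfolding lambda_family_def one_V by blast+

lemma gamma_op_eq: "gamma_op G n x = lambda_op G n (x \<boxplus> cst (int n - 1))"
  by (simp add: gamma_op_def add_pow_one)

lemma gamma_op_closed: "x \<in> V \<Longrightarrow> gamma_op G n x \<in> V"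
  by (simp add: gamma_op_eq lambda_op_closed V_add V_cst)

lemma gamma_op_0: "x \<in> V \<Longrightarrow> gamma_op G 0 x = cst 1"
  by (simp add: gamma_op_eq lambda_op_0 V_add V_cst)

lemma gamma_op_1:
  assumes "x \<in> V"
  shows "gamma_op G 1 x = x"
proof -
  have "x \<boxplus> cst 0 = x" using V_extensional[OF assms] by (intro V_eqI) auto
  then show ?thesis using lambda_op_1[OF assms] by (simp add: gamma_op_eq)
qed

lemma lambda_op_add_one:
  assumes "x \<in> V" "g \<in> carrier G"
  shows "lambda_op G (Suc n) (x \<boxplus> cst 1) g = lambda_op G (Suc n) x g + lambda_op G n x g"
proof -
  obtain a where a: "a \<in> A" "\<And>g. g \<in> carrier G \<Longrightarrow> chi a g = 1" using chi_trivial by blast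
  then have "cst 1 = X a" by (intro V_eqI) auto
  then show ?thesis using lambda_op_add_X[OF assms(1) a(1) assms(2), of "Suc n"] a(2)[OF assms(2)] by simp
qed

text \<open>The value is the binomial coefficient of \<open>m\<close> over \<open>n\<close>, zero in
  this range. The case \<open>m = n - 1\<close> is what makes \<open>\<gamma>^n(0)\<close>
  vanish.\<close>

lemma lambda_op_cst:
  assumes "m < n"
  shows "lambda_op G n (cst (int m)) = cst 0"
  using assms
proof (induction m arbitrary: n)
  case 0
  then show ?case by (simp add: lambda_op_zero)
next
  case (Suc m)
  then obtain l where l: "n = Suc l" "m < l" by (cases n) auto
  have *: "cst (int (Suc m)) = cst (int m) \<boxplus> cst 1" by (rule V_eqI) auto
  show ?case
  proof (rule V_eqI)
    fix g assume g: "g \<in> carrier G"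
    show "lambda_op G n (cst (int (Suc m))) g = cst 0 g"
      unfolding * l(1) using Suc.IH[of "Suc l"] Suc.IH[of l] l g
      by (simp add: lambda_op_add_one[OF V_cst])
  qed (auto intro: V_extensional lambda_op_closed V_cst)
qed

lemma gamma_op_zero:
  assumes "n > 0"
  shows "gamma_op G n (cst 0) = cst 0"
proof -
  have "cst 0 \<boxplus> cst (int n - 1) = cst (int (n - 1))" using assms by (intro V_eqI) (auto simp: of_nat_diff)
  then show ?thesis using assms lambda_op_cst[of "n - 1" n] by (simp add: gamma_op_eq)
qed

text \<open>Both sides come from \<open>\<lambda>\<^sup>n(z + \<chi>) = \<lambda>\<^sup>n(z) + \<chi> \<lambda>\<^sup>n\<^sup>-\<^sup>1(z)\<close> at \<open>z = y + n - 2\<close>, once for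
  \<open>\<chi>\<close> and once for the trivial character.\<close>

lemma gamma_op_add:
  assumes y: "y \<in> V" and a: "a \<in> A" and g: "g \<in> carrier G"
  shows "gamma_op G (Suc n) (y \<boxplus> X a \<boxplus> cst (- 1)) g
    = gamma_op G (Suc n) y g + (chi a g - 1) * gamma_op G n y g"
proof -
  define z where "z = y \<boxplus> cst (int n - 1)"
  have z: "z \<in> V" unfolding z_def by (intro V_add y V_cst)
  have "y \<boxplus> X a \<boxplus> cst (- 1) \<boxplus> cst (int (Suc n) - 1) = z \<boxplus> X a"
    by (rule V_eqI) (auto simp: z_def)
  moreover have "y \<boxplus> cst (int (Suc n) - 1) = z \<boxplus> cst 1"
    by (rule V_eqI) (auto simp: z_def)
  ultimately show ?thesis
    unfolding gamma_op_eq z_def[symmetric]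
    using lambda_op_add_X[OF z a g, of "Suc n"] lambda_op_add_one[OF z g, of n]
    by (simp add: algebra_simps)
qed

section \<open>The gamma filtration\<close>

lemma gamma_products_closed: "gamma_products G n \<subseteq> V"
proof -
  have "foldr (\<lambda>(i, y) z. gamma_op G i y \<boxtimes> z) iys \<one>\<^bsub>char_ring G\<^esub> \<in> V" if "snd ` set iys \<subseteq> aug_ideal G" for iys
    using that
  proof (induction iys)
    case (Cons iy iys)
    then show ?case by (auto simp: aug_ideal_iff V_mult gamma_op_closed case_prod_beta)
  qed (simp add: one_V V_one)
  then show ?thesis by (auto simp: gamma_products_def)
qed

lemma gamma_filtration_subgroup: "subgroup (gamma_filtration G n) (add_monoid (char_ring G))"
  unfolding gamma_filtration_def
  by (rule group.generate_is_subgroup[OF V_add_group]) (simp add: gamma_products_closed)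

lemma gamma_filtration_zero: "cst 0 \<in> gamma_filtration G n"
  using subgroup.one_closed[OF gamma_filtration_subgroup] by (simp add: zero_V)

lemma gamma_filtration_add:
  "x \<in> gamma_filtration G n \<Longrightarrow> y \<in> gamma_filtration G n \<Longrightarrow> x \<boxplus> y \<in> gamma_filtration G n"
  using subgroup.m_closed[OF gamma_filtration_subgroup] by simp

lemma gamma_filtration_neg:
  assumes "x \<in> gamma_filtration G n"
  shows "neg x \<in> gamma_filtration G n"
proof -
  have "x \<in> V" using subgroup.subset[OF gamma_filtration_subgroup] assms by auto
  then show ?thesis using subgroup.m_inv_closed[OF gamma_filtration_subgroup assms] inv_char_ring by metis
qed

text \<open>As \<open>\<gamma>^1\<close> is the identity, an ordinary product of elements of the
  augmentation ideal is a gamma product whose weight is the number of factors.\<close>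

lemma product_in_gamma_filtration:
  assumes "set ys \<subseteq> aug_ideal G" "length ys \<ge> n"
  shows "foldr (\<boxtimes>) ys (cst 1) \<in> gamma_filtration G n"
proof -
  have "foldr (\<lambda>(i, y) z. gamma_op G i y \<boxtimes> z) (map (Pair 1) ys) (cst 1) = foldr (\<boxtimes>) ys (cst 1)"
    using assms(1)
  proof (induction ys)
    case (Cons y ys)
    then show ?case using gamma_op_1[of y] by (simp add: aug_ideal_iff)
  qed simp
  moreover have "sum_list (map fst (map (Pair 1) ys)) = length ys" by (induction ys) auto
  ultimately have "foldr (\<boxtimes>) ys (cst 1) \<in> gamma_products G n"
    unfolding gamma_products_def one_V using assms
    by (intro CollectI exI[of _ "map (Pair 1) ys"]) (auto simp: image_image)
  then show ?thesis unfolding gamma_filtration_def by (rule generate.incl)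
qed

end

text \<open>Any decreasing multiplicative filtration by subgroups that has every
  \<open>\<chi> - 1\<close> in degree 1. The gamma filtration is bounded above by each of
  these.\<close>

locale char_filtration = dual_group +
  fixes E :: "nat \<Rightarrow> ('a \<Rightarrow> complex) set"
  assumes E_closed: "E n \<subseteq> carrier (char_ring G)"
    and E_zero: "cst 0 \<in> E n"
    and E_add: "x \<in> E n \<Longrightarrow> y \<in> E n \<Longrightarrow> x \<boxplus> y \<in> E n"
    and E_neg: "x \<in> E n \<Longrightarrow> neg x \<in> E n"
    and E_mult: "x \<in> E m \<Longrightarrow> y \<in> E n \<Longrightarrow> x \<boxtimes> y \<in> E (m + n)"
    and E_one: "cst 1 \<in> E 0"
    and E_X: "a \<in> A \<Longrightarrow> X a \<boxplus> cst (- 1) \<in> E 1"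
    and E_Suc: "E (Suc n) \<subseteq> E n"
begin

lemma E_antimono: "m \<le> n \<Longrightarrow> E n \<subseteq> E m"
  by (rule lift_Suc_antimono_le[of E]) (use E_Suc in auto)

text \<open>In \<open>gamma_op_add\<close> each drop of \<open>n\<close> by one is paid for by a
  factor \<open>\<chi> - 1\<close> of degree 1. Removing \<open>\<chi> - 1\<close> from the argument
  is handled by solving the same recursion in \<open>n\<close>.\<close>

lemma gamma_op_in_E:
  assumes "y \<in> aug_ideal G"
  shows "gamma_op G n y \<in> E n"
proof -
  have V: "y \<in> carrier (char_ring G)" if "y \<in> aug_ideal G" for y using that aug_ideal_iff by blast
  have "\<forall>n. gamma_op G n y \<in> E n" using assms
  proof (induction rule: aug_induct)
    case zero
    show ?case
    proof
      fix n show "gamma_op G n (cst 0) \<in> E n"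
        using gamma_op_0[OF V_zero] gamma_op_zero[of n] E_one E_zero by (cases "n = 0") auto
    qed
  next
    case (plus y a)
    show ?case
    proof
      fix n
      let ?y = "y \<boxplus> X a \<boxplus> cst (- 1)"
      show "gamma_op G n ?y \<in> E n"
      proof (cases n)
        case 0
        then show ?thesis using gamma_op_0[OF V[OF augI_plus[OF plus(1,2)]]] E_one by simp
      next
        case (Suc m)
        have "gamma_op G n ?y = gamma_op G n y \<boxplus> ((X a \<boxplus> cst (- 1)) \<boxtimes> gamma_op G m y)"
          unfolding Suc using gamma_op_add[OF V[OF plus(1)] plus(2)]
            V_extensional[OF gamma_op_closed[OF V[OF augI_plus[OF plus(1,2)]]]]
          by (intro V_eqI) auto
        moreover have "(X a \<boxplus> cst (- 1)) \<boxtimes> gamma_op G m y \<in> E n"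
          using E_mult[OF E_X[OF plus(2)], of "gamma_op G m y" m] plus(3) Suc by simp
        ultimately show ?thesis using E_add plus(3) by simp
      qed
    qed
  next
    case (minus x a)
    define y where "y = x \<boxplus> neg (X a) \<boxplus> cst 1"
    have y: "y \<in> aug_ideal G" unfolding y_def by (rule augI_minus[OF minus(1,2)])
    have x: "x = y \<boxplus> X a \<boxplus> cst (- 1)"
      using V_extensional[OF V[OF minus(1)]] by (intro V_eqI) (auto simp: y_def)
    have "gamma_op G n y \<in> E n" for n
    proof (induction n)
      case 0
      then show ?case using gamma_op_0[OF V[OF y]] E_one by simp
    next
      case (Suc n)
      have "gamma_op G (Suc n) y = gamma_op G (Suc n) x \<boxplus> neg ((X a \<boxplus> cst (- 1)) \<boxtimes> gamma_op G n y)"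
        unfolding x using gamma_op_add[OF V[OF y] minus(2)]
          V_extensional[OF gamma_op_closed[OF V[OF y]]]
        by (intro V_eqI) auto
      moreover have "(X a \<boxplus> cst (- 1)) \<boxtimes> gamma_op G n y \<in> E (Suc n)"
        using E_mult[OF E_X[OF minus(2)] Suc] by simp
      ultimately show ?case using E_add E_neg minus(3) by simp
    qed
    then show ?case by (simp add: y_def)
  qed
  then show ?thesis by blast
qed

lemma gamma_filtration_subset: "gamma_filtration G n \<subseteq> E n"
proof -
  have prod: "foldr (\<lambda>(i, y) z. gamma_op G i y \<boxtimes> z) iys \<one>\<^bsub>char_ring G\<^esub> \<in> E (sum_list (map fst iys))"
    if "snd ` set iys \<subseteq> aug_ideal G" for iys
    using that
  proof (induction iys)
    case (Cons iy iys)
    then show ?case using E_mult gamma_op_in_E by (auto simp: case_prod_beta)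
  qed (simp add: one_V E_one)
  show ?thesis
  proof
    fix x assume "x \<in> gamma_filtration G n"
    then show "x \<in> E n"
      unfolding gamma_filtration_def
    proof (induction rule: generate.induct)
      case one
      then show ?case using E_zero by (simp add: zero_V)
    next
      case (incl h)
      then show ?case using prod E_antimono unfolding gamma_products_def by blast
    next
      case (inv h)
      then have "h \<in> E n" using prod E_antimono unfolding gamma_products_def by blast
      then have "h \<in> carrier (char_ring G)" using E_closed by blast
      from inv_char_ring[OF this] E_neg[OF \<open>h \<in> E n\<close>] show ?case by metis
    next
      case (eng h1 h2)
      then show ?case using E_add by simp
    qed
  qed
qed

end

section \<open>The characters of an elementary abelian group\<close>

lemma root_of_unity_cis:
  assumes "p > 0"
  shows "cis (2 * pi / real p) ^ p = 1" and "cis (2 * pi / real p) ^ m = 1 \<longleftrightarrow> p dvd m"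
proof -
  let ?z = "cis (2 * pi / real p)"
  show p: "?z ^ p = 1" using assms by (simp add: DeMoivre)
  have "?z ^ m = ?z ^ (m mod p)"
  proof -
    have "?z ^ m = (?z ^ p) ^ (m div p) * ?z ^ (m mod p)"
      by (simp flip: power_mult power_add)
    then show ?thesis by (simp add: p)
  qed
  also have "\<dots> = cis (2 * pi * real (m mod p) / real p)"
    by (simp add: DeMoivre mult_ac)
  also have "\<dots> = 1 \<longleftrightarrow> m mod p = 0"
  proof
    assume eq: "cis (2 * pi * real (m mod p) / real p) = 1"
    have inj: "inj_on (\<lambda>k. cis (2 * pi * real k / real p)) {..<p}"
      using bij_betw_roots_unity[OF assms] by (rule bij_betw_imp_inj_on)
    show "m mod p = 0"
      by (rule inj_onD[OF inj]) (use eq assms in auto)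
  qed simp
  finally show "?z ^ m = 1 \<longleftrightarrow> p dvd m" by (simp add: dvd_eq_mod_eq_0)
qed

lemma sum_powers_root_of_unity:
  fixes z :: complex
  assumes "z ^ p = 1" and "\<And>m. z ^ m = 1 \<longleftrightarrow> p dvd m"
  shows "(\<Sum>j<p. z ^ (j * m)) = (if p dvd m then of_nat p else 0)"
proof -
  have "(\<Sum>j<p. z ^ (j * m)) = (\<Sum>j<p. (z ^ m) ^ j)"
    by (intro sum.cong refl) (simp add: mult.commute flip: power_mult)
  also have "\<dots> = (if p dvd m then of_nat p else 0)"
  proof (cases "p dvd m")
    case True
    then have "z ^ m = 1" using assms(2) by blast
    then show ?thesis using True by simp
  next
    case False
    then have "z ^ m \<noteq> 1" using assms(2) by blast
    moreover have "(z ^ m) ^ p = 1" using assms(1) by (metis power_mult power_one mult.commute)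
    ultimately show ?thesis using False by (simp add: geometric_sum)
  qed
  finally show ?thesis .
qed

locale prime_cyclic_group = C: group C for C :: "('a, 'b) monoid_scheme" (structure) +
  fixes p :: nat
  assumes cyclic: "cyclic_group C" and prime_p: "prime p" and order_p: "Coset.order C = p"
begin

lemma p_gt_1: "p > 1" using prime_p by (rule prime_gt_1_nat)

lemma finite_C: "finite (carrier C)"
  using order_p p_gt_1 unfolding Coset.order_def by (metis card.infinite not_less_zero)

definition gen :: 'a where
  "gen = (SOME x. x \<in> carrier C \<and> carrier C = range (\<lambda>n::int. x [^] n))"

lemma gen: "gen \<in> carrier C" "carrier C = range (\<lambda>n::int. gen [^] n)"
proof -
  have "\<exists>x. x \<in> carrier C \<and> carrier C = range (\<lambda>n::int. x [^] n)"
    using cyclic C.cyclic_group by blast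
  then have "gen \<in> carrier C \<and> carrier C = range (\<lambda>n::int. gen [^] n)"
    unfolding gen_def by (rule someI_ex)
  then show "gen \<in> carrier C" "carrier C = range (\<lambda>n::int. gen [^] n)" by blast+
qed

lemma ord_gen: "C.ord gen = p"
proof -
  have "C.ord gen dvd p" using C.ord_dvd_group_order[OF gen(1)] order_p by simp
  moreover have "C.ord gen \<noteq> 1"
  proof
    assume "C.ord gen = 1"
    then have "gen = \<one>" using C.ord_eq_1[OF gen(1)] by simp
    then have "carrier C = {\<one>}" using gen(2) by (simp add: C.int_pow_one image_constant_conv)
    then show False using order_p p_gt_1 by (simp add: Coset.order_def)
  qed
  ultimately show ?thesis using prime_p unfolding prime_nat_iff by blast
qed

lemma gen_power_bij: "bij_betw (\<lambda>n::nat. gen [^] n) {..<p} (carrier C)"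
proof -
  have "{0..C.ord gen - 1} = {..<p}" using p_gt_1 by (auto simp: ord_gen)
  then have inj: "inj_on (\<lambda>n::nat. gen [^] n) {..<p}" using C.ord_inj[OF gen(1)] by simp
  have "(\<lambda>n::nat. gen [^] n) ` {..<p} = carrier C"
    using finite_C gen(1) order_p card_image[OF inj]
    by (intro card_subset_eq) (auto simp: Coset.order_def)
  then show ?thesis using inj by (simp add: bij_betw_def)
qed

lemma gen_power_mod: "gen [^] (n mod p) = gen [^] (n :: nat)"
proof -
  have "gen [^] n = gen [^] (p * (n div p) + n mod p)" by simp
  also have "\<dots> = (gen [^] p) [^] (n div p) \<otimes> gen [^] (n mod p)"
    using gen(1) by (simp add: C.nat_pow_mult C.nat_pow_pow del: mult_div_mod_eq)
  also have "\<dots> = gen [^] (n mod p)"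
    using C.pow_ord_eq_1[OF gen(1)] gen(1) by (simp add: ord_gen)
  finally show ?thesis by simp
qed

definition dlog :: "'a \<Rightarrow> nat" where
  "dlog = inv_into {..<p} (\<lambda>n. gen [^] n)"

lemma dlog_less: "x \<in> carrier C \<Longrightarrow> dlog x < p"
  using inv_into_into[of x "\<lambda>n. gen [^] n" "{..<p}"] gen_power_bij by (simp add: dlog_def bij_betw_def)

lemma gen_dlog: "x \<in> carrier C \<Longrightarrow> gen [^] dlog x = x"
  unfolding dlog_def by (rule bij_betw_inv_into_right[OF gen_power_bij])

lemma dlog_bij: "bij_betw dlog (carrier C) {..<p}"
  unfolding dlog_def by (rule bij_betw_inv_into[OF gen_power_bij])

lemma dlog_gen: "dlog (gen [^] n) = n mod p"
proof -
  have "dlog (gen [^] (n mod p)) = n mod p"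
    unfolding dlog_def using p_gt_1 by (intro bij_betw_inv_into_left[OF gen_power_bij]) simp
  then show ?thesis by (simp add: gen_power_mod)
qed

lemma dlog_mult: "x \<in> carrier C \<Longrightarrow> y \<in> carrier C \<Longrightarrow> dlog (x \<otimes> y) = (dlog x + dlog y) mod p"
  using dlog_gen[of "dlog x + dlog y"] gen(1) by (simp add: gen_dlog flip: C.nat_pow_mult)

definition zeta :: complex where
  "zeta = cis (2 * pi / real p)"

lemma zeta: "zeta ^ p = 1" "zeta ^ m = 1 \<longleftrightarrow> p dvd m"
  using root_of_unity_cis[of p] p_gt_1 by (auto simp: zeta_def)

lemma zeta_mod: "zeta ^ (m mod p) = zeta ^ m"
proof -
  have "zeta ^ m = (zeta ^ p) ^ (m div p) * zeta ^ (m mod p)"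
    by (simp flip: power_mult power_add)
  then show ?thesis by (simp add: zeta)
qed

lemmas sum_zeta = sum_powers_root_of_unity[OF zeta]

text \<open>The faithful character sending \<open>gen\<close> to \<open>zeta\<close>; its powers are
  all the characters of \<open>C\<close>.\<close>

definition lin :: "'a \<Rightarrow> complex" where
  "lin x = zeta ^ dlog x"

lemma lin_mult: "x \<in> carrier C \<Longrightarrow> y \<in> carrier C \<Longrightarrow> lin (x \<otimes> y) = lin x * lin y"
  by (simp add: lin_def dlog_mult zeta_mod power_add)

lemma lin_one: "lin \<one> = 1"
  using dlog_gen[of 0] by (simp add: lin_def)

lemma lin_power_p: "lin x ^ p = 1"
  unfolding lin_def by (metis power_mult mult.commute power_one zeta(1))

lemma lin_power_mod: "lin x ^ (n mod p) = lin x ^ n"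
proof -
  have "lin x ^ n = (lin x ^ p) ^ (n div p) * lin x ^ (n mod p)"
    by (simp flip: power_mult power_add)
  then show ?thesis by (simp add: lin_power_p)
qed

lemma lin_inv: "x \<in> carrier C \<Longrightarrow> lin (inv x) = lin x ^ (p - 1)"
proof -
  assume x: "x \<in> carrier C"
  have "lin (inv x) * lin x = 1" using lin_mult[of "inv x" x] x lin_one by simp
  moreover have "lin x ^ (p - 1) * lin x = 1"
    using lin_power_p[of x] p_gt_1 by (simp flip: power_Suc2)
  moreover have "lin x \<noteq> 0" using calculation by auto
  ultimately show ?thesis by (metis mult_right_cancel)
qed

lemma sum_lin_power: "(\<Sum>x\<in>carrier C. lin x ^ m) = (if p dvd m then of_nat p else 0)"
proof -
  have "(\<Sum>x\<in>carrier C. lin x ^ m) = (\<Sum>n<p. zeta ^ (n * m))"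
    unfolding lin_def using sum.reindex_bij_betw[OF dlog_bij, of "\<lambda>n. zeta ^ (n * m)"]
    by (simp add: power_mult)
  then show ?thesis by (simp add: sum_zeta)
qed

lemma sum_lin_orthogonal:
  assumes "a < p" "b < p"
  shows "(\<Sum>x\<in>carrier C. lin (inv x) ^ a * lin x ^ b) = (if a = b then of_nat p else 0)"
proof -
  have "(\<Sum>x\<in>carrier C. lin (inv x) ^ a * lin x ^ b) = (\<Sum>x\<in>carrier C. lin x ^ ((p - 1) * a + b))"
    by (intro sum.cong refl) (simp add: lin_inv power_add power_mult)
  also have "\<dots> = (if p dvd (p - 1) * a + b then of_nat p else 0)" by (rule sum_lin_power)
  \<comment> \<open>Modulo \<open>p\<close> the left side is \<open>b - a\<close>, and both numbers
    lie below \<open>p\<close>.\<close>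
  also have "p dvd (p - 1) * a + b \<longleftrightarrow> a = b"
  proof -
    have "int p dvd int ((p - 1) * a + b) \<longleftrightarrow> int p dvd int b - int a"
    proof -
      have "int ((p - 1) * a + b) = int p * int a + (int b - int a)"
        using p_gt_1 by (cases p) (auto simp: algebra_simps)
      then show ?thesis using dvd_add_right_iff[of "int p" "int p * int a" "int b - int a"]
        by (simp only: dvd_triv_left)
    qed
    also have "\<dots> \<longleftrightarrow> int b mod int p = int a mod int p"
      by (rule mod_eq_dvd_iff[symmetric])
    also have "\<dots> \<longleftrightarrow> a = b" using assms by auto
    finally show ?thesis by (simp only: int_dvd_int_iff)
  qed
  finally show ?thesis .
qed

lemma sum_lin_dual:
  assumes "x \<in> carrier C"
  shows "(\<Sum>n<p. lin x ^ n) = (if x = \<one> then of_nat p else 0)"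
proof -
  have "(\<Sum>n<p. lin x ^ n) = (\<Sum>n<p. zeta ^ (n * dlog x))"
    unfolding lin_def by (intro sum.cong refl) (simp add: mult.commute flip: power_mult)
  also have "\<dots> = (if p dvd dlog x then of_nat p else 0)" by (rule sum_zeta)
  also have "p dvd dlog x \<longleftrightarrow> x = \<one>"
  proof
    assume "p dvd dlog x"
    then have "dlog x = 0" using dlog_less[OF assms] by (auto dest: dvd_imp_le)
    then show "x = \<one>" using gen_dlog[OF assms] by simp
  next
    assume "x = \<one>"
    then show "p dvd dlog x" using dlog_gen[of 0] by simp
  qed
  finally show ?thesis .
qed

end

section \<open>The dual of a power of the cyclic group\<close>

locale elementary_abelian = prime_cyclic_group C p for C :: "('a, 'b) monoid_scheme" (structure) and p +
  fixes k :: nat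
begin

definition G :: "(nat \<Rightarrow> 'a) monoid" where
  "G = product_group {1..k} (\<lambda>_. C)"

definition A :: "(nat \<Rightarrow> nat) set" where
  "A = (\<Pi>\<^sub>E i\<in>{1..k}. {..<p})"

definition chi :: "(nat \<Rightarrow> nat) \<Rightarrow> (nat \<Rightarrow> 'a) \<Rightarrow> complex" where
  "chi a g = (\<Prod>i\<in>{1..k}. lin (g i) ^ a i)"

lemma carrier_G: "carrier G = (\<Pi>\<^sub>E i\<in>{1..k}. carrier C)"
  by (simp add: G_def)

lemma G_apply: "g \<in> carrier G \<Longrightarrow> i \<in> {1..k} \<Longrightarrow> g i \<in> carrier C"
  by (auto simp: carrier_G)

lemma prod_if_const: "finite I \<Longrightarrow> (\<Prod>i\<in>I. if P i then c else 0) = (if \<forall>i\<in>I. P i then c ^ card I else (0::complex))"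
  by (induction I rule: finite_induct) auto

lemma card_G: "card (carrier G) = p ^ k"
  using order_p by (simp add: carrier_G card_PiE Coset.order_def)

lemma group_G: "group G"
  unfolding G_def by (rule product_group) (rule C.is_group)

text \<open>Group and index set are both products, so each orthogonality sum factors into sums over
  the coordinates and reduces to the cyclic group.\<close>

lemma dual_group_G: "dual_group G A chi"
proof -
  interpret G: group G by (rule group_G)
  have comm: "x \<otimes>\<^bsub>G\<^esub> y = y \<otimes>\<^bsub>G\<^esub> x" if "x \<in> carrier G" "y \<in> carrier G" for x y
  proof -
    interpret C': comm_group C by (rule C.cyclic_imp_abelian_group[OF cyclic])
    show ?thesis using that G_apply by (auto simp: G_def C'.m_comm intro!: restrict_ext)
  qed
  show ?thesis
  proof (unfold_locales)
    show "finite (carrier G)" unfolding carrier_G using finite_C by (intro finite_PiE) auto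
    show "finite A" unfolding A_def by (intro finite_PiE) auto
    show "x \<otimes>\<^bsub>G\<^esub> y = y \<otimes>\<^bsub>G\<^esub> x" if "x \<in> carrier G" "y \<in> carrier G" for x y using comm that .
    show "chi a (g \<otimes>\<^bsub>G\<^esub> h) = chi a g * chi a h" if "g \<in> carrier G" "h \<in> carrier G" for a g h
      unfolding chi_def prod.distrib[symmetric] using that G_apply
      by (intro prod.cong refl) (simp add: G_def lin_mult power_mult_distrib)
    show "chi a \<one>\<^bsub>G\<^esub> = 1" for a by (simp add: chi_def G_def lin_one)
    show "(\<Sum>g\<in>carrier G. chi a (inv\<^bsub>G\<^esub> g) * chi b g) = (if a = b then of_nat (card (carrier G)) else 0)"
      if ab: "a \<in> A" "b \<in> A" for a b
    proof -
      have lt: "a i < p" "b i < p" if "i \<in> {1..k}" for i using ab that by (auto simp: A_def)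
      have "(\<Sum>g\<in>carrier G. chi a (inv\<^bsub>G\<^esub> g) * chi b g)
        = (\<Sum>g\<in>carrier G. \<Prod>i\<in>{1..k}. lin (inv (g i)) ^ a i * lin (g i) ^ b i)"
      proof (intro sum.cong refl)
        fix g assume "g \<in> carrier G"
        then have "inv\<^bsub>G\<^esub> g = (\<lambda>i\<in>{1..k}. inv (g i))"
          unfolding G_def by (intro inv_product_group) (auto simp: G_def C.is_group)
        then show "chi a (inv\<^bsub>G\<^esub> g) * chi b g = (\<Prod>i\<in>{1..k}. lin (inv (g i)) ^ a i * lin (g i) ^ b i)"
          by (simp add: chi_def prod.distrib)
      qed
      also have "\<dots> = (\<Prod>i\<in>{1..k}. \<Sum>x\<in>carrier C. lin (inv x) ^ a i * lin x ^ b i)"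
        unfolding carrier_G by (rule prod_sum_PiE[symmetric]) (auto simp: finite_C)
      also have "\<dots> = (\<Prod>i\<in>{1..k}. if a i = b i then of_nat p else 0)"
        using lt by (intro prod.cong refl sum_lin_orthogonal) auto
      also have "\<dots> = (if \<forall>i\<in>{1..k}. a i = b i then of_nat p ^ card {1..k} else 0)"
        by (rule prod_if_const) simp
      also have "(\<forall>i\<in>{1..k}. a i = b i) \<longleftrightarrow> a = b"
        using ab by (auto simp: A_def intro: PiE_ext)
      finally show ?thesis by (simp add: card_G)
    qed
    show "(\<Sum>a\<in>A. chi a g) = (if g = \<one>\<^bsub>G\<^esub> then of_nat (card (carrier G)) else 0)" if g: "g \<in> carrier G" for g
    proof -
      have "(\<Sum>a\<in>A. chi a g) = (\<Prod>i\<in>{1..k}. \<Sum>n<p. lin (g i) ^ n)"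
        unfolding chi_def A_def by (rule prod_sum_PiE[symmetric]) auto
      also have "\<dots> = (\<Prod>i\<in>{1..k}. if g i = \<one> then of_nat p else 0)"
        using G_apply[OF g] by (intro prod.cong refl sum_lin_dual) auto
      also have "\<dots> = (if \<forall>i\<in>{1..k}. g i = \<one> then of_nat p ^ card {1..k} else 0)"
        by (rule prod_if_const) simp
      also have "(\<forall>i\<in>{1..k}. g i = \<one>) \<longleftrightarrow> g = \<one>\<^bsub>G\<^esub>"
        using g by (auto simp: G_def intro: PiE_ext)
      finally show ?thesis by (simp add: card_G)
    qed
    show "\<exists>c\<in>A. \<forall>g\<in>carrier G. chi c g = chi a g * chi b g" for a b
      using p_gt_1
      by (intro bexI[of _ "\<lambda>i\<in>{1..k}. (a i + b i) mod p"])
        (auto simp: chi_def A_def lin_power_mod power_add prod.distrib)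
    show "\<exists>a\<in>A. \<forall>g\<in>carrier G. chi a g = 1"
      using p_gt_1 by (intro bexI[of _ "\<lambda>i\<in>{1..k}. 0"]) (auto simp: chi_def A_def)
  qed
qed

sublocale dual_group G A chi by (rule dual_group_G)

end

section \<open>The gamma filtration of an elementary abelian group\<close>

definition deg_ge :: "nat \<Rightarrow> nat \<Rightarrow> int_mpoly set" where
  "deg_ge k n = {P \<in> carrier (mpoly_ring k). \<forall>m\<in>keys P. mon_deg m \<ge> n}"

lemma deg_ge_carrier: "deg_ge k n \<subseteq> carrier (mpoly_ring k)"
  by (auto simp: deg_ge_def)

lemma deg_ge_0: "deg_ge k 0 = carrier (mpoly_ring k)"
  by (auto simp: deg_ge_def)

lemma deg_ge_zero: "0 \<in> deg_ge k n"
  by (simp add: deg_ge_def mpoly_ring_0)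

lemma deg_ge_add: "P \<in> deg_ge k n \<Longrightarrow> Q \<in> deg_ge k n \<Longrightarrow> P + Q \<in> deg_ge k n"
  using Poly_Mapping.keys_add[of P Q] by (auto simp: deg_ge_def mpoly_ring_add)

lemma deg_ge_uminus: "P \<in> deg_ge k n \<Longrightarrow> - P \<in> deg_ge k n"
  by (auto simp: deg_ge_def mpoly_ring_uminus)

lemma deg_ge_antimono: "m \<le> n \<Longrightarrow> deg_ge k n \<subseteq> deg_ge k m"
  by (auto simp: deg_ge_def)

lemma deg_ge_mult: 
  assumes "P \<in> deg_ge k m" "Q \<in> deg_ge k n"
  shows "P * Q \<in> deg_ge k (m + n)"
proof -
  have "mon_deg x \<ge> m + n" if x: "x \<in> keys (P * Q)" for x
  proof -
    obtain a b where "x = a + b" "a \<in> keys P" "b \<in> keys Q"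
      using x Poly_Mapping.keys_mult[of P Q] by blast
    then show ?thesis using assms by (auto simp: deg_ge_def mon_deg_add intro: add_mono)
  qed
  then show ?thesis using assms by (auto simp: deg_ge_def mpoly_ring_mult)
qed

lemma deg_ge_var: "i \<in> {1..k} \<Longrightarrow> mpoly_var i \<in> deg_ge k 1"
  using mpoly_ring_var[of i k] by (auto simp: deg_ge_def mpoly_var_def)

lemma hom_part_deg_ge:
  assumes "P \<in> carrier (mpoly_ring k)"
  shows "hom_part n P \<in> deg_ge k n"
  using mpoly_ring_hom_part[OF assms] by (auto simp: deg_ge_def keys_hom_part)

lemma diff_hom_part_deg_ge:
  assumes "P \<in> deg_ge k n"
  shows "P - hom_part n P \<in> deg_ge k (Suc n)"
proof -
  have "P \<in> carrier (mpoly_ring k)" using assms deg_ge_carrier by blast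
  then have "P - hom_part n P \<in> carrier (mpoly_ring k)" by (intro mpoly_ring_diff mpoly_ring_hom_part)
  moreover have "mon_deg m \<ge> Suc n" if "m \<in> keys (P - hom_part n P)" for m
  proof -
    have "lookup P m \<noteq> 0" "mon_deg m \<noteq> n"
      using that by (auto simp: in_keys_iff lookup_minus lookup_hom_part split: if_splits)
    then show ?thesis using assms by (auto simp: deg_ge_def in_keys_iff Suc_le_eq order_less_le)
  qed
  ultimately show ?thesis by (simp add: deg_ge_def)
qed

section \<open>Polynomial values along a line\<close>

lemma mon_eval_scale: "mon_eval (\<lambda>i. y * s i) m = y ^ mon_deg m * mon_eval s m"
  by (simp add: mon_eval_def mon_deg_def power_mult_distrib prod.distrib power_sum)

text \<open>To be used in \<open>\<int>[X]\<close> with \<open>y = X - 1\<close>: the coordinates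
  \<open>X^(a_i) - 1\<close> are multiples of it, and homogeneity extracts the exact power.\<close>

lemma mpoly_eval_scale_homogeneous:
  assumes "\<And>m. m \<in> keys P \<Longrightarrow> mon_deg m = n"
  shows "mpoly_eval (\<lambda>i. y * s i) P = y ^ n * mpoly_eval s P"
  unfolding mpoly_eval_def sum_distrib_left
  by (intro sum.cong refl) (simp add: mon_eval_scale assms mult_ac)

lemma mpoly_eval_scale_dvd:
  assumes "\<And>m. m \<in> keys P \<Longrightarrow> mon_deg m \<ge> n"
  shows "y ^ n dvd mpoly_eval (\<lambda>i. y * s i) P"
  unfolding mpoly_eval_def using assms
  by (intro dvd_sum) (simp add: mon_eval_scale dvd_mult dvd_mult2 le_imp_power_dvd)

lemma mpoly_eval_cong:
  assumes "P \<in> carrier (mpoly_ring k)" "\<And>i. i \<in> {1..k} \<Longrightarrow> y i = z i"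
  shows "mpoly_eval y P = mpoly_eval z P"
  unfolding mpoly_eval_def mon_eval_def
  using assms by (intro sum.cong arg_cong2[of _ _ _ _ "(*)"] prod.cong refl) (auto simp: in_mpoly_ring_iff subset_iff simp del: atLeastAtMost_iff)

text \<open>Values of characters thus become values at \<open>w\<close> of a polynomial with integer
  coefficients, where divisibility can be argued before specialising.\<close>

lemma poly_mpoly_eval:
  fixes w :: complex
  shows "poly (map_poly of_int (mpoly_eval s P)) w = mpoly_eval (\<lambda>i. poly (map_poly of_int (s i)) w) P"
proof -
  have mon: "poly (map_poly of_int (mon_eval s m)) w = mon_eval (\<lambda>i. poly (map_poly of_int (s i)) w) m" for m
    by (simp add: mon_eval_def of_int_poly_hom.hom_prod of_int_poly_hom.hom_power poly_prod)
  have scale: "poly (map_poly of_int (of_int c * f)) w = of_int c * poly (map_poly of_int f) w" for c :: int and f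
    by (simp add: of_int_poly of_int_hom.map_poly_hom_smult)
  show ?thesis
    by (simp only: mpoly_eval_def of_int_poly_hom.hom_sum poly_sum scale mon)
qed

context prime_cyclic_group
begin

lemma prime_dvd_poly_at_1:
  fixes f :: "int poly"
  assumes "\<And>j. 0 < j \<Longrightarrow> j < p \<Longrightarrow> poly (map_poly of_int f) (zeta ^ j) = 0"
  shows "int p dvd poly f 1"
proof -
  let ?c = "\<lambda>l. Polynomial.coeff f l"
  have ev: "poly (map_poly of_int f) w = (\<Sum>l\<le>Polynomial.degree f. of_int (?c l) * w ^ l)" for w :: complex
    by (simp add: poly_altdef)
  have "(of_int (poly f 1) :: complex) = poly (map_poly of_int f) (zeta ^ 0)"
    by (simp add: ev)
  also have "\<dots> = (\<Sum>j<p. poly (map_poly of_int f) (zeta ^ j))"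
  proof -
    have "(\<Sum>j<p. poly (map_poly of_int f) (zeta ^ j)) = (\<Sum>j\<in>{0}. poly (map_poly of_int f) (zeta ^ j))"
      using assms p_gt_1 by (intro sum.mono_neutral_right) auto
    then show ?thesis by simp
  qed
  also have "\<dots> = (\<Sum>l\<le>Polynomial.degree f. of_int (?c l) * (\<Sum>j<p. zeta ^ (j * l)))"
    unfolding ev sum_distrib_left by (subst sum.swap) (simp add: power_mult)
  also have "\<dots> = (\<Sum>l\<le>Polynomial.degree f. of_int (?c l) * (if p dvd l then of_nat p else 0))"
    by (simp add: sum_zeta)
  also have "\<dots> = of_int (\<Sum>l\<le>Polynomial.degree f. ?c l * (if p dvd l then int p else 0))"
    unfolding of_int_sum by (intro sum.cong refl) simp
  finally have "poly f 1 = (\<Sum>l\<le>Polynomial.degree f. ?c l * (if p dvd l then int p else 0))"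
    by (simp only: of_int_eq_iff)
  also have "int p dvd \<dots>" by (intro dvd_sum) auto
  finally show ?thesis .
qed

end

context elementary_abelian
begin

section \<open>Substituting the generators into polynomials\<close>

abbreviation add_char (infixl "\<boxplus>" 65) where "x \<boxplus> y \<equiv> x \<oplus>\<^bsub>char_ring G\<^esub> y"
abbreviation mult_char (infixl "\<boxtimes>" 70) where "x \<boxtimes> y \<equiv> x \<otimes>\<^bsub>char_ring G\<^esub> y"

definition pt :: "(nat \<Rightarrow> 'a) \<Rightarrow> nat \<Rightarrow> complex" where
  "pt g i = lin (g i) - 1"

definition ev :: "int_mpoly \<Rightarrow> (nat \<Rightarrow> 'a) \<Rightarrow> complex" where
  "ev P = (\<lambda>g\<in>carrier G. mpoly_eval (pt g) P)"

text \<open>These are the powers of the augmentation ideal. Described as values of polynomials of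
  order at least \<open>n\<close>, they inherit the filtration axioms from degrees of
  monomials.\<close>

definition E :: "nat \<Rightarrow> ((nat \<Rightarrow> 'a) \<Rightarrow> complex) set" where
  "E n = ev ` deg_ge k n"

lemma ev_apply [simp]: "g \<in> carrier G \<Longrightarrow> ev P g = mpoly_eval (pt g) P"
  by (simp add: ev_def)

lemma ev_extensional [simp]: "ev P \<in> extensional (carrier G)"
  by (simp add: ev_def)

lemma ev_add: "ev (P + Q) = ev P \<boxplus> ev Q" and ev_mult: "ev (P * Q) = ev P \<boxtimes> ev Q"
  and ev_uminus: "ev (- P) = neg (ev P)" and ev_0: "ev 0 = cst 0" and ev_1: "ev 1 = cst 1"
  by (auto intro!: V_eqI simp: mpoly_eval_add mpoly_eval_mult mpoly_eval_uminus)

lemma ev_diff: "ev (P - Q) = ev P \<boxplus> neg (ev Q)"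
  using ev_add[of P "- Q"] by (simp add: ev_uminus)

definition var_index :: "nat \<Rightarrow> nat \<Rightarrow> nat" where
  "var_index i = (\<lambda>j\<in>{1..k}. if j = i then 1 else 0)"

lemma ev_var:
  assumes "i \<in> {1..k}"
  shows "ev (mpoly_var i) = X (var_index i) \<boxplus> cst (- 1)" "var_index i \<in> A"
proof -
  show "var_index i \<in> A" using p_gt_1 by (auto simp: var_index_def A_def)
  have "chi (var_index i) g = lin (g i)" for g
  proof -
    have "chi (var_index i) g = (\<Prod>j\<in>{1..k}. if j = i then lin (g j) else 1)"
      unfolding chi_def by (intro prod.cong refl) (simp add: var_index_def)
    then show ?thesis using assms by simp
  qed
  then show "ev (mpoly_var i) = X (var_index i) \<boxplus> cst (- 1)"
    by (intro V_eqI) (auto simp: pt_def)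
qed

lemma ev_var_aug: "i \<in> {1..k} \<Longrightarrow> ev (mpoly_var i) \<in> aug_ideal G"
  unfolding aug_ideal_iff ev_var(1)
  using ev_var(2)[of i] chi_one[of "var_index i"] by (simp add: V_add V_X V_cst)

lemma ev_monomial_product:
  assumes "keys m \<subseteq> {1..k}"
  shows "\<exists>ys. set ys \<subseteq> aug_ideal G \<and> length ys = mon_deg m \<and> ev (single m 1) = foldr (\<boxtimes>) ys (cst 1)"
  using assms
proof (induction "mon_deg m" arbitrary: m)
  case 0
  have "lookup m i = 0" for i using lookup_le_mon_deg[of m i] 0(1) by simp
  then have "m = 0" by (intro poly_mapping_eqI) simp
  then show ?case by (intro exI[of _ "[]"]) (simp add: ev_1)
next
  case (Suc n)
  then have "keys m \<noteq> {}" by (auto simp: mon_deg_def)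
  then obtain i where i: "i \<in> keys m" by blast
  then have "lookup m i \<ge> 1" by (simp add: in_keys_iff)
  then obtain m0 where m0: "m = m0 + single i 1" by (rule monomial_split)
  have "keys m0 \<subseteq> keys m" by (auto simp: m0 in_keys_iff lookup_add)
  then have "keys m0 \<subseteq> {1..k}" "mon_deg m0 = n" using Suc(2,3) by (auto simp: m0 mon_deg_add)
  then obtain ys where ys: "set ys \<subseteq> aug_ideal G" "length ys = n" "ev (single m0 1) = foldr (\<boxtimes>) ys (cst 1)"
    using Suc(1)[of m0] by blast
  have "single m 1 = mpoly_var i * single m0 (1::int)"
    by (simp add: m0 mpoly_var_def mult_single add.commute)
  then have "ev (single m 1) = ev (mpoly_var i) \<boxtimes> ev (single m0 1)" by (simp only: ev_mult)
  then show ?case using ys ev_var_aug[of i] i Suc(2,3)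
    by (intro exI[of _ "ev (mpoly_var i) # ys"]) auto
qed

lemma ev_in_subgroup:
  assumes zero: "cst 0 \<in> H" and add: "\<And>x y. x \<in> H \<Longrightarrow> y \<in> H \<Longrightarrow> x \<boxplus> y \<in> H"
    and neg: "\<And>x. x \<in> H \<Longrightarrow> neg x \<in> H"
    and mon: "\<And>m. m \<in> keys P \<Longrightarrow> ev (single m 1) \<in> H"
  shows "ev P \<in> H"
proof -
  have nat: "ev (single m (int n)) \<in> H" if "ev (single m 1) \<in> H" for m n
  proof (induction n)
    case 0
    then show ?case using zero by (simp add: ev_0)
  next
    case (Suc n)
    have "single m (int (Suc n)) = single m (int n) + single m 1" by (simp flip: single_add add: add.commute)
    then show ?case using add[OF Suc that] by (simp only: ev_add)
  qed
  have int: "ev (single m c) \<in> H" if "ev (single m 1) \<in> H" for m c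
  proof (cases "c \<ge> 0")
    case True
    then show ?thesis using nat[OF that, of "nat c"] by simp
  next
    case False
    then have "single m c = - single m (int (nat (- c)))" by (simp flip: single_uminus)
    then show ?thesis using neg[OF nat[OF that, of "nat (- c)"]] by (simp only: ev_uminus)
  qed
  have "ev (\<Sum>m\<in>M. single m (lookup P m)) \<in> H" if "finite M" "M \<subseteq> keys P" for M
    using that
  proof (induction M rule: finite_induct)
    case empty
    then show ?case using zero by (simp add: ev_0)
  next
    case (insert m M)
    then show ?case using add int mon by (simp add: ev_add)
  qed
  from this[of "keys P"] show ?thesis by (simp add: mpoly_sum_monomials)
qed

lemma ev_in_gamma_filtration:
  assumes "P \<in> deg_ge k n"
  shows "ev P \<in> gamma_filtration G n"
proof (rule ev_in_subgroup)
  fix m assume "m \<in> keys P"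
  then have "keys m \<subseteq> {1..k}" "mon_deg m \<ge> n" using assms by (auto simp: deg_ge_def in_mpoly_ring_iff)
  then show "ev (single m 1) \<in> gamma_filtration G n"
    using ev_monomial_product[of m] product_in_gamma_filtration by metis
qed (auto intro: gamma_filtration_zero gamma_filtration_add gamma_filtration_neg)

text \<open>The character \<open>chi a\<close> is the value of this product, so the missing constant
  term after subtracting 1 places \<open>chi a - 1\<close> in degree 1.\<close>

lemma one_plus_var_product:
  assumes "I \<subseteq> {1..k}"
  shows "(\<Prod>i\<in>I. (1 + mpoly_var i) ^ a i) - 1 \<in> deg_ge k 1"
proof -
  have step: "P * Q - 1 \<in> deg_ge k 1" if "P - 1 \<in> deg_ge k 1" "Q - 1 \<in> deg_ge k 1" for P Q
  proof -
    have "P * Q - 1 = (P - 1) * (Q - 1) + (P - 1) + (Q - 1)" by (simp add: algebra_simps)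
    moreover have "(P - 1) * (Q - 1) \<in> deg_ge k 1"
      using deg_ge_mult[OF that] deg_ge_antimono[of 1 "1 + 1" k] by auto
    ultimately show ?thesis using that by (simp only: deg_ge_add)
  qed
  have pow: "(1 + mpoly_var i) ^ n - 1 \<in> deg_ge k 1" if "i \<in> {1..k}" for i n
  proof (induction n)
    case (Suc n)
    show ?case unfolding power_Suc by (rule step[OF _ Suc]) (simp add: deg_ge_var[OF that, simplified])
  qed (simp add: deg_ge_zero)
  show ?thesis using assms
  proof (induction I rule: infinite_finite_induct)
    case (insert i I)
    then show ?case unfolding prod.insert[OF insert.hyps] by (intro step pow) auto
  qed (auto simp: deg_ge_zero)
qed

lemma char_filtration_E: "char_filtration G A chi E"
proof unfold_locales
  fix n
  have "gamma_filtration G n \<subseteq> carrier (char_ring G)"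
    using subgroup.subset[OF gamma_filtration_subgroup] by simp
  then show "E n \<subseteq> carrier (char_ring G)" using ev_in_gamma_filtration by (auto simp: E_def)
  show "cst 0 \<in> E n" unfolding E_def ev_0[symmetric] by (intro imageI deg_ge_zero)
  show "x \<boxplus> y \<in> E n" if "x \<in> E n" "y \<in> E n" for x y
    using that by (auto simp: E_def ev_add[symmetric] intro!: imageI deg_ge_add)
  show "neg x \<in> E n" if "x \<in> E n" for x
    using that by (auto simp: E_def ev_uminus[symmetric] intro!: imageI deg_ge_uminus)
  show "x \<boxtimes> y \<in> E (m + n)" if "x \<in> E m" "y \<in> E n" for x y m
    using that by (auto simp: E_def ev_mult[symmetric] intro!: imageI deg_ge_mult)
  show "cst 1 \<in> E 0" unfolding E_def ev_1[symmetric] deg_ge_0 by (intro imageI mpoly_ring_1)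
  show "X a \<boxplus> cst (- 1) \<in> E 1" if "a \<in> A" for a
  proof -
    have prod: "mpoly_eval z (\<Prod>i\<in>I. f i) = (\<Prod>i\<in>I. mpoly_eval z (f i))"
      for z :: "nat \<Rightarrow> complex" and I :: "nat set" and f
      by (induction I rule: infinite_finite_induct) (auto simp: mpoly_eval_mult)
    have "X a \<boxplus> cst (- 1) = ev ((\<Prod>i\<in>{1..k}. (1 + mpoly_var i) ^ a i) - 1)"
      by (rule V_eqI) (auto simp: mpoly_eval_diff mpoly_eval_add mpoly_eval_power prod pt_def chi_def)
    then show ?thesis using one_plus_var_product[of "{1..k}" a] by (auto simp: E_def)
  qed
  show "E (Suc n) \<subseteq> E n" unfolding E_def by (intro image_mono deg_ge_antimono) simp
qed

sublocale char_filtration G A chi E by (rule char_filtration_E)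

text \<open>One inclusion is the bound valid for every \<open>char_filtration\<close>; the other
  holds because monomials in the \<open>u_i\<close> are products of elements of the augmentation
  ideal.\<close>

lemma gamma_filtration_eq: "gamma_filtration G n = E n"
  using gamma_filtration_subset[of n] ev_in_gamma_filtration[of _ n] by (auto simp: E_def)

lemma ev_in_E: "P \<in> deg_ge k n \<Longrightarrow> ev P \<in> E n"
  by (simp add: E_def)

text \<open>The filtration pulled back to polynomials. It is larger than \<open>deg_ge\<close>: a
  polynomial vanishing on the group, such as \<open>(1 + x_i)^p - 1\<close>, lies in all its
  members, and this is the source of the relations.\<close>

definition filt :: "nat \<Rightarrow> int_mpoly set" where
  "filt n = {P \<in> carrier (mpoly_ring k). ev P \<in> E n}"

lemma filt_0: "0 \<in> filt n"
  by (simp add: filt_def mpoly_ring_0 ev_0 E_zero)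

lemma filt_add: "P \<in> filt n \<Longrightarrow> Q \<in> filt n \<Longrightarrow> P + Q \<in> filt n"
  by (auto simp: filt_def mpoly_ring_add ev_add E_add)

lemma filt_uminus: "P \<in> filt n \<Longrightarrow> - P \<in> filt n"
  by (auto simp: filt_def mpoly_ring_uminus ev_uminus E_neg)

lemma filt_diff: "P \<in> filt n \<Longrightarrow> Q \<in> filt n \<Longrightarrow> P - Q \<in> filt n"
  using filt_add[of P n "- Q"] filt_uminus by simp

lemma filt_mult: "P \<in> filt m \<Longrightarrow> Q \<in> filt n \<Longrightarrow> P * Q \<in> filt (m + n)"
  by (auto simp: filt_def mpoly_ring_mult ev_mult E_mult)

lemma filt_antimono: "m \<le> n \<Longrightarrow> P \<in> filt n \<Longrightarrow> P \<in> filt m"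
  using E_antimono by (auto simp: filt_def)

lemma filt_sum: "(\<And>i. i \<in> I \<Longrightarrow> f i \<in> filt n) \<Longrightarrow> sum f I \<in> filt n"
  by (induction I rule: infinite_finite_induct) (auto intro: filt_add filt_0)

lemma deg_ge_filt: "P \<in> deg_ge k n \<Longrightarrow> P \<in> filt n"
  using deg_ge_carrier by (auto simp: filt_def ev_in_E)

lemma filt_var_power: "i \<in> {1..k} \<Longrightarrow> mpoly_var i ^ n \<in> filt n"
proof (induction n)
  case 0
  then show ?case using deg_ge_filt[of 1 0] by (simp add: deg_ge_0 mpoly_ring_1)
next
  case (Suc n)
  then show ?case using filt_mult[OF deg_ge_filt[OF deg_ge_var[of i]], of "mpoly_var i ^ n" n] by simp
qed

lemma filt_of_int: "of_int c \<in> filt 0"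
proof -
  have "(of_int c :: int_mpoly) = single 0 c" by (simp flip: single_of_int)
  then show ?thesis using deg_ge_filt[of "of_int c" 0] mpoly_ring_single[of 0 k c] by (simp add: deg_ge_0)
qed

text \<open>Expanding \<open>(1 + x)\<^sup>p = 1\<close> shows \<open>p x + x\<^sup>p\<close> to be a combination of the \<open>(p x) x\<^sup>j\<^sup>-\<^sup>1\<close> with
  \<open>2 \<le> j < p\<close>, so that the filtration degree of \<open>p x\<close> can be raised step by step.\<close>

lemma p_var_step:
  assumes i: "i \<in> {1..k}" and m: "of_nat p * mpoly_var i \<in> filt m"
  shows "of_nat p * mpoly_var i + mpoly_var i ^ p \<in> filt (Suc m)"
proof -
  let ?x = "mpoly_var i"
  have "ev ((1 + ?x) ^ p - 1) = cst 0"
    by (rule V_eqI) (auto simp: mpoly_eval_diff mpoly_eval_add mpoly_eval_power pt_def lin_power_p)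
  moreover have "(1 + ?x) ^ p - 1 \<in> carrier (mpoly_ring k)"
    by (intro mpoly_ring_diff mpoly_ring_power mpoly_ring_add mpoly_ring_1 mpoly_ring_var[OF i])
  ultimately have rel: "(1 + ?x) ^ p - 1 \<in> filt (Suc m)" by (simp add: filt_def E_zero)
  have p: "{..p} = insert 0 (insert 1 (insert p {2..<p}))" using p_gt_1 by auto
  have "(1 + ?x) ^ p = (?x + 1) ^ p" by (simp add: add.commute)
  also have "\<dots> = (\<Sum>j\<le>p. of_nat (p choose j) * ?x ^ j)"
    by (simp add: binomial_ring)
  also have "\<dots> = 1 + of_nat p * ?x + ?x ^ p + (\<Sum>j=2..<p. of_nat (p choose j) * ?x ^ j)"
    unfolding p using p_gt_1 by simp
  finally have eq: "of_nat p * ?x + ?x ^ p = ((1 + ?x) ^ p - 1) - (\<Sum>j=2..<p. of_nat (p choose j) * ?x ^ j)"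
    by simp
  have "(\<Sum>j=2..<p. of_nat (p choose j) * ?x ^ j) \<in> filt (Suc m)"
  proof (rule filt_sum)
    fix j assume j: "j \<in> {2..<p}"
    then have "p dvd p choose j" using prime_p by (intro dvd_choose_prime) auto
    then obtain c where c: "p choose j = p * c" by blast
    have "?x ^ j = ?x * ?x ^ (j - 1)" using j by (simp flip: power_Suc)
    then have "of_nat (p choose j) * ?x ^ j = of_int (int c) * ((of_nat p * ?x) * ?x ^ (j - 1))"
      by (simp add: c mult_ac)
    moreover have "of_int (int c) * ((of_nat p * ?x) * ?x ^ (j - 1)) \<in> filt (0 + (m + (j - 1)))"
      by (intro filt_mult filt_of_int m filt_var_power i)
    ultimately show "of_nat (p choose j) * ?x ^ j \<in> filt (Suc m)"
      using j by (intro filt_antimono[of "Suc m" "0 + (m + (j - 1))"]) auto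
  qed
  then show ?thesis unfolding eq by (rule filt_diff[OF rel])
qed

text \<open>Each round subtracts \<open>x_i^p\<close>, which is possible while the target degree is
  at most \<open>p\<close>. In the last round \<open>x_i^p\<close> can no longer be discarded, and
  the sum itself is what gains a degree.\<close>

lemma p_var_filt:
  assumes i: "i \<in> {1..k}"
  shows "of_nat p * mpoly_var i \<in> filt p" "of_nat p * mpoly_var i + mpoly_var i ^ p \<in> filt (Suc p)"
proof -
  have "m \<le> p \<Longrightarrow> of_nat p * mpoly_var i \<in> filt m" for m
  proof (induction m)
    case 0
    show ?case using filt_mult[OF filt_of_int[of "int p"] filt_var_power[OF i, of 1]]
      by (intro filt_antimono[of 0 1]) auto
  next
    case (Suc m)
    have "of_nat p * mpoly_var i + mpoly_var i ^ p - mpoly_var i ^ p \<in> filt (Suc m)"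
      using Suc by (intro filt_diff p_var_step[OF i] filt_antimono[OF _ filt_var_power[OF i]]) auto
    then show ?case by simp
  qed
  then show "of_nat p * mpoly_var i \<in> filt p" by simp
  then show "of_nat p * mpoly_var i + mpoly_var i ^ p \<in> filt (Suc p)" by (rule p_var_step[OF i])
qed

text \<open>The kernel of the map to the associated graded ring. The condition is imposed on each
  homogeneous part because distinct degrees land in distinct summands.\<close>

definition ker :: "int_mpoly set" where
  "ker = {P \<in> carrier (mpoly_ring k). \<forall>n. hom_part n P \<in> filt (Suc n)}"

lemma ideal_ker: "ideal ker (mpoly_ring k)"
proof -
  interpret R: cring "mpoly_ring k" by (rule cring_mpoly_ring)
  have add: "P + Q \<in> ker" if "P \<in> ker" "Q \<in> ker" for P Q
    using that by (auto simp: ker_def mpoly_ring_add hom_part_add filt_add)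
  have neg: "- P \<in> ker" if "P \<in> ker" for P
    using that by (auto simp: ker_def mpoly_ring_uminus hom_part_uminus filt_uminus)
  have mult: "P * Q \<in> ker" if P: "P \<in> ker" and Q: "Q \<in> carrier (mpoly_ring k)" for P Q
  proof -
    have "hom_part n (P * Q) \<in> filt (Suc n)" for n
      unfolding hom_part_mult
    proof (rule filt_sum)
      fix i assume i: "i \<in> {..n}"
      have "hom_part i P \<in> filt (Suc i)" using P by (simp add: ker_def)
      from filt_mult[OF this deg_ge_filt[OF hom_part_deg_ge[OF Q, of "n - i"]]] i
      show "hom_part i P * hom_part (n - i) Q \<in> filt (Suc n)" by simp
    qed
    then show ?thesis using P Q by (auto simp: ker_def mpoly_ring_mult)
  qed
  have zero: "0 \<in> ker" by (simp add: ker_def mpoly_ring_0 filt_0)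
  show ?thesis
  proof (rule idealI[OF R.ring_axioms])
    show "subgroup ker (add_monoid (mpoly_ring k))"
    proof (rule R.add.subgroupI)
      show "ker \<subseteq> carrier (mpoly_ring k)" by (auto simp: ker_def)
      show "ker \<noteq> {}" using zero by blast
      fix P assume P: "P \<in> ker"
      have "\<ominus>\<^bsub>mpoly_ring k\<^esub> P = - P"
        using P by (intro R.minus_equality) (auto simp: ker_def mpoly_ring_uminus)
      then show "\<ominus>\<^bsub>mpoly_ring k\<^esub> P \<in> ker" using neg[OF P] by simp
      show "P \<oplus>\<^bsub>mpoly_ring k\<^esub> Q \<in> ker" if "Q \<in> ker" for Q using add[OF P that] by simp
    qed
    show "x \<otimes>\<^bsub>mpoly_ring k\<^esub> a \<in> ker" if "a \<in> ker" "x \<in> carrier (mpoly_ring k)" for a x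
      using mult[OF that] by (simp add: mult.commute)
    show "a \<otimes>\<^bsub>mpoly_ring k\<^esub> x \<in> ker" if "a \<in> ker" "x \<in> carrier (mpoly_ring k)" for a x
      using mult[OF that] by simp
  qed
qed

lemma homogeneous_in_ker:
  assumes "P \<in> carrier (mpoly_ring k)" "\<And>m. m \<in> keys P \<Longrightarrow> mon_deg m = n" "P \<in> filt (Suc n)"
  shows "P \<in> ker"
proof -
  have "hom_part l P = (if l = n then P else 0)" for l
    using assms(2) by (intro poly_mapping_eqI) (auto simp: lookup_hom_part in_keys_iff)
  then show ?thesis using assms(1,3) by (auto simp: ker_def filt_0)
qed

lemma relations_in_ker: "elementary_abelian_relations p k \<subseteq> ker"
proof -
  have "of_nat p * mpoly_var i \<in> ker" if i: "i \<in> {1..k}" for i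
  proof (rule homogeneous_in_ker[where n = 1])
    show "of_nat p * mpoly_var i \<in> carrier (mpoly_ring k)" using p_var_filt(1)[OF i] by (simp add: filt_def)
    show "mon_deg m = 1" if "m \<in> keys (of_nat p * mpoly_var i)" for m
    proof -
      have "of_nat p * mpoly_var i = single (single i 1) (int p)"
        by (simp add: mpoly_var_def mult_single flip: single_of_nat)
      then show ?thesis using that by (auto split: if_splits)
    qed
    show "of_nat p * mpoly_var i \<in> filt (Suc 1)"
      using p_var_filt(1)[OF i] p_gt_1 by (intro filt_antimono[of "Suc 1" p]) auto
  qed
  moreover have "mpoly_var i ^ p * mpoly_var j - mpoly_var i * mpoly_var j ^ p \<in> ker"
    if i: "i \<in> {1..k}" and j: "j \<in> {1..k}" for i j
  proof (rule homogeneous_in_ker[where n = "Suc p"])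
    let ?x = "mpoly_var i" and ?y = "mpoly_var j"
    \<comment> \<open>The two copies of \<open>p x y\<close> cancel, and the difference keeps the
      extra degree of \<open>p x + x^p\<close> and of \<open>p y + y^p\<close>.\<close>
    have "(of_nat p * ?x + ?x ^ p) * ?y - ?x * (of_nat p * ?y + ?y ^ p) \<in> filt (Suc (Suc p))"
    proof (rule filt_diff)
      show "(of_nat p * ?x + ?x ^ p) * ?y \<in> filt (Suc (Suc p))"
        using filt_mult[OF p_var_filt(2)[OF i] filt_var_power[OF j, of 1]] by simp
      show "?x * (of_nat p * ?y + ?y ^ p) \<in> filt (Suc (Suc p))"
        using filt_mult[OF filt_var_power[OF i, of 1] p_var_filt(2)[OF j]] by simp
    qed
    also have "(of_nat p * ?x + ?x ^ p) * ?y - ?x * (of_nat p * ?y + ?y ^ p) = ?x ^ p * ?y - ?x * ?y ^ p"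
      by (simp add: algebra_simps)
    finally show f: "?x ^ p * ?y - ?x * ?y ^ p \<in> filt (Suc (Suc p))" .
    then show "?x ^ p * ?y - ?x * ?y ^ p \<in> carrier (mpoly_ring k)" by (simp add: filt_def)
    fix m assume m: "m \<in> keys (?x ^ p * ?y - ?x * ?y ^ p)"
    have "?x ^ p * ?y - ?x * ?y ^ p = single (single i p + single j 1) 1 - single (single i 1 + single j p) 1"
      unfolding mpoly_var_power by (simp add: mpoly_var_def mult_single)
    then have "m \<in> {single i p + single j 1, single i 1 + single j p}"
      using m by (auto simp: in_keys_iff lookup_minus lookup_single when_def split: if_splits)
    then show "mon_deg m = Suc p" by (auto simp: mon_deg_add)
  qed
  ultimately show ?thesis unfolding elementary_abelian_relations_def by blast
qed

text \<open>At the elements \<open>g\<^sub>j\<close> with \<open>i\<close>-th entry \<open>gen^(j a\<^sub>i)\<close> the values of \<open>ev P\<close> are those of an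
  integral polynomial in one variable at \<open>\<zeta>\<^sup>j\<close>.\<close>

lemma homogeneous_filt_vanishing:
  assumes P: "P \<in> carrier (mpoly_ring k)" and hom: "\<And>m. m \<in> keys P \<Longrightarrow> mon_deg m = n"
    and filt: "P \<in> filt (Suc n)"
  shows "int p dvd mpoly_eval (\<lambda>i. int (a i)) P"
proof -
  define Y :: "int poly" where "Y = [:-1, 1:]"
  let ?\<phi> = "\<lambda>f (w::complex). poly (map_poly of_int f) w"
  \<comment> \<open>The cofactor of \<open>Y = X - 1\<close> in \<open>X^(a i) - 1\<close>. Its
    value at 1 is \<open>a i\<close>, which is how the point \<open>a\<close> enters the
    conclusion.\<close>
  define S where "S i = (\<Sum>l<a i. [:0, 1:] ^ l :: int poly)" for i
  have YS: "Y * S i = [:0, 1:] ^ a i - 1" for i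
  proof -
    have "Y = [:0, 1:] - 1" by (simp add: Y_def one_pCons)
    then show ?thesis using power_diff_1_eq[of "[:0, 1:] :: int poly" "a i"] by (simp add: S_def)
  qed
  obtain Q where Q: "Q \<in> deg_ge k (Suc n)" and PQ: "ev P = ev Q" using filt by (auto simp: filt_def E_def)
  \<comment> \<open>Along this line \<open>P\<close> takes the value \<open>Y ^ n * H\<close>,
    whereas the value of \<open>Q\<close> is divisible by \<open>Y ^ Suc n\<close>. At a root of
    unity \<open>w \<noteq> 1\<close> the common factor \<open>(w - 1) ^ n\<close> cancels.\<close>
  define H where "H = mpoly_eval S P"
  have evP: "mpoly_eval (\<lambda>i. Y * S i) P = Y ^ n * H"
    unfolding H_def by (rule mpoly_eval_scale_homogeneous[OF hom])
  have "Y ^ Suc n dvd mpoly_eval (\<lambda>i. Y * S i) Q"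
    using Q by (intro mpoly_eval_scale_dvd) (auto simp: deg_ge_def)
  then obtain h where h: "mpoly_eval (\<lambda>i. Y * S i) Q = Y ^ Suc n * h" by blast
  have "int p dvd poly (H - Y * h) 1"
  proof (rule prime_dvd_poly_at_1)
    fix j assume j: "0 < j" "j < p"
    define w where "w = zeta ^ j"
    have w: "w \<noteq> 1" using j zeta(2)[of j] by (auto simp: w_def dest: dvd_imp_le)
    define g where "g = (\<lambda>i\<in>{1..k}. gen [^]\<^bsub>C\<^esub> (j * a i))"
    have g: "g \<in> carrier G" using gen(1) by (auto simp: g_def carrier_G)
    have pt: "pt g i = ?\<phi> (Y * S i) w" if "i \<in> {1..k}" for i
    proof -
      have "lin (g i) = w ^ a i" using that
        by (simp add: g_def lin_def dlog_gen zeta_mod w_def power_mult)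
      moreover have "?\<phi> (Y * S i) w = w ^ a i - 1"
        unfolding YS by (simp add: of_int_poly_hom.hom_minus of_int_poly_hom.hom_power map_poly_pCons)
      ultimately show ?thesis by (simp add: pt_def)
    qed
    have val: "ev R g = ?\<phi> (mpoly_eval (\<lambda>i. Y * S i) R) w" if "R \<in> carrier (mpoly_ring k)" for R
    proof -
      have "mpoly_eval (pt g) R = mpoly_eval (\<lambda>i. ?\<phi> (Y * S i) w) R"
        by (rule mpoly_eval_cong[OF that pt])
      then show ?thesis by (simp only: ev_apply[OF g] poly_mpoly_eval)
    qed
    have Qc: "Q \<in> carrier (mpoly_ring k)" using Q deg_ge_carrier by blast
    have "?\<phi> (Y ^ n * H) w = ?\<phi> (Y ^ Suc n * h) w"
      unfolding evP[symmetric] h[symmetric] by (simp only: val[OF P, symmetric] val[OF Qc, symmetric] PQ)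
    moreover have "?\<phi> Y w = w - 1" by (simp add: Y_def)
    ultimately have "(w - 1) ^ n * ?\<phi> H w = (w - 1) ^ n * ((w - 1) * ?\<phi> h w)"
      by (simp add: of_int_poly_hom.hom_mult of_int_poly_hom.hom_power mult_ac)
    then have "?\<phi> H w = (w - 1) * ?\<phi> h w" using w by simp
    with \<open>?\<phi> Y w = w - 1\<close> show "?\<phi> (H - Y * h) (zeta ^ j) = 0"
      by (simp add: of_int_poly_hom.hom_mult of_int_poly_hom.hom_minus flip: w_def)
  qed
  also have "poly (H - Y * h) 1 = poly H 1" by (simp add: Y_def)
  also have "\<dots> = mpoly_eval (\<lambda>i. int (a i)) P"
  proof -
    have "poly (mpoly_eval S R) 1 = mpoly_eval (\<lambda>i. poly (S i) 1) R" for R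
      by (simp add: mpoly_eval_def mon_eval_def poly_sum poly_prod)
    moreover have "poly (S i) 1 = int (a i)" for i by (simp add: S_def poly_sum)
    ultimately show ?thesis by (simp add: H_def)
  qed
  finally show ?thesis .
qed

text \<open>Both sides are compared one homogeneous part at a time. In positive degree, divisibility
  by \<open>p\<close> at all points suffices; in degree 0 the constant must be zero
  outright.\<close>

lemma ker_eq: "ker = Idl\<^bsub>mpoly_ring k\<^esub> (elementary_abelian_relations p k)"
proof (rule antisym)
  interpret R: cring "mpoly_ring k" by (rule cring_mpoly_ring)
  have rel: "elementary_abelian_relations p k \<subseteq> carrier (mpoly_ring k)"
    using relations_in_ker by (auto simp: ker_def)
  show "Idl\<^bsub>mpoly_ring k\<^esub> (elementary_abelian_relations p k) \<subseteq> ker"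
    by (rule R.genideal_minimal[OF ideal_ker relations_in_ker])
  let ?J = "Idl\<^bsub>mpoly_ring k\<^esub> (elementary_abelian_relations p k)"
  interpret J: relations_ideal p k ?J
    by (rule relations_ideal.intro[OF prime_p R.genideal_ideal[OF rel] R.genideal_self[OF rel]])
  show "ker \<subseteq> ?J"
  proof
    fix P assume P: "P \<in> ker"
    then have Pc: "P \<in> carrier (mpoly_ring k)" by (simp add: ker_def)
    have hom: "hom_part n P \<in> ?J" for n
    proof (cases "n = 0")
      case True
      \<comment> \<open>All \<open>u_i\<close> vanish at the identity of the group, so evaluation
        there annihilates order at least 1 and returns the constant term.\<close>
      have "mpoly_eval (\<lambda>_. 0 :: complex) Q = 0" if "Q \<in> deg_ge k 1" for Q
      proof -
        have "0 ^ 1 dvd mpoly_eval (\<lambda>i. 0 * (0 :: complex)) Q"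
          using that by (intro mpoly_eval_scale_dvd) (auto simp: deg_ge_def)
        then show ?thesis by simp
      qed
      moreover obtain Q where "Q \<in> deg_ge k 1" "ev (hom_part 0 P) = ev Q"
        using P by (auto simp: ker_def filt_def E_def)
      moreover have "ev Q \<one>\<^bsub>G\<^esub> = mpoly_eval (\<lambda>_. 0) Q" if "Q \<in> carrier (mpoly_ring k)" for Q
      proof -
        have "ev Q \<one>\<^bsub>G\<^esub> = mpoly_eval (pt \<one>\<^bsub>G\<^esub>) Q" by (rule ev_apply) simp
        also have "\<dots> = mpoly_eval (\<lambda>_. 0) Q"
          by (rule mpoly_eval_cong[OF that]) (simp add: pt_def G_def lin_one)
        finally show ?thesis .
      qed
      ultimately have ev0: "mpoly_eval (\<lambda>_. 0 :: complex) (hom_part 0 P) = 0"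
        using mpoly_ring_hom_part[OF Pc, of 0] deg_ge_carrier by (metis subsetD)
      have "hom_part 0 P = single 0 (lookup P 0)"
      proof (rule poly_mapping_eqI)
        fix m
        have "mon_deg m = 0 \<Longrightarrow> m = 0"
          using lookup_le_mon_deg[of m] by (intro poly_mapping_eqI) auto
        then show "lookup (hom_part 0 P) m = lookup (single 0 (lookup P 0)) m"
          by (auto simp: lookup_hom_part lookup_single when_def)
      qed
      moreover from this have "lookup P 0 = 0" using ev0 by simp
      ultimately have "hom_part 0 P = 0" by simp
      then show ?thesis using True J.J(1) by simp
    next
      case False
      show ?thesis
      proof (rule J.vanishing_in_ideal)
        show "hom_part n P \<in> carrier (mpoly_ring k)" by (rule mpoly_ring_hom_part[OF Pc])
        show "mon_deg m = n" if "m \<in> keys (hom_part n P)" for m using that by (simp add: keys_hom_part)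
        show "n > 0" using False by simp
        show "int p dvd mpoly_eval (\<lambda>i. int (a i)) (hom_part n P)" for a
          using P mpoly_ring_hom_part[OF Pc]
          by (intro homogeneous_filt_vanishing[where n = n]) (auto simp: keys_hom_part ker_def)
      qed
    qed
    \<comment> \<open>The inserted 0 keeps the maximum meaningful when \<open>P\<close> is
      zero.\<close>
    define N where "N = Suc (Max (insert 0 (mon_deg ` keys P)))"
    have "mon_deg m < N" if "m \<in> keys P" for m
      using that by (auto simp: N_def less_Suc_eq_le intro: Max_ge)
    then have "(\<Sum>n<N. hom_part n P) = P" by (rule mpoly_sum_hom_parts)
    then show "P \<in> ?J" using J.J_sum[of "{..<N}" "\<lambda>n. hom_part n P"] hom by simp
  qed
qed

end

section \<open>The graded ring\<close>

context elementary_abelian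
begin

definition layer :: "nat \<Rightarrow> ((nat \<Rightarrow> 'a) \<Rightarrow> complex) monoid" where
  "layer n = add_monoid ((char_ring G)\<lparr>carrier := E n\<rparr>)"

text \<open>A single name for two cosets with the same elements: the one in the group
  \<open>layer n\<close>, and the one in \<open>char_ring G\<close> that occurs in
  \<open>rcoset_mult\<close>.\<close>

definition cls :: "nat \<Rightarrow> ((nat \<Rightarrow> 'a) \<Rightarrow> complex) \<Rightarrow> ((nat \<Rightarrow> 'a) \<Rightarrow> complex) set" where
  "cls n x = (\<lambda>h. h \<boxplus> x) ` E (Suc n)"

lemma layer_simps [simp]:
  "carrier (layer n) = E n" "x \<otimes>\<^bsub>layer n\<^esub> y = x \<boxplus> y" "\<one>\<^bsub>layer n\<^esub> = cst 0"
  by (simp_all add: layer_def zero_V)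

lemma E_ext: "x \<in> E n \<Longrightarrow> x \<in> extensional (carrier G)"
  using E_closed V_extensional by blast

lemma E_Suc_in: "x \<in> E (Suc n) \<Longrightarrow> x \<in> E n"
  using E_Suc by blast

lemma comm_group_layer: "comm_group (layer n)"
proof (rule comm_groupI)
  fix x assume "x \<in> carrier (layer n)"
  then have x: "x \<in> E n" by simp
  show "\<one>\<^bsub>layer n\<^esub> \<otimes>\<^bsub>layer n\<^esub> x = x" using E_ext[OF x] by (auto intro: V_eqI)
  show "\<exists>y\<in>carrier (layer n). y \<otimes>\<^bsub>layer n\<^esub> x = \<one>\<^bsub>layer n\<^esub>"
    using E_neg[OF x] by (auto intro!: bexI[of _ "neg x"] V_eqI)
qed (auto simp: E_add E_zero intro: V_eqI)

lemma subgroup_layer: "subgroup (E (Suc n)) (layer n)"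
proof -
  interpret L: comm_group "layer n" by (rule comm_group_layer)
  show ?thesis
  proof (rule L.subgroupI)
    show "E (Suc n) \<subseteq> carrier (layer n)" using E_Suc by simp
    show "E (Suc n) \<noteq> {}" using E_zero by blast
    fix x assume x: "x \<in> E (Suc n)"
    have "inv\<^bsub>layer n\<^esub> x = neg x"
      using E_neg[OF E_Suc_in[OF x]] E_Suc_in[OF x] by (intro L.inv_equality) (auto intro: V_eqI)
    then show "inv\<^bsub>layer n\<^esub> x \<in> E (Suc n)" using E_neg[OF x] by simp
    show "x \<otimes>\<^bsub>layer n\<^esub> y \<in> E (Suc n)" if "y \<in> E (Suc n)" for y using E_add[OF x that] by simp
  qed
qed

lemma graded_piece_eq: "graded_piece G n = layer n Mod E (Suc n)"
  by (simp add: graded_piece_def layer_def gamma_filtration_eq)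

lemma r_coset_layer: "r_coset (layer n) (E (Suc n)) x = cls n x"
  by (auto simp: r_coset_def cls_def)

lemma a_r_coset_cls: "a_r_coset (char_ring G) (E (Suc n)) x = cls n x"
  by (auto simp: a_r_coset_def r_coset_def cls_def)

lemma comm_group_graded_piece: "comm_group (graded_piece G n)"
  unfolding graded_piece_eq by (rule comm_group.abelian_FactGroup[OF comm_group_layer subgroup_layer])

lemma carrier_graded_piece: "carrier (graded_piece G n) = cls n ` E n"
  by (simp add: graded_piece_eq carrier_FactGroup r_coset_layer)

lemma one_graded_piece: "\<one>\<^bsub>graded_piece G n\<^esub> = E (Suc n)"
  by (simp add: graded_piece_eq)

lemma cls_mult:
  assumes "x \<in> E n" "y \<in> E n"
  shows "cls n x \<otimes>\<^bsub>graded_piece G n\<^esub> cls n y = cls n (x \<boxplus> y)"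
proof -
  have "E (Suc n) \<lhd> layer n"
    by (rule comm_group.subgroup_imp_normal[OF comm_group_layer subgroup_layer])
  from normal.rcos_sum[OF this, of x y] assms show ?thesis
    by (simp add: graded_piece_eq r_coset_layer)
qed

lemma cls_eq_iff:
  assumes "x \<in> E n" "y \<in> E n"
  shows "cls n x = cls n y \<longleftrightarrow> x \<boxplus> neg y \<in> E (Suc n)"
proof
  assume "cls n x = cls n y"
  moreover have "x \<in> cls n x" unfolding cls_def
    by (rule image_eqI[OF _ E_zero]) (use E_ext[OF assms(1)] in \<open>auto intro: V_eqI\<close>)
  ultimately obtain h where h: "h \<in> E (Suc n)" "x = h \<boxplus> y" unfolding cls_def by blast
  have "x \<boxplus> neg y = h" unfolding h(2) using E_ext[OF h(1)] by (intro V_eqI) auto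
  then show "x \<boxplus> neg y \<in> E (Suc n)" using h(1) by simp
next
  assume d: "x \<boxplus> neg y \<in> E (Suc n)"
  show "cls n x = cls n y"
  proof (intro equalityI subsetI)
    fix w assume "w \<in> cls n x"
    then obtain h where h: "h \<in> E (Suc n)" "w = h \<boxplus> x" unfolding cls_def by blast
    have "w = (h \<boxplus> (x \<boxplus> neg y)) \<boxplus> y" unfolding h(2) by (rule V_eqI) auto
    then show "w \<in> cls n y" unfolding cls_def using E_add[OF h(1) d] by blast
  next
    fix w assume "w \<in> cls n y"
    then obtain h where h: "h \<in> E (Suc n)" "w = h \<boxplus> y" unfolding cls_def by blast
    have "w = (h \<boxplus> neg (x \<boxplus> neg y)) \<boxplus> x" unfolding h(2) by (rule V_eqI) auto
    then show "w \<in> cls n x" unfolding cls_def using E_add[OF h(1) E_neg[OF d]] by blast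
  qed
qed

lemma cls_zero: "cls n (cst 0) = E (Suc n)"
proof -
  have "h \<boxplus> cst 0 = h" if "h \<in> E (Suc n)" for h using E_ext[OF that] by (intro V_eqI) auto
  then show ?thesis by (force simp: cls_def)
qed

lemma finprod_cls:
  assumes "finite I" "\<And>i. i \<in> I \<Longrightarrow> ev (f i) \<in> E n"
  shows "(\<Otimes>\<^bsub>graded_piece G n\<^esub>i\<in>I. cls n (ev (f i))) = cls n (ev (\<Sum>i\<in>I. f i)) \<and> ev (\<Sum>i\<in>I. f i) \<in> E n"
proof -
  interpret Q: comm_group "graded_piece G n" by (rule comm_group_graded_piece)
  show ?thesis using assms
  proof (induction I rule: finite_induct)
    case empty
    then show ?case by (simp add: one_graded_piece ev_0 cls_zero E_zero)
  next
    case (insert i I)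
    then have "(\<lambda>i. cls n (ev (f i))) \<in> I \<rightarrow> carrier (graded_piece G n)" "cls n (ev (f i)) \<in> carrier (graded_piece G n)"
      by (auto simp: carrier_graded_piece)
    then show ?case using insert by (simp add: cls_mult ev_add E_add)
  qed
qed

text \<open>\<open>rcoset_mult\<close> is a union over all pairs of representatives. With
  \<open>a = h + x\<close> and \<open>b = l + y\<close> one has
  \<open>a b - x y = h b + x l\<close>, which lies one degree above \<open>i + j\<close>, so all
  pairs give the same coset.\<close>

lemma rcoset_mult_cls:
  assumes "x \<in> E i" "y \<in> E j"
  shows "rcoset_mult (char_ring G) (E (Suc (i + j))) (cls i x) (cls j y) = cls (i + j) (x \<boxtimes> y)"
proof -
  have "cls (i + j) (a \<boxtimes> b) = cls (i + j) (x \<boxtimes> y)" if ab: "a \<in> cls i x" "b \<in> cls j y" for a b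
  proof -
    obtain h l where h: "h \<in> E (Suc i)" "a = h \<boxplus> x" and l: "l \<in> E (Suc j)" "b = l \<boxplus> y"
      using ab unfolding cls_def by blast
    have a: "a \<in> E i" unfolding h(2) using h(1) assms(1) E_add E_Suc_in by blast
    have b: "b \<in> E j" unfolding l(2) using l(1) assms(2) E_add E_Suc_in by blast
    have "a \<boxtimes> b \<boxplus> neg (x \<boxtimes> y) = h \<boxtimes> b \<boxplus> x \<boxtimes> l"
      by (rule V_eqI) (auto simp: h(2) l(2) algebra_simps)
    moreover have "h \<boxtimes> b \<in> E (Suc (i + j))" "x \<boxtimes> l \<in> E (Suc (i + j))"
      using E_mult[OF h(1) b] E_mult[OF assms(1) l(1)] by simp_all
    ultimately have "a \<boxtimes> b \<boxplus> neg (x \<boxtimes> y) \<in> E (Suc (i + j))" using E_add by simp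
    then show ?thesis using cls_eq_iff E_mult[OF a b] E_mult[OF assms] by blast
  qed
  \<comment> \<open>Without representatives the union would be empty.\<close>
  moreover have "cls i x \<noteq> {}" "cls j y \<noteq> {}" using E_zero by (auto simp: cls_def)
  ultimately show ?thesis unfolding rcoset_mult_def a_r_coset_cls by blast
qed

section \<open>The map from polynomials onto the graded ring\<close>

definition Phi :: "int_mpoly \<Rightarrow> nat \<Rightarrow> ((nat \<Rightarrow> 'a) \<Rightarrow> complex) set" where
  "Phi P n = cls n (ev (hom_part n P))"

lemma ev_hom_part: "P \<in> carrier (mpoly_ring k) \<Longrightarrow> ev (hom_part n P) \<in> E n"
  by (intro ev_in_E hom_part_deg_ge)

lemma carrier_graded: "carrier (graded_char_ring G) =
  {x. (\<forall>n. x n \<in> cls n ` E n) \<and> finite {n. x n \<noteq> E (Suc n)}}"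
proof -
  have "group (graded_piece G n)" for n using comm_group_graded_piece comm_group.axioms(2) by blast
  then show ?thesis
    by (auto simp: graded_char_ring_def carrier_sum_group carrier_graded_piece one_graded_piece)
qed

lemma Phi_add:
  assumes "P \<in> carrier (mpoly_ring k)" "Q \<in> carrier (mpoly_ring k)"
  shows "Phi (P + Q) = Phi P \<oplus>\<^bsub>graded_char_ring G\<^esub> Phi Q"
  using assms by (auto simp: graded_char_ring_def Phi_def cls_mult ev_hom_part hom_part_add ev_add)

lemma Phi_mult:
  assumes "P \<in> carrier (mpoly_ring k)" "Q \<in> carrier (mpoly_ring k)"
  shows "Phi (P * Q) = Phi P \<otimes>\<^bsub>graded_char_ring G\<^esub> Phi Q"
proof
  fix n
  interpret Q: comm_group "graded_piece G n" by (rule comm_group_graded_piece)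
  have E: "ev (hom_part i P * hom_part (n - i) Q) \<in> E n" if "i \<in> {..n}" for i
    using E_mult[OF ev_hom_part[OF assms(1), of i] ev_hom_part[OF assms(2), of "n - i"]] that
    by (simp add: ev_mult)
  have "(Phi P \<otimes>\<^bsub>graded_char_ring G\<^esub> Phi Q) n
    = (\<Otimes>\<^bsub>graded_piece G n\<^esub>i\<in>{..n}. rcoset_mult (char_ring G) (E (Suc n)) (Phi P i) (Phi Q (n - i)))"
    by (simp add: graded_char_ring_def gamma_filtration_eq)
  also have "\<dots> = (\<Otimes>\<^bsub>graded_piece G n\<^esub>i\<in>{..n}. cls n (ev (hom_part i P * hom_part (n - i) Q)))"
  proof (rule Q.finprod_cong')
    show "(\<lambda>i. cls n (ev (hom_part i P * hom_part (n - i) Q))) \<in> {..n} \<rightarrow> carrier (graded_piece G n)"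
      using E by (auto simp: carrier_graded_piece)
    fix i assume i: "i \<in> {..n}"
    then have "i + (n - i) = n" by simp
    then show "rcoset_mult (char_ring G) (E (Suc n)) (Phi P i) (Phi Q (n - i))
      = cls n (ev (hom_part i P * hom_part (n - i) Q))"
      using rcoset_mult_cls[OF ev_hom_part[OF assms(1), of i] ev_hom_part[OF assms(2), of "n - i"]]
      by (simp add: Phi_def ev_mult)
  qed simp
  also have "\<dots> = Phi (P * Q) n"
    using finprod_cls[of "{..n}" "\<lambda>i. hom_part i P * hom_part (n - i) Q" n] E
    by (simp add: Phi_def hom_part_mult)
  finally show "Phi (P * Q) n = (Phi P \<otimes>\<^bsub>graded_char_ring G\<^esub> Phi Q) n" by simp
qed

lemma Phi_one: "Phi 1 = \<one>\<^bsub>graded_char_ring G\<^esub>"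
proof
  fix n
  show "Phi 1 n = \<one>\<^bsub>graded_char_ring G\<^esub> n"
    using a_r_coset_cls[of 0 "cst 1"]
    by (simp add: graded_char_ring_def Phi_def hom_part_1 gamma_filtration_eq one_V ev_0 ev_1 cls_zero one_graded_piece)
qed

lemma Phi_eq_iff:
  assumes "P \<in> carrier (mpoly_ring k)" "Q \<in> carrier (mpoly_ring k)"
  shows "Phi P = Phi Q \<longleftrightarrow> P - Q \<in> ker"
proof -
  have "Phi P n = Phi Q n \<longleftrightarrow> hom_part n (P - Q) \<in> filt (Suc n)" for n
    using cls_eq_iff[OF ev_hom_part[OF assms(1)] ev_hom_part[OF assms(2)], of n]
      mpoly_ring_hom_part[OF mpoly_ring_diff[OF assms]]
    by (simp add: Phi_def filt_def hom_part_diff ev_diff)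
  then show ?thesis using mpoly_ring_diff[OF assms] by (auto simp: ker_def fun_eq_iff)
qed

lemma Phi_closed:
  assumes "P \<in> carrier (mpoly_ring k)"
  shows "Phi P \<in> carrier (graded_char_ring G)"
proof -
  have "{n. Phi P n \<noteq> E (Suc n)} \<subseteq> mon_deg ` keys P"
  proof
    fix n assume n: "n \<in> {n. Phi P n \<noteq> E (Suc n)}"
    show "n \<in> mon_deg ` keys P"
    proof (rule ccontr)
      assume "n \<notin> mon_deg ` keys P"
      then have "hom_part n P = 0"
        by (intro poly_mapping_eqI) (auto simp: lookup_hom_part in_keys_iff image_iff)
      then show False using n by (simp add: Phi_def ev_0 cls_zero)
    qed
  qed
  then have "finite {n. Phi P n \<noteq> E (Suc n)}" by (rule finite_subset) simp
  then show ?thesis using ev_hom_part[OF assms] by (auto simp: carrier_graded Phi_def)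
qed

text \<open>Only finitely many components are nontrivial, so representatives in these degrees can be
  added up.\<close>

lemma Phi_surj:
  assumes s: "s \<in> carrier (graded_char_ring G)"
  shows "\<exists>P\<in>carrier (mpoly_ring k). Phi P = s"
proof -
  define I where "I = {n. s n \<noteq> E (Suc n)}"
  have fin: "finite I" using s by (simp add: carrier_graded I_def)
  have "\<exists>Q\<in>deg_ge k n. s n = cls n (ev Q)" for n
    using s unfolding carrier_graded E_def by blast
  then obtain Q where Q: "\<And>n. Q n \<in> deg_ge k n" "\<And>n. s n = cls n (ev (Q n))" by metis
  have Qc: "Q n \<in> carrier (mpoly_ring k)" for n using Q(1) deg_ge_carrier by blast
  \<comment> \<open>\<open>Q n\<close> may have terms of higher order. They do not affect its class
    in degree \<open>n\<close>, but would disturb other components of \<open>P\<close>, so only the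
    homogeneous part is kept.\<close>
  define P where "P = (\<Sum>n\<in>I. hom_part n (Q n))"
  have Pc: "P \<in> carrier (mpoly_ring k)"
    unfolding P_def by (intro mpoly_ring_sum mpoly_ring_hom_part Qc)
  have hh: "hom_part n (hom_part l R) = (if n = l then hom_part l R else 0)" for n l R
    by (rule poly_mapping_eqI) (auto simp: lookup_hom_part)
  have hP: "hom_part n P = (if n \<in> I then hom_part n (Q n) else 0)" for n
    using fin by (simp add: P_def hom_part_sum hh)
  have "Phi P n = s n" for n
  proof (cases "n \<in> I")
    case True
    have "ev (Q n) \<boxplus> neg (ev (hom_part n (Q n))) \<in> E (Suc n)"
      using ev_in_E[OF diff_hom_part_deg_ge[OF Q(1)[of n]]] by (simp add: ev_diff)
    then have "cls n (ev (Q n)) = cls n (ev (hom_part n (Q n)))"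
      using cls_eq_iff[OF ev_in_E[OF Q(1)[of n]] ev_hom_part[OF Qc]] by blast
    then show ?thesis using True Q(2) by (simp add: Phi_def hP)
  next
    case False
    then show ?thesis by (simp add: Phi_def hP ev_0 cls_zero I_def)
  qed
  then show ?thesis using Pc by blast
qed

text \<open>The isomorphism goes from the graded ring to the quotient: an element is sent to its
  fibre under \<open>Phi\<close>, which is a coset of \<open>ker\<close>. Injectivity is then
  immediate, as nonempty fibres determine their base point.\<close>

lemma graded_char_ring_iso: "graded_char_ring G \<simeq> mpoly_ring k Quot ker"
proof -
  let ?R = "mpoly_ring k" and ?S = "graded_char_ring G"
  interpret I: ideal ker ?R by (rule ideal_ker)
  define Psi where "Psi s = {P \<in> carrier ?R. Phi P = s}" for s
  have ker_sub: "ker \<subseteq> carrier ?R" by (rule ideal_mpoly_ringD(6)[OF ideal_ker])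
  have Psi: "Psi (Phi P) = ker +>\<^bsub>?R\<^esub> P" if P: "P \<in> carrier ?R" for P
  proof -
    have "Psi (Phi P) = {Q \<in> carrier ?R. Q - P \<in> ker}" unfolding Psi_def using Phi_eq_iff[OF _ P] by blast
    also have "\<dots> = (\<lambda>h. h + P) ` ker"
    proof (intro equalityI subsetI)
      fix Q assume "Q \<in> {Q \<in> carrier ?R. Q - P \<in> ker}"
      then show "Q \<in> (\<lambda>h. h + P) ` ker" by (intro image_eqI[of _ _ "Q - P"]) auto
    next
      fix Q assume "Q \<in> (\<lambda>h. h + P) ` ker"
      then obtain h where "h \<in> ker" "Q = h + P" by blast
      then show "Q \<in> {Q \<in> carrier ?R. Q - P \<in> ker}"
        using mpoly_ring_add[OF _ P] ker_sub by auto
    qed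
    also have "\<dots> = ker +>\<^bsub>?R\<^esub> P" by (auto simp: a_r_coset_def r_coset_def)
    finally show ?thesis .
  qed
  have "Psi \<in> Ring.ring_hom ?S (?R Quot ker)"
  proof (rule ring_hom_memI)
    fix s t assume "s \<in> carrier ?S" "t \<in> carrier ?S"
    then obtain P Q where P: "P \<in> carrier ?R" "Phi P = s" and Q: "Q \<in> carrier ?R" "Phi Q = t"
      using Phi_surj by metis
    show "Psi s \<in> carrier (?R Quot ker)"
      unfolding P(2)[symmetric] Psi[OF P(1)] using P(1) by (auto simp: FactRing_def A_RCOSETS_def' )
    have "Psi (s \<otimes>\<^bsub>?S\<^esub> t) = ker +>\<^bsub>?R\<^esub> (P * Q)"
      unfolding P(2)[symmetric] Q(2)[symmetric] Phi_mult[OF P(1) Q(1), symmetric]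
      by (rule Psi[OF mpoly_ring_mult[OF P(1) Q(1)]])
    then show "Psi (s \<otimes>\<^bsub>?S\<^esub> t) = Psi s \<otimes>\<^bsub>?R Quot ker\<^esub> Psi t"
      using I.rcoset_mult_add[OF P(1) Q(1)]
      by (simp add: FactRing_def P(2)[symmetric] Q(2)[symmetric] Psi P(1) Q(1))
    have "Psi (s \<oplus>\<^bsub>?S\<^esub> t) = ker +>\<^bsub>?R\<^esub> (P + Q)"
      unfolding P(2)[symmetric] Q(2)[symmetric] Phi_add[OF P(1) Q(1), symmetric]
      by (rule Psi[OF mpoly_ring_add[OF P(1) Q(1)]])
    then show "Psi (s \<oplus>\<^bsub>?S\<^esub> t) = Psi s \<oplus>\<^bsub>?R Quot ker\<^esub> Psi t"
      using I.a_rcos_sum[OF P(1) Q(1)]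
      by (simp add: FactRing_def P(2)[symmetric] Q(2)[symmetric] Psi P(1) Q(1))
  next
    show "Psi \<one>\<^bsub>?S\<^esub> = \<one>\<^bsub>?R Quot ker\<^esub>"
      unfolding Phi_one[symmetric] Psi[OF mpoly_ring_1] by (simp add: FactRing_def)
  qed
  moreover have "bij_betw Psi (carrier ?S) (carrier (?R Quot ker))"
  proof (rule bij_betw_imageI)
    show "inj_on Psi (carrier ?S)"
    proof (rule inj_onI)
      fix s t assume "s \<in> carrier ?S" "Psi s = Psi t"
      moreover obtain P where "P \<in> carrier ?R" "Phi P = s" using Phi_surj[OF calculation(1)] by blast
      ultimately have "P \<in> Psi t" by (auto simp: Psi_def)
      then show "s = t" using \<open>Phi P = s\<close> by (simp add: Psi_def)
    qed
    have "carrier (?R Quot ker) = (\<lambda>P. ker +>\<^bsub>?R\<^esub> P) ` carrier ?R"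
      by (auto simp: FactRing_def A_RCOSETS_def')
    also have "\<dots> = (\<lambda>P. Psi (Phi P)) ` carrier ?R" using Psi by auto
    also have "\<dots> = Psi ` (Phi ` carrier ?R)" by (simp add: image_image)
    also have "Phi ` carrier ?R = carrier ?S" using Phi_closed Phi_surj by fast
    finally show "Psi ` carrier ?S = carrier (?R Quot ker)" by simp
  qed
  ultimately show ?thesis unfolding is_ring_iso_def ring_iso_def by blast
qed

end

theorem theorem1p1:
  fixes C :: "('a, 'b) monoid_scheme" and p k :: nat
  assumes "group C" and "cyclic_group C" and "prime p" and "Coset.order C = p"
  shows "graded_char_ring (product_group {1..k} (\<lambda>_. C)) \<simeq>
           mpoly_ring k Quot (Idl\<^bsub>mpoly_ring k\<^esub> (elementary_abelian_relations p k))"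
proof -
  interpret elementary_abelian C p k
    by (intro elementary_abelian.intro prime_cyclic_group.intro prime_cyclic_group_axioms.intro assms)
  show ?thesis using graded_char_ring_iso unfolding ker_eq G_def .
qed

end
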